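(* Let $\sigma\in\mathcal C$. Then there exist a probability measure $\mu_\sigma$ on $\Omega=\mathcal S'_{\mathbb R^n}(\mathbb R)$, a linear operator $Q_\sigma:\mathcal S_{\mathbb R^n}\to\mathbf L_2(\mathbb R^n,dx)$, and a generalized Gaussian stochastic process $\{X_\sigma(\psi)\}_{\psi\in\mathcal S_{\mathbb R^n}}$ in the white noise space $\mathcal W$ such that $$X_\sigma(\psi)=\widetilde{Q_\sigma(\psi)},\qquad\forall\,\psi\in\mathcal S_{\mathbb R^n},$$ and, for every real-valued $\psi\in\mathcal S_{\mathbb R^n}(\mathbb R)$, $$\int_\Omega e^{i X_\sigma(\psi)(\omega)}\,d\mu_W(\omega)=\int_\Omega e^{i\langle\omega,\psi\rangle}\,d\mu_\sigma(\omega)=e^{-\frac12\|\widehat\psi\|^2_{\mathbf L_2(\sigma)}}.$$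
   Context: $\mathcal S_{\mathbb R^n}$ (resp. $\mathcal S_{\mathbb R^n}(\mathbb R)$) is the space of complex-valued (resp. real-valued) Schwartz functions on $\mathbb R^n$; $\Omega=\mathcal S'_{\mathbb R^n}(\mathbb R)$ is the space of real tempered distributions (the dual of $\mathcal S_{\mathbb R^n}(\mathbb R)$) with its Borel sigma-algebra $\mathcal B$, and $\langle\omega,\psi\rangle$ is the duality pairing. $\widehat\psi(u)=\int_{\mathbb R^n}e^{-iu\cdot x}\psi(x)\,dx$. $\mathcal C$ is the set of positive regular Borel measures $\sigma$ on $\mathbb R^n$ with $\int_{\mathbb R^n}\frac{d\sigma(u)}{(1+|u|^2)^p}<\infty$ for some $p\in\mathbb N$. $\mu_W$ is the white noise measure, i.e. the probability measure on $\Omega$ (given by the Bochner-Minlos theorem) with $\int_\Omega e^{i\langle\omega,\psi\rangle}d\mu_W(\omega)=e^{-\frac12\|\psi\|^2_{\mathbf L_2(\mathbb R^n,dx)}}$ for all $\psi\in\mathcal S_{\mathbb R^n}(\mathbb R)$; the white noise space is $\mathcal W=\mathbf L_2(\Omega,\mathcal B,\mu_W)$. The map $f\mapsto\widetilde f$ is the isometry from real-valued functions of $\mathbf L_2(\mathbb R^n,dx)$ into $\mathcal W$ given by $\widetilde\psi(\omega)=\langle\omega,\psi\rangle$ for $\psi\in\mathcal S_{\mathbb R^n}(\mathbb R)$ and extended by continuity; it is extended complex-linearly to complex-valued $f\in\mathbf L_2(\mathbb R^n,dx)$. A generalized Gaussian stochastic process in $\mathcal W$ is a family of random variables $X(\psi)\in\mathcal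 W$, depending linearly on $\psi\in\mathcal S_{\mathbb R^n}$, such that the real and imaginary parts of any finite subfamily are jointly Gaussian. *)

theory Defs
  imports "HOL-Probability.Probability"
begin

section \<open>Schwartz functions\<close>

text \<open>The codomain is polymorphic: it is \<^typ>\<open>complex\<close> for complex-valued and
  \<^typ>\<open>real\<close> for real-valued Schwartz functions.\<close>

definition partial_deriv ::
    "'n \<Rightarrow> (real^'n \<Rightarrow> 'b) \<Rightarrow> real^'n \<Rightarrow> 'b::real_normed_vector" where
  "partial_deriv i f x = frechet_derivative f (at x) (axis i 1)"

primrec iter_partial ::
    "'n list \<Rightarrow> (real^'n \<Rightarrow> 'b) \<Rightarrow> real^'n \<Rightarrow> 'b::real_normed_vector" where
  "iter_partial [] f = f"
| "iter_partial (i # is) f = partial_deriv i (iter_partial is f)"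

definition smooth :: "(real^'n \<Rightarrow> 'b::real_normed_vector) \<Rightarrow> bool" where
  "smooth f \<longleftrightarrow> (\<forall>is x. iter_partial is f differentiable (at x))"

definition schwartz :: "(real^'n \<Rightarrow> 'b::real_normed_vector) set" where
  "schwartz = {f. smooth f \<and>
     (\<forall>k is. bdd_above (range (\<lambda>x. norm x ^ k * norm (iter_partial is f x))))}"

definition schwartz_seminorm ::
    "nat \<Rightarrow> 'n list \<Rightarrow> (real^'n \<Rightarrow> 'b::real_normed_vector) \<Rightarrow> real" where
  "schwartz_seminorm k is f = (SUP x. norm x ^ k * norm (iter_partial is f x))"

definition schwartz_topology :: "(real^'n \<Rightarrow> 'b::real_normed_vector) topology" where
  "schwartz_topology = topology_generated_by
     {{g \<in> schwartz. schwartz_seminorm k is (\<lambda>x. g x - f x) < e} | f k is e.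
        f \<in> schwartz \<and> 0 < e}"


section \<open>Real tempered distributions\<close>

text \<open>A distribution is an extensional function on the real Schwartz space (it is
  \<^const>\<open>undefined\<close> elsewhere), so that equality of distributions is equality in HOL.
  The pairing of \<open>\<omega>\<close> with \<open>\<psi>\<close> is the application \<open>\<omega> \<psi>\<close>.\<close>

definition tempered :: "((real^'n \<Rightarrow> real) \<Rightarrow> real) set" where
  "tempered = {\<omega> \<in> extensional schwartz.
     (\<forall>\<phi>\<in>schwartz. \<forall>\<psi>\<in>schwartz. \<forall>a b.
        \<omega> (\<lambda>x. a * \<phi> x + b * \<psi> x) = a * \<omega> \<phi> + b * \<omega> \<psi>) \<and>
     continuous_map schwartz_topology euclideanreal \<omega>}"

text \<open>The weak-* topology, i.e. that of pointwise convergence on Schwartz functions.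
  (The strong dual topology has the same Borel sets.)\<close>

definition tempered_topology :: "((real^'n \<Rightarrow> real) \<Rightarrow> real) topology" where
  "tempered_topology =
     subtopology (product_topology (\<lambda>_. euclideanreal) schwartz) tempered"

definition tempered_borel :: "((real^'n \<Rightarrow> real) \<Rightarrow> real) measure" where
  "tempered_borel = sigma tempered {U. openin tempered_topology U}"


section \<open>Square-integrable functions, Fourier transform and spectral measures\<close>

text \<open>Elements of \<open>L\<^sub>2\<close> are represented by functions; identities between them are stated
  almost everywhere.\<close>

definition L2 :: "'a measure \<Rightarrow> ('a \<Rightarrow> 'b::real_normed_vector) set" where
  "L2 M = {f \<in> borel_measurable M. integrable M (\<lambda>x. (norm (f x))\<^sup>2)}"

definition l2_norm :: "'a measure \<Rightarrow> ('a \<Rightarrow> 'b::real_normed_vector) \<Rightarrow> real" where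
  "l2_norm M f = sqrt (\<integral>x. (norm (f x))\<^sup>2 \<partial>M)"

definition linear_into_L2 ::
    "'a measure \<Rightarrow> ((real^'n \<Rightarrow> complex) \<Rightarrow> 'a \<Rightarrow> complex) \<Rightarrow> bool" where
  "linear_into_L2 M T \<longleftrightarrow>
     (\<forall>\<psi>\<in>schwartz. T \<psi> \<in> L2 M) \<and>
     (\<forall>\<phi>\<in>schwartz. \<forall>\<psi>\<in>schwartz. \<forall>a b.
        AE y in M. T (\<lambda>x. a * \<phi> x + b * \<psi> x) y = a * T \<phi> y + b * T \<psi> y)"

definition fourier :: "(real^'n \<Rightarrow> complex) \<Rightarrow> real^'n \<Rightarrow> complex" where
  "fourier \<psi> u = (\<integral>x. exp (- \<i> * complex_of_real (u \<bullet> x)) * \<psi> x \<partial>lborel)"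

definition regular_borel_measure :: "(real^'n) measure \<Rightarrow> bool" where
  "regular_borel_measure \<sigma> \<longleftrightarrow> sets \<sigma> = sets borel \<and>
     (\<forall>A\<in>sets borel.
        emeasure \<sigma> A = (INF U\<in>{U. A \<subseteq> U \<and> open U}. emeasure \<sigma> U) \<and>
        emeasure \<sigma> A = (SUP K\<in>{K. K \<subseteq> A \<and> compact K}. emeasure \<sigma> K))"

definition spectral_measures :: "(real^'n) measure set" where
  "spectral_measures = {\<sigma>. regular_borel_measure \<sigma> \<and>
     (\<exists>p::nat. (\<integral>\<^sup>+ u. ennreal (1 / (1 + (norm u)\<^sup>2) ^ p) \<partial>\<sigma>) < \<infinity>)}"


section \<open>White noise and Gaussian processes\<close>

definition white_noise_measure :: "((real^'n \<Rightarrow> real) \<Rightarrow> real) measure \<Rightarrow> bool" where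
  "white_noise_measure W \<longleftrightarrow> prob_space W \<and> sets W = sets tempered_borel \<and>
     (\<forall>\<psi>\<in>schwartz. (\<integral>\<omega>. exp (\<i> * complex_of_real (\<omega> \<psi>)) \<partial>W) =
        complex_of_real (exp (- (l2_norm lborel \<psi>)\<^sup>2 / 2)))"

text \<open>Extension by continuity of \<open>\<psi> \<mapsto> (\<lambda>\<omega>. \<omega> \<psi>)\<close> from real Schwartz functions to real
  \<open>L\<^sub>2\<close>: the value at \<open>f\<close> is the limit in \<open>L\<^sub>2(W)\<close> along Schwartz functions converging to \<open>f\<close>
  in \<open>L\<^sub>2\<close>. The limit is determined only almost surely; \<open>SOME\<close> picks a representative.\<close>

definition tilde_real ::
    "((real^'n \<Rightarrow> real) \<Rightarrow> real) measure \<Rightarrow> (real^'n \<Rightarrow> real) \<Rightarrow>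
       ((real^'n \<Rightarrow> real) \<Rightarrow> real) \<Rightarrow> real" where
  "tilde_real W f = (SOME F. F \<in> L2 W \<and>
     (\<exists>\<psi>::nat \<Rightarrow> real^'n \<Rightarrow> real. (\<forall>k. \<psi> k \<in> schwartz) \<and>
        (\<lambda>k. l2_norm lborel (\<lambda>x. \<psi> k x - f x)) \<longlonglongrightarrow> 0 \<and>
        (\<lambda>k. l2_norm W (\<lambda>\<omega>. \<omega> (\<psi> k) - F \<omega>)) \<longlonglongrightarrow> 0))"

definition tilde ::
    "((real^'n \<Rightarrow> real) \<Rightarrow> real) measure \<Rightarrow> (real^'n \<Rightarrow> complex) \<Rightarrow>
       ((real^'n \<Rightarrow> real) \<Rightarrow> real) \<Rightarrow> complex" where
  "tilde W f \<omega> = complex_of_real (tilde_real W (\<lambda>x. Re (f x)) \<omega>) +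
     \<i> * complex_of_real (tilde_real W (\<lambda>x. Im (f x)) \<omega>)"

text \<open>Gaussian variables may be degenerate (almost surely constant).\<close>

definition gaussian_rv :: "'a measure \<Rightarrow> ('a \<Rightarrow> real) \<Rightarrow> bool" where
  "gaussian_rv M Y \<longleftrightarrow> Y \<in> borel_measurable M \<and>
     (\<exists>m. (AE y in M. Y y = m) \<or> (\<exists>s>0. distributed M lborel Y (normal_density m s)))"

definition jointly_gaussian :: "'a measure \<Rightarrow> 'i set \<Rightarrow> ('i \<Rightarrow> 'a \<Rightarrow> real) \<Rightarrow> bool" where
  "jointly_gaussian M I Y \<longleftrightarrow>
     (\<forall>c::'i \<Rightarrow> real. gaussian_rv M (\<lambda>y. \<Sum>i\<in>I. c i * Y i y))"

definition generalized_gaussian_process ::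
    "'a measure \<Rightarrow> ((real^'n \<Rightarrow> complex) \<Rightarrow> 'a \<Rightarrow> complex) \<Rightarrow> bool" where
  "generalized_gaussian_process M X \<longleftrightarrow> linear_into_L2 M X \<and>
     (\<forall>F. finite F \<and> F \<subseteq> schwartz \<longrightarrow>
        jointly_gaussian M (F \<times> {Re, Im}) (\<lambda>(\<psi>, part) y. part (X \<psi> y)))"

end

theory Submission
  imports Defs "HOL-Computational_Algebra.Polynomial"
begin

text \<open>
  The law of the process only prescribes the norm of \<open>Q \<psi>\<close>: it has to be the norm of the Fourier
  transform of \<open>\<psi>\<close> in \<open>L\<^sub>2(\<sigma>)\<close>. So \<open>Q\<close> may be the Fourier transform followed by any isometry into
  \<open>L\<^sub>2(dx)\<close>, and the proof consists in choosing this isometry well: \<open>Q\<close> is made to map real Schwartz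
  functions to real Schwartz functions, linearly and continuously (\<open>spectral_factor\<close>). Everything
  else is then immediate. Put \<open>X \<psi> \<omega> = \<omega> (Q \<psi>)\<close>, extended complex-linearly. The extension by
  continuity \<open>tilde\<close> is plain evaluation on Schwartz functions, the variables \<open>\<omega> (Q \<psi>)\<close> are Gaussian
  under white noise by uniqueness of characteristic functions, and \<open>\<mu>\<close> is the image of white noise
  under the transposed map \<open>\<omega> \<mapsto> \<omega> \<circ> Q\<close>, which is weak-* continuous and therefore Borel. In this way
  the measure \<open>\<mu>\<close> is obtained from white noise, without a second appeal to the Bochner-Minlos theorem.

  Let \<open>a\<^sub>k(\<psi>)\<close> be the inner product in \<open>L\<^sub>2(\<sigma>)\<close> of the Fourier transform of \<open>\<psi>\<close> with the \<open>k\<close>-th vector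
  of an orthonormal system, and let \<open>Q \<psi>\<close> be, up to a constant, the sum of \<open>a\<^sub>k(\<psi>)\<close> times the \<open>k\<close>-th
  translate of a smooth bump supported in the unit cube. The supports are disjoint, so the norm of
  \<open>Q \<psi>\<close> is correct by Parseval's identity, and \<open>Q\<close> is continuous on Schwartz functions as soon as
  \<open>a\<^sub>k(\<psi>)\<close> decreases faster than every power of \<open>k\<close>, with constants given by Schwartz seminorms of
  \<open>\<psi>\<close>.

  Such a system comes from the Gram-Schmidt process applied to a sequence \<open>g\<^sub>k\<close>, since then
  \<open>\<bar>a\<^sub>k(\<psi>)\<bar>\<close> is at most the distance of the Fourier transform of \<open>\<psi>\<close> from the span of
  \<open>g\<^sub>0, \<dots>, g\<^bsub>k-1\<^esub>\<close> (\<open>gram_schmidt_coeff_le\<close>). It remains to approximate Fourier transforms of Schwartz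
  functions at a rate faster than every power of the number of functions used
  (\<open>rapidly_approximating_sequence\<close>). Piecewise polynomials of degree less than \<open>r\<close> in each
  coordinate, on the cells of side \<open>1/r\<close> of the box \<open>[-r, r]\<^sup>n\<close>, do this: they span a space of
  dimension polynomial in \<open>r\<close>, Taylor's formula gives an error of any desired order \<open>r\<^sup>-\<^sup>J\<close> inside the box, and outside it the Fourier
  transform itself is that small.
\<close>

section \<open>Schwartz functions and their seminorms\<close>

lemma iter_partial_append: "iter_partial (is @ js) f = iter_partial is (iter_partial js f)"
  by (induction "is") auto

lemma partial_deriv_eq: "(f has_derivative f') (at x) \<Longrightarrow> partial_deriv i f x = f' (axis i 1)"
  unfolding partial_deriv_def using frechet_derivative_at by metis

lemma smooth_has_derivative:
  "smooth f \<Longrightarrow>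
     (iter_partial is f has_derivative frechet_derivative (iter_partial is f) (at x)) (at x)"
  unfolding smooth_def by (metis frechet_derivative_works)

lemma iter_partial_bounded_linear:
  assumes "bounded_linear L" "smooth f"
  shows "iter_partial is (\<lambda>x. L (f x)) = (\<lambda>x. L (iter_partial is f x))"
proof (induction "is")
  case (Cons i "is")
  have "partial_deriv i (\<lambda>x. L (iter_partial is f x)) x = L (partial_deriv i (iter_partial is f) x)"
    for x
    using bounded_linear.has_derivative[OF assms(1) smooth_has_derivative[OF assms(2)]]
    by (subst partial_deriv_eq) (auto simp: partial_deriv_def)
  then show ?case by (intro ext) (simp add: Cons)
qed simp

lemma smooth_bounded_linear:
  assumes "bounded_linear L" "smooth f"
  shows "smooth (\<lambda>x. L (f x))"
  unfolding smooth_def iter_partial_bounded_linear[OF assms]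
  using bounded_linear.has_derivative[OF assms(1) smooth_has_derivative[OF assms(2)]]
  by (auto simp: differentiable_def)

lemma iter_partial_add:
  assumes "smooth f" "smooth g"
  shows "iter_partial is (\<lambda>x. f x + g x) = (\<lambda>x. iter_partial is f x + iter_partial is g x)"
proof (induction "is")
  case (Cons i "is")
  have "partial_deriv i (\<lambda>x. iter_partial is f x + iter_partial is g x) x
      = partial_deriv i (iter_partial is f) x + partial_deriv i (iter_partial is g) x" for x
    using has_derivative_add[OF smooth_has_derivative[OF assms(1)] smooth_has_derivative[OF assms(2)]]
    by (subst partial_deriv_eq) (auto simp: partial_deriv_def)
  then show ?case by (intro ext) (simp add: Cons)
qed simp

lemma smooth_add:
  assumes "smooth f" "smooth g"
  shows "smooth (\<lambda>x. f x + g x)"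
  unfolding smooth_def iter_partial_add[OF assms]
  using assms by (auto simp: smooth_def)

lemma schwartz_smooth: "f \<in> schwartz \<Longrightarrow> smooth f"
  by (simp add: schwartz_def)

lemma schwartz_bdd:
  "f \<in> schwartz \<Longrightarrow> bdd_above (range (\<lambda>x. norm x ^ k * norm (iter_partial is f x)))"
  by (simp add: schwartz_def)

lemma schwartzI:
  assumes "smooth f" "\<And>k is. \<exists>C. \<forall>x. norm x ^ k * norm (iter_partial is f x) \<le> C"
  shows "f \<in> schwartz"
  unfolding schwartz_def bdd_above_def using assms by fastforce

lemma schwartz_seminorm_upper:
  "f \<in> schwartz \<Longrightarrow> norm x ^ k * norm (iter_partial is f x) \<le> schwartz_seminorm k is f"
  unfolding schwartz_seminorm_def by (rule cSUP_upper[OF _ schwartz_bdd]) auto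

lemma schwartz_seminorm_least:
  "(\<And>x. norm x ^ k * norm (iter_partial is f x) \<le> C) \<Longrightarrow> schwartz_seminorm k is f \<le> C"
  unfolding schwartz_seminorm_def by (rule cSUP_least) auto

lemma schwartz_seminorm_nonneg: "f \<in> schwartz \<Longrightarrow> 0 \<le> schwartz_seminorm k is f"
  using schwartz_seminorm_upper[of f 0 k "is"]
  by (meson norm_ge_zero order_trans zero_le_mult_iff zero_le_power)

lemma schwartz_bounded_linear:
  assumes "bounded_linear L" "f \<in> schwartz"
  shows "(\<lambda>x. L (f x)) \<in> schwartz"
proof (rule schwartzI)
  show "smooth (\<lambda>x. L (f x))"
    using assms smooth_bounded_linear schwartz_smooth by blast
  fix k "is"
  obtain K where K: "0 < K" "\<And>y. norm (L y) \<le> norm y * K"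
    using bounded_linear.pos_bounded[OF assms(1)] by blast
  have "norm x ^ k * norm (L (iter_partial is f x)) \<le> schwartz_seminorm k is f * K" for x
  proof -
    have "norm x ^ k * norm (L (iter_partial is f x)) \<le> norm x ^ k * (norm (iter_partial is f x) * K)"
      using K(2) by (intro mult_left_mono) auto
    also have "\<dots> \<le> schwartz_seminorm k is f * K"
      using mult_right_mono[OF schwartz_seminorm_upper[OF assms(2), of x k "is"], of K] K(1)
      by (simp add: mult.assoc)
    finally show ?thesis .
  qed
  then show "\<exists>C. \<forall>x. norm x ^ k * norm (iter_partial is (\<lambda>x. L (f x)) x) \<le> C"
    unfolding iter_partial_bounded_linear[OF assms(1) schwartz_smooth[OF assms(2)]] by blast
qed

lemma iter_partial_add_le:
  assumes "f \<in> schwartz" "g \<in> schwartz"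
  shows "norm x ^ k * norm (iter_partial is (\<lambda>x. f x + g x) x)
     \<le> schwartz_seminorm k is f + schwartz_seminorm k is g"
proof -
  have "norm x ^ k * norm (iter_partial is f x + iter_partial is g x)
     \<le> norm x ^ k * norm (iter_partial is f x) + norm x ^ k * norm (iter_partial is g x)"
    by (metis distrib_left mult_left_mono norm_ge_zero norm_triangle_ineq zero_le_power)
  also have "\<dots> \<le> schwartz_seminorm k is f + schwartz_seminorm k is g"
    using assms by (intro add_mono schwartz_seminorm_upper)
  finally show ?thesis
    using iter_partial_add[OF assms[THEN schwartz_smooth]] by simp
qed

lemma schwartz_add:
  assumes "f \<in> schwartz" "g \<in> schwartz"
  shows "(\<lambda>x. f x + g x) \<in> schwartz"
proof (rule schwartzI)
  show "smooth (\<lambda>x. f x + g x)"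
    using assms by (intro smooth_add schwartz_smooth)
qed (use iter_partial_add_le[OF assms] in blast)

lemma schwartz_seminorm_triangle:
  assumes "f \<in> schwartz" "g \<in> schwartz"
  shows "schwartz_seminorm k is (\<lambda>x. f x + g x) \<le> schwartz_seminorm k is f + schwartz_seminorm k is g"
  by (intro schwartz_seminorm_least iter_partial_add_le assms)

lemma schwartz_lincomb:
  fixes f g :: "real^'n \<Rightarrow> real"
  assumes "f \<in> schwartz" "g \<in> schwartz"
  shows "(\<lambda>x. a * f x + b * g x) \<in> schwartz"
  using schwartz_add[OF schwartz_bounded_linear[OF bounded_linear_mult_right assms(1)]
      schwartz_bounded_linear[OF bounded_linear_mult_right assms(2)]] .

lemma schwartz_diff:
  fixes f g :: "real^'n \<Rightarrow> real"
  assumes "f \<in> schwartz" "g \<in> schwartz"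
  shows "(\<lambda>x. f x - g x) \<in> schwartz"
  using schwartz_lincomb[OF assms, of 1 "-1"] by simp

lemma schwartz_zero: "(\<lambda>x. 0 :: 'b::real_normed_vector) \<in> (schwartz :: (real^'n \<Rightarrow> 'b) set)"
proof -
  have "iter_partial is (\<lambda>x::real^'n. 0 :: 'b) = (\<lambda>x. 0)" for "is"
    by (induction "is") (auto simp: partial_deriv_def)
  then show ?thesis by (intro schwartzI) (auto simp: smooth_def)
qed

lemma schwartz_sum:
  fixes f :: "'i \<Rightarrow> real^'n \<Rightarrow> real"
  assumes "finite I" "\<And>i. i \<in> I \<Longrightarrow> f i \<in> schwartz"
  shows "(\<lambda>x. \<Sum>i\<in>I. c i * f i x) \<in> schwartz"
  using assms
proof (induction I rule: finite_induct)
  case (insert i I)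
  then show ?case using schwartz_lincomb[of "f i" "\<lambda>x. \<Sum>i\<in>I. c i * f i x" "c i" 1] by simp
qed (simp add: schwartz_zero)

lemma schwartz_partial: "f \<in> schwartz \<Longrightarrow> iter_partial js f \<in> schwartz"
  unfolding schwartz_def smooth_def iter_partial_append[symmetric]
  by (simp add: iter_partial_append[symmetric])

text \<open>
  There are finitely many seminorms up to a given order, so a bound by some \<open>snorm N\<close> is what
  continuity for the topology generated by all of them amounts to.
\<close>

definition snorm :: "nat \<Rightarrow> (real^'n \<Rightarrow> 'b::real_normed_vector) \<Rightarrow> real" where
  "snorm N f = (\<Sum>k\<le>N. \<Sum>is\<in>{is. length is \<le> N}. schwartz_seminorm k is f)"

lemma finite_short_lists: "finite {is :: 'n::finite list. length is \<le> N}"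
  using finite_lists_length_le[of "UNIV :: 'n set" N] by simp

lemma schwartz_seminorm_le_snorm:
  fixes f :: "real^'n \<Rightarrow> 'b::real_normed_vector"
  assumes "f \<in> schwartz" "k \<le> N" "length is \<le> N"
  shows "schwartz_seminorm k is f \<le> snorm N f"
proof -
  have "schwartz_seminorm k is f \<le> (\<Sum>is\<in>{is. length is \<le> N}. schwartz_seminorm k is f)"
    using assms finite_short_lists by (intro member_le_sum) (auto intro: schwartz_seminorm_nonneg)
  also have "\<dots> \<le> snorm N f"
    unfolding snorm_def using assms
    by (intro member_le_sum[where f = "\<lambda>k. \<Sum>is\<in>{is. length is \<le> N}. schwartz_seminorm k is f"])
      (auto intro: schwartz_seminorm_nonneg sum_nonneg)
  finally show ?thesis .
qed

lemma snorm_nonneg: "f \<in> schwartz \<Longrightarrow> 0 \<le> snorm N f"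
  unfolding snorm_def by (intro sum_nonneg schwartz_seminorm_nonneg)

lemma snorm_mono:
  fixes f :: "real^'n \<Rightarrow> 'b::real_normed_vector"
  assumes "f \<in> schwartz" "N \<le> M"
  shows "snorm N f \<le> snorm M f"
proof -
  have "snorm N f \<le> (\<Sum>k\<le>N. \<Sum>is\<in>{is. length is \<le> M}. schwartz_seminorm k is f)"
    unfolding snorm_def using assms
    by (intro sum_mono sum_mono2 finite_short_lists schwartz_seminorm_nonneg) auto
  also have "\<dots> \<le> snorm M f"
    unfolding snorm_def using assms
    by (intro sum_mono2 sum_nonneg schwartz_seminorm_nonneg) auto
  finally show ?thesis .
qed

lemma one_plus_power_le: "(1 + t) ^ k \<le> 2 ^ k * (1 + t ^ k)" if "0 \<le> t" for t :: real
proof -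
  have "(1 + t) ^ k \<le> (2 * max 1 t) ^ k"
    using that by (intro power_mono) auto
  also have "\<dots> \<le> 2 ^ k * (1 + t ^ k)"
    using that by (auto simp: power_mult_distrib max_def)
  finally show ?thesis .
qed

lemma schwartz_decay:
  assumes "f \<in> schwartz" "k \<le> N" "length is \<le> N"
  shows "(1 + norm x) ^ k * norm (iter_partial is f x) \<le> 2 ^ Suc k * snorm N f"
proof -
  have "(1 + norm x) ^ k * norm (iter_partial is f x)
      \<le> 2 ^ k * (1 + norm x ^ k) * norm (iter_partial is f x)"
    by (intro mult_right_mono one_plus_power_le) auto
  also have "\<dots> = 2 ^ k * (norm x ^ 0 * norm (iter_partial is f x) + norm x ^ k * norm (iter_partial is f x))"
    by (simp add: algebra_simps)
  also have "\<dots> \<le> 2 ^ k * (snorm N f + snorm N f)"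
    using assms
    by (intro mult_left_mono add_mono order_trans[OF schwartz_seminorm_upper schwartz_seminorm_le_snorm]) auto
  finally show ?thesis by simp
qed

lemma schwartz_continuous: "f \<in> schwartz \<Longrightarrow> continuous_on UNIV f"
  using schwartz_smooth[of f] unfolding smooth_def
  by (metis continuous_at_imp_continuous_on differentiable_imp_continuous_within iter_partial.simps(1))

lemma schwartz_measurable: "f \<in> schwartz \<Longrightarrow> f \<in> borel_measurable borel"
  by (simp add: borel_measurable_continuous_onI schwartz_continuous)

section \<open>The Fourier transform of a Schwartz function\<close>

text \<open>
  Cut the space into the shells \<open>k \<le> norm x < k + 1\<close>. The volume of such a shell is at most of order
  \<open>(k + 1)\<^sup>n\<close>, so it contributes at most a multiple of \<open>1 / (k + 1)\<^sup>2\<close>.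
\<close>

lemma integrable_inverse_power_norm:
  "integrable lborel (\<lambda>x::real^'n. 1 / (1 + norm x) ^ (CARD('n) + 2))"
proof -
  let ?n = "CARD('n)"
  let ?c = "\<lambda>k. unit_ball_vol (real ?n) * (1 / real (Suc k) ^ 2)"
  let ?f = "\<lambda>k x. ennreal (1 / real (Suc k) ^ (?n + 2)) * indicator (cball (0::real^'n) (real (Suc k))) x"
  have le: "ennreal (1 / (1 + norm x) ^ (?n + 2)) \<le> (\<Sum>k. ?f k x)" for x :: "real^'n"
  proof -
    define k where "k = nat \<lfloor>norm x\<rfloor>"
    have k: "real k \<le> norm x" "norm x \<le> real (Suc k)"
      unfolding k_def using norm_ge_zero[of x] by linarith+
    have "ennreal (1 / (1 + norm x) ^ (?n + 2)) \<le> ennreal (1 / real (Suc k) ^ (?n + 2))"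
      using k by (intro ennreal_leI divide_left_mono power_mono mult_pos_pos zero_less_power)
        (auto simp: add_pos_nonneg)
    also have "\<dots> = ?f k x" using k by simp
    also have "\<dots> = (\<Sum>k\<in>{k}. ?f k x)" by (subst sum.insert) simp_all
    also have "\<dots> \<le> (\<Sum>k. ?f k x)" by (intro sum_le_suminf) auto
    finally show ?thesis .
  qed
  have "(\<integral>\<^sup>+x. ennreal (norm (1 / (1 + norm x) ^ (?n + 2))) \<partial>(lborel :: (real^'n) measure))
      \<le> (\<integral>\<^sup>+x. (\<Sum>k. ?f k x) \<partial>lborel)"
    using le by (intro nn_integral_mono) auto
  also have "\<dots> = (\<Sum>k. \<integral>\<^sup>+x. ?f k x \<partial>lborel)"
    by (rule nn_integral_suminf)
      (intro borel_measurable_times_ennreal borel_measurable_const borel_measurable_indicator, simp)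
  also have "\<dots> = (\<Sum>k. ennreal (?c k))"
  proof (intro arg_cong[where f = suminf] ext)
    fix k
    have "(\<integral>\<^sup>+x. ?f k x \<partial>lborel)
        = ennreal (1 / real (Suc k) ^ (?n + 2)) * ennreal (unit_ball_vol (real ?n) * real (Suc k) ^ ?n)"
      by (subst nn_integral_cmult_indicator) (auto simp: emeasure_cball)
    also have "\<dots> = ennreal (?c k)"
      by (subst ennreal_mult[symmetric]) (auto simp: power_add power2_eq_square field_simps simp del: of_nat_Suc)
    finally show "(\<integral>\<^sup>+x. ?f k x \<partial>lborel) = ennreal (?c k)" .
  qed
  also have "\<dots> < \<infinity>"
  proof -
    have "summable (\<lambda>k. 1 / real (Suc k) ^ 2)"
      using inverse_power_summable[of 2, where 'a = real] summable_Suc_iff[of "\<lambda>n. inverse (real n ^ 2)"]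
      by (simp add: inverse_eq_divide)
    then have "summable ?c" by (rule summable_mult)
    then show ?thesis
      by (subst suminf_ennreal2) (auto intro!: mult_nonneg_nonneg)
  qed
  finally show ?thesis
    by (intro integrableI_bounded) auto
qed

definition weight_mass :: "'n::finite itself \<Rightarrow> real" where
  "weight_mass _ = (\<integral>x. 1 / (1 + norm (x::real^'n)) ^ (CARD('n) + 2) \<partial>lborel)"

lemma weight_mass_nonneg: "0 \<le> weight_mass TYPE('n::finite)"
  unfolding weight_mass_def by (intro integral_nonneg_AE) auto

text \<open>
  Of the \<open>j + n + 2\<close> powers of \<open>1 + norm x\<close> that \<open>snorm N\<close> controls, \<open>n + 2\<close> are spent on
  integrability.
\<close>

lemma
  fixes f :: "real^'n \<Rightarrow> real"
  assumes f: "f \<in> schwartz" and N: "j + CARD('n) + 2 \<le> N" "length js \<le> N"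
  shows integrable_schwartz_moment:
      "integrable lborel (\<lambda>x. (1 + norm x) ^ j * norm (iter_partial js f x))"
    and integral_schwartz_moment:
      "(\<integral>x. (1 + norm x) ^ j * norm (iter_partial js f x) \<partial>lborel)
        \<le> 2 ^ Suc N * weight_mass TYPE('n) * snorm N f"
proof -
  let ?K = "2 ^ Suc N * snorm N f"
  let ?g = "iter_partial js f"
  have pw: "(1 + norm x) ^ j * norm (?g x) \<le> ?K * (1 / (1 + norm x) ^ (CARD('n) + 2))" for x
  proof -
    have "(1 + norm x) ^ j * norm (?g x) * (1 + norm x) ^ (CARD('n) + 2)
        = (1 + norm x) ^ (j + CARD('n) + 2) * norm (?g x)"
      by (simp add: power_add)
    also have "\<dots> \<le> 2 ^ Suc (j + CARD('n) + 2) * snorm N f"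
      by (intro schwartz_decay f N)
    also have "\<dots> \<le> ?K"
      using N by (intro mult_right_mono power_increasing snorm_nonneg f) auto
    finally show ?thesis
      by (simp add: pos_le_divide_eq add_pos_nonneg)
  qed
  have meas[measurable]: "?g \<in> borel_measurable borel"
    by (intro schwartz_measurable schwartz_partial f)
  have int: "integrable lborel (\<lambda>x::real^'n. ?K * (1 / (1 + norm x) ^ (CARD('n) + 2)))"
    by (intro integrable_mult_right integrable_inverse_power_norm)
  show I: "integrable lborel (\<lambda>x. (1 + norm x) ^ j * norm (?g x))"
  proof (rule Bochner_Integration.integrable_bound[OF int], measurable, rule AE_I2)
    fix x
    have "norm ((1 + norm x) ^ j * norm (?g x)) = (1 + norm x) ^ j * norm (?g x)"
      by (simp add: abs_mult)
    then show "norm ((1 + norm x) ^ j * norm (?g x)) \<le> norm (?K * (1 / (1 + norm x) ^ (CARD('n) + 2)))"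
      using order_trans[OF pw[of x] abs_ge_self] by (simp only: real_norm_def)
  qed
  have "(\<integral>x. (1 + norm x) ^ j * norm (?g x) \<partial>lborel)
     \<le> (\<integral>x. ?K * (1 / (1 + norm (x::real^'n)) ^ (CARD('n) + 2)) \<partial>lborel)"
    by (intro integral_mono I int pw)
  also have "\<dots> = 2 ^ Suc N * weight_mass TYPE('n) * snorm N f"
    by (subst Bochner_Integration.integral_mult_right_zero) (simp add: weight_mass_def)
  finally show "(\<integral>x. (1 + norm x) ^ j * norm (?g x) \<partial>lborel)
        \<le> 2 ^ Suc N * weight_mass TYPE('n) * snorm N f" .
qed

lemma integrable_schwartz:
  fixes f :: "real^'n \<Rightarrow> real"
  assumes "f \<in> schwartz"
  shows "integrable lborel f"
  using integrable_schwartz_moment[OF assms, of 0 _ "[]"] schwartz_measurable[OF assms]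
  by (subst integrable_norm_iff[symmetric]) auto

definition fourier_real :: "(real^'n \<Rightarrow> real) \<Rightarrow> real^'n \<Rightarrow> complex" where
  "fourier_real f = fourier (\<lambda>x. complex_of_real (f x))"

lemma fourier_real_eq: "fourier_real f u = (\<integral>x. exp (- \<i> * complex_of_real (u \<bullet> x)) * complex_of_real (f x) \<partial>lborel)"
  by (simp add: fourier_real_def fourier_def)

lemma integrable_exp_mult:
  fixes f :: "real^'n \<Rightarrow> real"
  assumes "integrable lborel f"
  shows "integrable lborel (\<lambda>x. exp (- \<i> * complex_of_real (u \<bullet> x)) * complex_of_real (f x))"
proof -
  have [measurable]: "f \<in> borel_measurable borel"
    using assms by auto
  show ?thesis
    by (intro Bochner_Integration.integrable_bound[OF assms]) (auto simp: norm_mult)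
qed

lemma fourier_real_measurable [measurable]:
  fixes f :: "real^'n \<Rightarrow> real"
  assumes [measurable]: "f \<in> borel_measurable borel"
  shows "fourier_real f \<in> borel_measurable borel"
  unfolding fourier_real_def fourier_def by measurable

lemma norm_fourier_real_le:
  fixes f :: "real^'n \<Rightarrow> real"
  assumes "integrable lborel f"
  shows "norm (fourier_real f u) \<le> (\<integral>x. norm (f x) \<partial>lborel)"
  unfolding fourier_real_eq by (intro order_trans[OF integral_norm_bound]) (simp add: norm_mult)

lemma fourier_real_lincomb:
  fixes f g :: "real^'n \<Rightarrow> real"
  assumes "integrable lborel f" "integrable lborel g"
  shows "fourier_real (\<lambda>x. a * f x + b * g x) u = a * fourier_real f u + b * fourier_real g u"
proof -
  let ?e = "\<lambda>x. exp (- \<i> * complex_of_real (u \<bullet> x))"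
  have "fourier_real (\<lambda>x. a * f x + b * g x) u
      = (\<integral>x. a * (?e x * complex_of_real (f x)) + b * (?e x * complex_of_real (g x)) \<partial>lborel)"
    unfolding fourier_real_eq by (rule Bochner_Integration.integral_cong) (simp_all only: of_real_add of_real_mult ring_distribs mult_ac)
  also have "\<dots> = a * fourier_real f u + b * fourier_real g u"
    unfolding fourier_real_eq
    by (subst Bochner_Integration.integral_add)
      (intro integrable_mult_right integrable_exp_mult assms integral_mult_right_zero refl
        | simp only: integral_mult_right_zero)+
  finally show ?thesis .
qed

lemma fourier_real_translate:
  fixes f :: "real^'n \<Rightarrow> real"
  assumes [measurable]: "f \<in> borel_measurable borel"
  shows "fourier_real (\<lambda>x. f (a + x)) u = exp (\<i> * complex_of_real (u \<bullet> a)) * fourier_real f u"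
proof -
  have "fourier_real f u = (\<integral>x. exp (- \<i> * complex_of_real (u \<bullet> x)) * complex_of_real (f x) \<partial>distr lborel borel ((+) a))"
    by (simp add: fourier_real_eq lborel_distr_plus)
  also have "\<dots> = (\<integral>x. exp (- \<i> * complex_of_real (u \<bullet> (a + x))) * complex_of_real (f (a + x)) \<partial>lborel)"
    by (subst integral_distr) auto
  also have "\<dots> = (\<integral>x. exp (- \<i> * complex_of_real (u \<bullet> a)) * (exp (- \<i> * complex_of_real (u \<bullet> x)) * complex_of_real (f (a + x))) \<partial>lborel)"
    by (simp only: inner_add_right of_real_add distrib_left exp_add mult.assoc)
  also have "\<dots> = exp (- \<i> * complex_of_real (u \<bullet> a)) * fourier_real (\<lambda>x. f (a + x)) u"
    by (simp add: fourier_real_eq)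
  finally show ?thesis by (simp add: exp_minus field_simps)
qed

text \<open>
  An integrable majorant for difference quotients. By the mean value theorem they are values of the
  partial derivative at distance at most \<open>1\<close> from \<open>x\<close>, and over such a distance \<open>1 + norm x\<close> changes by
  a factor of at most \<open>2\<close>.
\<close>

lemma schwartz_increment_le:
  fixes f :: "real^'n \<Rightarrow> real"
  assumes f: "f \<in> schwartz" and t: "0 < t" "t \<le> 1"
  shows "\<bar>f (x + t *\<^sub>R axis i 1) - f x\<bar>
      \<le> t * (2 ^ (2 * CARD('n) + 5) * snorm (CARD('n) + 2) f / (1 + norm x) ^ (CARD('n) + 2))"
proof -
  let ?n = "CARD('n) + 2" and ?e = "axis i 1 :: real^'n"
  let ?D = "\<lambda>s. partial_deriv i f (x + s *\<^sub>R ?e)"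
  have "((\<lambda>s. f (x + s *\<^sub>R ?e)) has_derivative (\<lambda>h. h * ?D s)) (at s)" for s
  proof -
    let ?F = "frechet_derivative f (at (x + s *\<^sub>R ?e))"
    have F: "(f has_derivative ?F) (at (x + s *\<^sub>R ?e))"
      using smooth_has_derivative[OF schwartz_smooth[OF f], of "[]"] by simp
    have "((\<lambda>s. x + s *\<^sub>R ?e) has_derivative (\<lambda>h. h *\<^sub>R ?e)) (at s)"
      by (auto intro!: derivative_eq_intros)
    from has_derivative_compose[OF this F]
    have "((\<lambda>s. f (x + s *\<^sub>R ?e)) has_derivative (\<lambda>h. ?F (h *\<^sub>R ?e))) (at s)" .
    moreover have "?F (h *\<^sub>R ?e) = h * ?D s" for h
      using linear_scale[OF has_derivative_linear[OF F], of h ?e] by (simp add: partial_deriv_def)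
    ultimately show ?thesis by simp
  qed
  then have "\<exists>s\<in>{0..t}. f (x + t *\<^sub>R ?e) - f (x + 0 *\<^sub>R ?e) = (t - 0) * ?D s"
    using mvt_very_simple[where f = "\<lambda>s. f (x + s *\<^sub>R ?e)" and f' = "\<lambda>s h. h * ?D s" and a = 0 and b = t]
      has_derivative_at_withinI t by (metis (no_types, lifting) less_imp_le)
  then obtain s where s: "0 \<le> s" "s \<le> t" "f (x + t *\<^sub>R ?e) - f x = t * ?D s"
    by auto
  have "norm x \<le> norm (x + s *\<^sub>R ?e) + s"
    using norm_triangle_ineq4[of "x + s *\<^sub>R ?e" "s *\<^sub>R ?e"] s by simp
  then have "1 + norm x \<le> 2 * (1 + norm (x + s *\<^sub>R ?e))"
    using s(1,2) t norm_ge_zero[of "x + s *\<^sub>R ?e"] by argo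
  then have "(1 + norm x) ^ ?n * \<bar>?D s\<bar> \<le> (2 * (1 + norm (x + s *\<^sub>R ?e))) ^ ?n * \<bar>?D s\<bar>"
    by (intro mult_right_mono power_mono) auto
  also have "\<dots> = 2 ^ ?n * ((1 + norm (x + s *\<^sub>R ?e)) ^ ?n * norm (iter_partial [i] f (x + s *\<^sub>R ?e)))"
    by (simp only: power_mult_distrib iter_partial.simps real_norm_def mult.assoc)
  also have "\<dots> \<le> 2 ^ ?n * (2 ^ Suc ?n * snorm ?n f)"
    by (intro mult_left_mono schwartz_decay f) auto
  also have "\<dots> = 2 ^ (2 * CARD('n) + 5) * snorm ?n f"
    by (simp add: power_add power_mult power2_eq_square flip: power_mult_distrib)
  finally have "\<bar>?D s\<bar> \<le> 2 ^ (2 * CARD('n) + 5) * snorm ?n f / (1 + norm x) ^ ?n"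
    by (simp add: pos_le_divide_eq add_pos_nonneg mult.commute del: power_Suc add_2_eq_Suc')
  then show ?thesis
    using t unfolding s(3) abs_mult by (intro mult_mono) auto
qed

text \<open>
  Translation by \<open>a\<close> multiplies the transform at \<open>u\<close> by \<open>exp (\<i> * (u \<bullet> a))\<close>. The claim is the derivative
  of this relation at \<open>a = 0\<close> along the \<open>i\<close>-th axis, where dominated convergence takes the place of
  an integration by parts.
\<close>

lemma fourier_real_partial_deriv:
  fixes f :: "real^'n \<Rightarrow> real"
  assumes f: "f \<in> schwartz"
  shows "fourier_real (partial_deriv i f) u = \<i> * complex_of_real (u $ i) * fourier_real f u"
proof -
  let ?e = "axis i 1 :: real^'n" and ?n = "CARD('n) + 2"
  define t where "t m = 1 / real (Suc m)" for m
  have t: "0 < t m" "t m \<le> 1" for m by (auto simp: t_def)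
  have t0: "t \<longlonglongrightarrow> 0"
    unfolding t_def using LIMSEQ_inverse_real_of_nat by (simp add: inverse_eq_divide)
  have t_at: "filterlim t (at 0) sequentially"
    using t t0 unfolding filterlim_at by (auto intro!: always_eventually less_imp_neq[symmetric])
  have [measurable]: "f \<in> borel_measurable borel"
    by (rule schwartz_measurable[OF f])
  have [measurable]: "partial_deriv i f \<in> borel_measurable borel"
    using schwartz_measurable[OF schwartz_partial[OF f, of "[i]"]] by simp
  let ?q = "\<lambda>m x. (1 / t m) * f (t m *\<^sub>R ?e + x) + (- 1 / t m) * f x"
  let ?w = "\<lambda>x::real^'n. 2 ^ (2 * CARD('n) + 5) * snorm ?n f * (1 / (1 + norm x) ^ ?n)"
  have bound: "\<bar>?q m x\<bar> \<le> ?w x" for m x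
  proof -
    have "\<bar>?q m x\<bar> = \<bar>f (x + t m *\<^sub>R ?e) - f x\<bar> / t m"
    proof -
      have "?q m x = (f (x + t m *\<^sub>R ?e) - f x) / t m"
        by (simp add: diff_divide_distrib add.commute)
      then show ?thesis using t[of m] by (simp only: abs_divide)
    qed
    also have "\<dots> \<le> ?w x"
      using schwartz_increment_le[OF f t[of m], where x = x and i = i] t[of m]
      by (simp add: pos_divide_le_eq mult.commute)
    finally show ?thesis .
  qed
  have lim: "(\<lambda>m. ?q m x) \<longlonglongrightarrow> partial_deriv i f x" for x
  proof -
    let ?F = "frechet_derivative f (at x)"
    have F: "(f has_derivative ?F) (at x)"
      using smooth_has_derivative[OF schwartz_smooth[OF f], of "[]"] by simp
    have "((\<lambda>s. x + s *\<^sub>R ?e) has_derivative (\<lambda>h. h *\<^sub>R ?e)) (at 0)"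
      by (auto intro!: derivative_eq_intros)
    moreover have "(f has_derivative ?F) (at (x + 0 *\<^sub>R ?e))" using F by simp
    ultimately have "((\<lambda>s. f (x + s *\<^sub>R ?e)) has_derivative (\<lambda>h. ?F (h *\<^sub>R ?e))) (at 0)"
      by (rule has_derivative_compose)
    moreover have "?F (h *\<^sub>R ?e) = partial_deriv i f x * h" for h
      using linear_scale[OF has_derivative_linear[OF F], of h ?e] by (simp add: partial_deriv_def)
    ultimately have "((\<lambda>s. f (x + s *\<^sub>R ?e)) has_real_derivative partial_deriv i f x) (at 0)"
      by (simp add: has_field_derivative_def mult_commute_abs)
    then have "((\<lambda>s. (f (x + s *\<^sub>R ?e) - f x) / s) \<longlongrightarrow> partial_deriv i f x) (at 0)"
      by (simp add: has_field_derivative_iff)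
    from filterlim_compose[OF this t_at] show ?thesis
      by (simp add: diff_divide_distrib add.commute)
  qed
  have "(\<lambda>m. fourier_real (?q m) u) \<longlonglongrightarrow> fourier_real (partial_deriv i f) u"
    unfolding fourier_real_eq
  proof (rule integral_dominated_convergence[where w = ?w])
    show "integrable lborel ?w"
      by (intro integrable_mult_right integrable_inverse_power_norm)
    show "AE x in lborel. (\<lambda>m. exp (- \<i> * complex_of_real (u \<bullet> x)) * complex_of_real (?q m x))
        \<longlonglongrightarrow> exp (- \<i> * complex_of_real (u \<bullet> x)) * complex_of_real (partial_deriv i f x)"
      by (intro AE_I2 tendsto_mult_left tendsto_of_real lim)
    show "AE x in lborel. norm (exp (- \<i> * complex_of_real (u \<bullet> x)) * complex_of_real (?q m x)) \<le> ?w x" for m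
      using bound[of m] by (intro AE_I2) (simp only: norm_mult norm_of_real, simp)
  qed measurable
  moreover have "fourier_real (?q m) u = ((exp (\<i> * complex_of_real (t m * u $ i)) - 1) / t m) * fourier_real f u" for m
  proof -
    have "integrable lborel (\<lambda>x. f (t m *\<^sub>R ?e + x))"
    proof -
      have "integrable (distr lborel borel ((+) (t m *\<^sub>R ?e))) f"
        using integrable_schwartz[OF f] by (simp add: lborel_distr_plus)
      then show ?thesis by (subst (asm) integrable_distr_eq) auto
    qed
    then show ?thesis
      using fourier_real_lincomb[of "\<lambda>x. f (t m *\<^sub>R ?e + x)" f "1 / t m" "- 1 / t m" u] integrable_schwartz[OF f]
        fourier_real_translate[of f "t m *\<^sub>R ?e" u]
      by (simp add: inner_axis field_simps) (simp add: diff_divide_distrib eq_diff_eq add.commute)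
  qed
  moreover have "(\<lambda>m. ((exp (\<i> * complex_of_real (t m * u $ i)) - 1) / t m) * fourier_real f u)
      \<longlonglongrightarrow> (\<i> * complex_of_real (u $ i)) * fourier_real f u"
  proof (intro tendsto_mult_right)
    have "((\<lambda>z. exp (\<i> * complex_of_real (u $ i) * z)) has_field_derivative \<i> * complex_of_real (u $ i)) (at 0)"
      by (auto intro!: derivative_eq_intros)
    then have "((\<lambda>z. (exp (\<i> * complex_of_real (u $ i) * z) - 1) / z) \<longlongrightarrow> \<i> * complex_of_real (u $ i)) (at 0)"
      by (simp add: has_field_derivative_iff)
    moreover have "filterlim (\<lambda>m. complex_of_real (t m)) (at 0) sequentially"
      using t tendsto_of_real[OF t0] unfolding filterlim_at
      by (auto intro!: always_eventually less_imp_neq[symmetric])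
    ultimately have "(\<lambda>m. (exp (\<i> * complex_of_real (u $ i) * complex_of_real (t m)) - 1) / complex_of_real (t m))
        \<longlonglongrightarrow> \<i> * complex_of_real (u $ i)"
      by (rule filterlim_compose)
    then show "(\<lambda>m. (exp (\<i> * complex_of_real (t m * u $ i)) - 1) / t m) \<longlonglongrightarrow> \<i> * complex_of_real (u $ i)"
      by (simp add: mult_ac)
  qed
  ultimately show ?thesis
    by (auto intro: LIMSEQ_unique)
qed

lemma fourier_real_iter_partial:
  fixes f :: "real^'n \<Rightarrow> real"
  assumes f: "f \<in> schwartz"
  shows "fourier_real (iter_partial (replicate m i) f) u = (\<i> * complex_of_real (u $ i)) ^ m * fourier_real f u"
proof (induction m)
  case (Suc m)
  then show ?case using fourier_real_partial_deriv[OF schwartz_partial[OF f]] by simp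
qed simp

text \<open>
  Some coordinate of \<open>u\<close> is at least \<open>norm u / n\<close> in absolute value, and its \<open>m\<close>-th power is the
  effect of an \<open>m\<close>-fold partial derivative.
\<close>

lemma fourier_real_decay:
  "\<exists>C\<ge>0. \<exists>N. \<forall>f\<in>schwartz. \<forall>u :: real^'n. (1 + norm u) ^ m * norm (fourier_real f u) \<le> C * snorm N f"
proof -
  let ?N = "m + CARD('n) + 2" and ?n = "real CARD('n)"
  let ?K = "2 ^ Suc ?N * weight_mass TYPE('n)"
  let ?C = "2 ^ m * (1 + ?n ^ m * ?n) * ?K"
  have "(1 + norm u) ^ m * norm (fourier_real f u) \<le> ?C * snorm ?N f" if f: "f \<in> schwartz" for f and u :: "real^'n"
  proof -
    have int: "(\<integral>x. norm (iter_partial is f x) \<partial>lborel) \<le> ?K * snorm ?N f" if "length is \<le> m" for "is"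
      using integral_schwartz_moment[OF f, of 0 ?N "is"] that by simp
    have fourier_real_i: "\<bar>u $ i\<bar> ^ m * norm (fourier_real f u) \<le> ?K * snorm ?N f" for i
    proof -
      have "\<bar>u $ i\<bar> ^ m * norm (fourier_real f u) = norm (fourier_real (iter_partial (replicate m i) f) u)"
        by (simp add: fourier_real_iter_partial[OF f] norm_mult norm_power)
      also have "\<dots> \<le> (\<integral>x. norm (iter_partial (replicate m i) f x) \<partial>lborel)"
        by (intro norm_fourier_real_le integrable_schwartz schwartz_partial f)
      also have "\<dots> \<le> ?K * snorm ?N f"
        by (rule int) simp
      finally show ?thesis .
    qed
    have "norm (fourier_real f u) \<le> ?K * snorm ?N f"
      using norm_fourier_real_le[OF integrable_schwartz[OF f], of u] int[of "[]"] by simp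
    moreover have "norm u ^ m * norm (fourier_real f u) \<le> ?n ^ m * ?n * (?K * snorm ?N f)"
    proof -
      define M where "M = Max (range (\<lambda>i. \<bar>u $ i\<bar>))"
      have "M \<in> range (\<lambda>i. \<bar>u $ i\<bar>)"
        unfolding M_def by (rule Max_in) auto
      then obtain i where i: "M = \<bar>u $ i\<bar>" by auto
      have "\<bar>u $ j\<bar> \<le> M" for j
        unfolding M_def by (intro Max_ge) auto
      then have "(\<Sum>j\<in>UNIV. \<bar>u $ j\<bar>) \<le> ?n * M"
        using sum_bounded_above[of UNIV "\<lambda>j. \<bar>u $ j\<bar>" M] by simp
      then have "norm u \<le> ?n * M"
        using norm_le_l1_cart[of u] by (rule order_trans[rotated])
      then have "norm u ^ m * norm (fourier_real f u) \<le> (?n * M) ^ m * norm (fourier_real f u)"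
        by (intro mult_right_mono power_mono) auto
      also have "\<dots> = ?n ^ m * (\<bar>u $ i\<bar> ^ m * norm (fourier_real f u))"
        by (simp add: power_mult_distrib i)
      also have "\<dots> \<le> ?n ^ m * (?K * snorm ?N f)"
        by (intro mult_left_mono fourier_real_i) auto
      also have "\<dots> \<le> ?n ^ m * ?n * (?K * snorm ?N f)"
        using snorm_nonneg[OF f, of ?N] weight_mass_nonneg[where 'n='n]
        by (intro mult_right_mono) (auto simp: Suc_leI)
      finally show ?thesis .
    qed
    ultimately have "2 ^ m * (norm (fourier_real f u) + norm u ^ m * norm (fourier_real f u))
        \<le> 2 ^ m * (?K * snorm ?N f + ?n ^ m * ?n * (?K * snorm ?N f))"
      by (intro mult_left_mono add_mono) auto
    moreover have "(1 + norm u) ^ m * norm (fourier_real f u) \<le> 2 ^ m * (1 + norm u ^ m) * norm (fourier_real f u)"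
      by (intro mult_right_mono one_plus_power_le) auto
    ultimately show ?thesis
      by (simp only: distrib_left distrib_right mult.assoc mult_1_left)
  qed
  moreover have "0 \<le> ?C"
    using weight_mass_nonneg[where 'n='n] by (intro mult_nonneg_nonneg add_nonneg_nonneg) auto
  ultimately show ?thesis by blast
qed

section \<open>Approximation of Fourier transforms by piecewise polynomials\<close>

text \<open>
  Expand \<open>exp (- \<i> * (w \<bullet> x))\<close> into powers of \<open>w \<bullet> x\<close> under the Fourier integral at \<open>c + w\<close>, and each
  power by the distributive law; this is the coefficient of \<open>\<Prod>s<l. w $ h s\<close>. Indexing by tuples \<open>h\<close>
  of coordinates instead of exponents keeps multinomial coefficients out of the formulas.
\<close>

definition taylor_coeff :: "(real^'n \<Rightarrow> real) \<Rightarrow> real^'n \<Rightarrow> nat \<Rightarrow> (nat \<Rightarrow> 'n) \<Rightarrow> complex" where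
  "taylor_coeff f c l h = (\<integral>x. exp (- \<i> * complex_of_real (c \<bullet> x)) *
     complex_of_real ((\<Prod>s<l. x $ h s) * f x) \<partial>lborel) * ((- \<i>) ^ l / fact l)"

lemma power_inner_eq:
  fixes w x :: "real^'n"
  shows "(w \<bullet> x) ^ l = (\<Sum>h\<in>PiE {..<l} (\<lambda>_. UNIV). (\<Prod>s<l. w $ h s) * (\<Prod>s<l. x $ h s))"
proof -
  have "(w \<bullet> x) ^ l = (\<Prod>s<l. \<Sum>i\<in>UNIV. w $ i * x $ i)"
    by (simp add: inner_vec_def)
  also have "\<dots> = (\<Sum>h\<in>PiE {..<l} (\<lambda>_. UNIV). \<Prod>s<l. w $ h s * x $ h s)"
    by (rule prod_sum_PiE) auto
  finally show ?thesis by (simp add: prod.distrib)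
qed

lemma integrable_monomial_mult:
  fixes f :: "real^'n \<Rightarrow> real"
  assumes f: "f \<in> schwartz"
  shows "integrable lborel (\<lambda>x. (\<Prod>s<(l::nat). x $ h s) * f x)"
proof -
  have int: "integrable lborel (\<lambda>x. (1 + norm x) ^ l * norm (f x))"
    using integrable_schwartz_moment[OF f order_refl, where j = l and js = "[]"] by simp
  have [measurable]: "f \<in> borel_measurable borel"
    by (rule schwartz_measurable[OF f])
  have "\<bar>\<Prod>s<l. x $ h s\<bar> \<le> (1 + norm x) ^ l" for x :: "real^'n"
  proof -
    have "(\<Prod>s<l. \<bar>x $ h s\<bar>) \<le> (\<Prod>s<l. 1 + norm x)"
      using component_le_norm_cart[of x] by (intro prod_mono) (auto intro: add_increasing)
    then show ?thesis by (simp add: abs_prod)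
  qed
  then have "norm ((\<Prod>s<l. x $ h s) * f x) \<le> norm ((1 + norm x) ^ l * norm (f x))" for x
    by (simp add: abs_mult mult_right_mono)
  moreover have "(\<lambda>x. (\<Prod>s<l. x $ h s) * f x) \<in> borel_measurable borel"
    by measurable
  ultimately show ?thesis
    by (intro Bochner_Integration.integrable_bound[OF int]) auto
qed

text \<open>
  The remainder of the exponential series is at most \<open>\<bar>w \<bullet> x\<bar> ^ Suc d\<close>, whatever the centre \<open>c\<close>; so a
  moment of \<open>f\<close> bounds the error uniformly in \<open>c\<close>.
\<close>

lemma fourier_real_taylor:
  fixes f :: "real^'n \<Rightarrow> real"
  assumes f: "f \<in> schwartz" and w: "\<And>i. \<bar>w $ i\<bar> \<le> \<delta>"
  shows "norm (fourier_real f (c + w) - (\<Sum>l\<le>d. \<Sum>h\<in>PiE {..<l} (\<lambda>_. UNIV).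
            taylor_coeff f c l h * complex_of_real (\<Prod>s<l. w $ h s)))
    \<le> (real CARD('n) * \<delta>) ^ Suc d * (\<integral>x. (1 + norm x) ^ Suc d * norm (f x) \<partial>lborel)"
proof -
  let ?E = "\<lambda>u x. exp (- \<i> * complex_of_real (u \<bullet> x))"
  let ?T = "\<lambda>x. \<Sum>l\<le>d. (\<i> * complex_of_real (- (w \<bullet> x))) ^ l / fact l"
  have [measurable]: "f \<in> borel_measurable borel"
    by (rule schwartz_measurable[OF f])
  have I: "integrable lborel (\<lambda>x. (?E c x * complex_of_real ((\<Prod>s<l. x $ h s) * f x)) *
      (((- \<i>) ^ l / fact l) * complex_of_real (\<Prod>s<l. w $ h s)))" for l and h :: "nat \<Rightarrow> 'n"
    by (intro integrable_mult_left integrable_exp_mult integrable_monomial_mult f)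
  have T: "?E c x * ?T x * f x = (\<Sum>l\<le>d. \<Sum>h\<in>PiE {..<l} (\<lambda>_. UNIV).
      (?E c x * complex_of_real ((\<Prod>s<l. x $ h s) * f x)) *
      (((- \<i>) ^ l / fact l) * complex_of_real (\<Prod>s<l. w $ h s)))" for x
  proof -
    have "(\<i> * complex_of_real (- (w \<bullet> x))) ^ l / fact l = (\<Sum>h\<in>PiE {..<l} (\<lambda>_. UNIV).
        ((- \<i>) ^ l / fact l) * complex_of_real (\<Prod>s<l. w $ h s) * complex_of_real (\<Prod>s<l. x $ h s))" for l
    proof -
      have "(\<i> * complex_of_real (- (w \<bullet> x))) ^ l = (- \<i>) ^ l * complex_of_real ((w \<bullet> x) ^ l)"
        by (simp flip: power_mult_distrib)
      also have "complex_of_real ((w \<bullet> x) ^ l) = (\<Sum>h\<in>PiE {..<l} (\<lambda>_. UNIV).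
        complex_of_real (\<Prod>s<l. w $ h s) * complex_of_real (\<Prod>s<l. x $ h s))"
        unfolding power_inner_eq by (simp only: of_real_sum of_real_mult)
      finally show ?thesis
        by (simp add: sum_distrib_left sum_divide_distrib mult.assoc)
    qed
    then show ?thesis
      by (simp only: sum_distrib_left sum_distrib_right of_real_mult mult_ac)
  qed
  have ftT: "(\<Sum>l\<le>d. \<Sum>h\<in>PiE {..<l} (\<lambda>_. UNIV).
      taylor_coeff f c l h * complex_of_real (\<Prod>s<l. w $ h s)) = (\<integral>x. ?E c x * ?T x * f x \<partial>lborel)"
  proof -
    have "(\<integral>x. ?E c x * ?T x * f x \<partial>lborel) = (\<Sum>l\<le>d. \<Sum>h\<in>PiE {..<l} (\<lambda>_. UNIV).
        (\<integral>x. (?E c x * complex_of_real ((\<Prod>s<l. x $ h s) * f x)) *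
          (((- \<i>) ^ l / fact l) * complex_of_real (\<Prod>s<l. w $ h s)) \<partial>lborel))"
      unfolding T by (simp only: Bochner_Integration.integral_sum Bochner_Integration.integrable_sum I)
    also have "\<dots> = (\<Sum>l\<le>d. \<Sum>h\<in>PiE {..<l} (\<lambda>_. UNIV).
        taylor_coeff f c l h * complex_of_real (\<Prod>s<l. w $ h s))"
      unfolding taylor_coeff_def
      by (intro sum.cong refl) (subst integral_mult_left_zero, rule mult.assoc[symmetric])
    finally show ?thesis by (rule sym)
  qed
  have IT: "integrable lborel (\<lambda>x. ?E c x * ?T x * f x)"
    unfolding T by (intro Bochner_Integration.integrable_sum I)
  have "fourier_real f (c + w) - (\<integral>x. ?E c x * ?T x * f x \<partial>lborel) = (\<integral>x. ?E (c + w) x * f x - ?E c x * ?T x * f x \<partial>lborel)"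
    unfolding fourier_real_eq
    by (intro Bochner_Integration.integral_diff[symmetric] integrable_exp_mult integrable_schwartz f IT)
  also have "norm \<dots> \<le> (\<integral>x. (real CARD('n) * \<delta>) ^ Suc d * ((1 + norm x) ^ Suc d * norm (f x)) \<partial>lborel)"
  proof (rule Bochner_Integration.integral_norm_bound_integral)
    show "integrable lborel (\<lambda>x. ?E (c + w) x * f x - ?E c x * ?T x * f x)"
      by (intro Bochner_Integration.integrable_diff integrable_exp_mult integrable_schwartz f IT)
    show "integrable lborel (\<lambda>x. (real CARD('n) * \<delta>) ^ Suc d * ((1 + norm x) ^ Suc d * norm (f x)))"
      using integrable_schwartz_moment[OF f order_refl, where j = "Suc d" and js = "[]"]
      by (intro integrable_mult_right) simp
    fix x
    have "?E (c + w) x * f x - ?E c x * ?T x * f x = ?E c x * ((iexp (- (w \<bullet> x)) - ?T x) * f x)"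
      by (simp add: inner_add_left exp_add[symmetric] ring_distribs algebra_simps)
    then have "norm (?E (c + w) x * f x - ?E c x * ?T x * f x) = norm (iexp (- (w \<bullet> x)) - ?T x) * norm (f x)"
      by (simp only: norm_mult) simp
    also have "\<dots> \<le> (real CARD('n) * \<delta> * (1 + norm x)) ^ Suc d * norm (f x)"
    proof (intro mult_right_mono)
      have "\<bar>w \<bullet> x\<bar> \<le> (\<Sum>i\<in>UNIV. \<bar>w $ i * x $ i\<bar>)"
        unfolding inner_vec_def by (simp add: sum_abs)
      also have "\<dots> \<le> (\<Sum>i\<in>(UNIV::'n set). \<delta> * (1 + norm x))"
        unfolding abs_mult using w component_le_norm_cart[of x]
        by (intro sum_mono mult_mono) (auto intro: add_increasing order_trans[OF abs_ge_zero])
      finally have *: "\<bar>- (w \<bullet> x)\<bar> \<le> real CARD('n) * \<delta> * (1 + norm x)"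
        by (simp add: mult.assoc)
      have "norm (iexp (- (w \<bullet> x)) - ?T x) \<le> \<bar>- (w \<bullet> x)\<bar> ^ Suc d / fact (Suc d)"
        by (rule iexp_approx1)
      also have "\<dots> \<le> \<bar>- (w \<bullet> x)\<bar> ^ Suc d"
        using fact_ge_1[of "Suc d", where 'a = real]
        by (simp add: divide_le_eq mult_le_cancel_left1 del: fact_Suc power_Suc)
      also have "\<dots> \<le> (real CARD('n) * \<delta> * (1 + norm x)) ^ Suc d"
        using * by (rule power_mono) simp
      finally show "norm (iexp (- (w \<bullet> x)) - ?T x) \<le> (real CARD('n) * \<delta> * (1 + norm x)) ^ Suc d" .
    qed simp
    also have "\<dots> = (real CARD('n) * \<delta>) ^ Suc d * ((1 + norm x) ^ Suc d * norm (f x))"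
      by (simp only: power_mult_distrib mult.assoc)
    finally show "norm (?E (c + w) x * f x - ?E c x * ?T x * f x)
       \<le> (real CARD('n) * \<delta>) ^ Suc d * ((1 + norm x) ^ Suc d * norm (f x))" .
  qed
  finally show ?thesis
    unfolding ftT by simp
qed

text \<open>
  The scalars are real because \<open>Q\<close> has to preserve real-valued functions, so the coefficients with
  respect to the orthonormal system must be real. Complex multiples are recovered by having both
  \<open>g\<close> and \<open>\<i> g\<close> among the spanning functions.
\<close>

definition real_subspace :: "('a \<Rightarrow> complex) set \<Rightarrow> bool" where
  "real_subspace V \<longleftrightarrow> (\<lambda>u. 0) \<in> V \<and>
     (\<forall>v\<in>V. \<forall>w\<in>V. \<forall>a b. (\<lambda>u. a *\<^sub>R v u + b *\<^sub>R w u) \<in> V)"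

lemma real_subspaceD:
  "real_subspace V \<Longrightarrow> v \<in> V \<Longrightarrow> w \<in> V \<Longrightarrow> (\<lambda>u. a *\<^sub>R v u + b *\<^sub>R w u) \<in> V"
  unfolding real_subspace_def by blast

lemma real_subspace_sum:
  assumes "real_subspace V" "finite I" "\<And>i. i \<in> I \<Longrightarrow> v i \<in> V"
  shows "(\<lambda>u. \<Sum>i\<in>I. v i u) \<in> V"
  using assms(2,3)
proof (induction I rule: finite_induct)
  case empty
  then show ?case using assms(1) by (simp add: real_subspace_def)
next
  case (insert i I)
  then have "(\<lambda>u. 1 *\<^sub>R v i u + 1 *\<^sub>R (\<Sum>i\<in>I. v i u)) \<in> V"
    by (intro real_subspaceD assms(1)) auto
  then show ?case using insert by simp
qed

text \<open>
  A monomial centred at the corner \<open>z / r\<close> of a cell of side \<open>1 / r\<close>, cut off outside the cell. The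
  factor \<open>\<epsilon>\<close> takes the values \<open>1\<close> and \<open>\<i>\<close> below.
\<close>

definition cell_monomial :: "nat \<Rightarrow> ('n \<Rightarrow> int) \<Rightarrow> ('n \<Rightarrow> nat) \<Rightarrow> complex \<Rightarrow> real^'n \<Rightarrow> complex" where
  "cell_monomial r z \<alpha> \<epsilon> u = (if \<forall>i. \<lfloor>real r * u $ i\<rfloor> = z i
     then \<epsilon> * complex_of_real (\<Prod>i\<in>UNIV. (u $ i - z i / r) ^ \<alpha> i) else 0)"

definition cell_indices :: "nat \<Rightarrow> ('n \<Rightarrow> int) set" where
  "cell_indices r = PiE UNIV (\<lambda>_. {- (int r)\<^sup>2..<(int r)\<^sup>2})"

definition cell_monomials :: "nat \<Rightarrow> (real^'n \<Rightarrow> complex) set" where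
  "cell_monomials r = (\<lambda>(z, \<alpha>, \<epsilon>). cell_monomial r z \<alpha> \<epsilon>) `
     (cell_indices r \<times> PiE UNIV (\<lambda>_. {..<r}) \<times> {1, \<i>})"

lemma finite_cell_indices: "finite (cell_indices r :: ('n::finite \<Rightarrow> int) set)"
  unfolding cell_indices_def by (intro finite_PiE) auto

text \<open>
  A product over a tuple of coordinates is a monomial whose exponents count the occurrences of each
  coordinate, hence are at most the length of the tuple.
\<close>

lemma mult_cell_monomial_mem:
  assumes V: "real_subspace V" "cell_monomials r \<subseteq> V"
    and z: "z \<in> cell_indices r" and l: "l < r"
  shows "(\<lambda>u. c * (if \<forall>i. \<lfloor>real r * u $ i\<rfloor> = z i
      then complex_of_real (\<Prod>s<l. u $ h s - z (h s) / r) else 0)) \<in> V"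
proof -
  define \<alpha> where "\<alpha> i = card {s \<in> {..<l}. h s = i}" for i
  have prod: "(\<Prod>s<l. u $ h s - z (h s) / r) = (\<Prod>i\<in>UNIV. (u $ i - z i / r) ^ \<alpha> i)" for u :: "real^'a"
  proof -
    have "(\<Prod>s<l. u $ h s - z (h s) / r)
        = (\<Prod>i\<in>UNIV. \<Prod>s\<in>{s \<in> {..<l}. h s = i}. u $ h s - z (h s) / r)"
      by (rule prod.group[symmetric]) auto
    also have "\<dots> = (\<Prod>i\<in>UNIV. (u $ i - z i / r) ^ \<alpha> i)"
      unfolding \<alpha>_def by (intro prod.cong refl) simp
    finally show ?thesis .
  qed
  have "\<alpha> i < r" for i
  proof -
    have "\<alpha> i \<le> card {..<l}" unfolding \<alpha>_def by (intro card_mono) auto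
    then show ?thesis using l by simp
  qed
  then have "cell_monomial r z \<alpha> \<epsilon> \<in> V" if "\<epsilon> \<in> {1, \<i>}" for \<epsilon>
    using z that
    by (intro subsetD[OF V(2)[unfolded cell_monomials_def]] image_eqI[of _ _ "(z, \<alpha>, \<epsilon>)"])
      (auto simp: PiE_iff)
  then have "(\<lambda>u. Re c *\<^sub>R cell_monomial r z \<alpha> 1 u + Im c *\<^sub>R cell_monomial r z \<alpha> \<i> u) \<in> V"
    by (intro real_subspaceD V(1)) auto
  also have "(\<lambda>u. Re c *\<^sub>R cell_monomial r z \<alpha> 1 u + Im c *\<^sub>R cell_monomial r z \<alpha> \<i> u)
     = (\<lambda>u. c * (if \<forall>i. \<lfloor>real r * u $ i\<rfloor> = z i
      then complex_of_real (\<Prod>s<l. u $ h s - z (h s) / r) else 0))"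
    unfolding prod by (rule ext) (auto simp: cell_monomial_def complex_eq_iff)
  finally show ?thesis .
qed

text \<open>
  On each cell take the Taylor polynomial at its corner. The cells are disjoint, so at a given point
  only one term of the sum over all cells survives.
\<close>

lemma cell_approximation:
  fixes V :: "(real^'n \<Rightarrow> complex) set"
  assumes f: "f \<in> schwartz" and V: "real_subspace V" "cell_monomials r \<subseteq> V" and d: "d < r"
  obtains v where "v \<in> V"
    "\<And>u. v u = 0 \<and> real r \<le> norm u \<or> (\<forall>i. \<bar>u $ i\<bar> \<le> real r) \<and> norm (fourier_real f u - v u)
       \<le> (real CARD('n) / r) ^ Suc d * (\<integral>x. (1 + norm x) ^ Suc d * norm (f x) \<partial>lborel)"
proof -
  let ?corner = "\<lambda>z. (\<chi> i. real_of_int (z i) / r) :: real^'n"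
  let ?term = "\<lambda>z l h u. taylor_coeff f (?corner z) l h * (if \<forall>i. \<lfloor>real r * u $ i\<rfloor> = z i
      then complex_of_real (\<Prod>s<l. u $ h s - z (h s) / r) else 0)"
  let ?v = "\<lambda>u. \<Sum>z\<in>cell_indices r. \<Sum>l\<le>d. \<Sum>h\<in>PiE {..<l} (\<lambda>_. UNIV). ?term z l h u"
  have r: "0 < r" using d by simp
  have v: "?v u = (if (\<lambda>i. \<lfloor>real r * u $ i\<rfloor>) \<in> cell_indices r
      then (\<Sum>l\<le>d. \<Sum>h\<in>PiE {..<l} (\<lambda>_. UNIV). ?term (\<lambda>i. \<lfloor>real r * u $ i\<rfloor>) l h u) else 0)" for u
  proof -
    have "?v u = (\<Sum>z\<in>cell_indices r. if z = (\<lambda>i. \<lfloor>real r * u $ i\<rfloor>) then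
        (\<Sum>l\<le>d. \<Sum>h\<in>PiE {..<l} (\<lambda>_. UNIV). ?term z l h u) else 0)"
    proof (intro sum.cong refl)
      fix z
      show "(\<Sum>l\<le>d. \<Sum>h\<in>PiE {..<l} (\<lambda>_. UNIV). ?term z l h u) = (if z = (\<lambda>i. \<lfloor>real r * u $ i\<rfloor>) then
        (\<Sum>l\<le>d. \<Sum>h\<in>PiE {..<l} (\<lambda>_. UNIV). ?term z l h u) else 0)"
      proof (cases "z = (\<lambda>i. \<lfloor>real r * u $ i\<rfloor>)")
        case False
        then have "\<not> (\<forall>i. \<lfloor>real r * u $ i\<rfloor> = z i)" by auto
        then show ?thesis by (simp only: False if_False mult_zero_right sum.neutral_const)
      qed simp
    qed
    also have "\<dots> = (if (\<lambda>i. \<lfloor>real r * u $ i\<rfloor>) \<in> cell_indices r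
      then (\<Sum>l\<le>d. \<Sum>h\<in>PiE {..<l} (\<lambda>_. UNIV). ?term (\<lambda>i. \<lfloor>real r * u $ i\<rfloor>) l h u) else 0)"
      by (rule sum.delta[OF finite_cell_indices])
    finally show ?thesis .
  qed
  show thesis
  proof
    show "?v \<in> V"
      using d by (intro real_subspace_sum V(1) finite_cell_indices mult_cell_monomial_mem V(2) finite_PiE) auto
  next
    fix u :: "real^'n"
    let ?z = "\<lambda>i. \<lfloor>real r * u $ i\<rfloor>"
    have z_iff: "?z i \<in> {- (int r)\<^sup>2..<(int r)\<^sup>2} \<longleftrightarrow> - real r \<le> u $ i \<and> u $ i < real r" for i
    proof -
      have "?z i \<in> {- (int r)\<^sup>2..<(int r)\<^sup>2}
          \<longleftrightarrow> real r * (- real r) \<le> real r * u $ i \<and> real r * u $ i < real r * real r"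
        by (simp add: le_floor_iff floor_less_iff power2_eq_square)
      also have "\<dots> \<longleftrightarrow> - real r \<le> u $ i \<and> u $ i < real r"
        using r by (simp only: mult_le_cancel_left_pos mult_less_cancel_left_pos of_nat_0_less_iff)
      finally show ?thesis .
    qed
    show "?v u = 0 \<and> real r \<le> norm u \<or> (\<forall>i. \<bar>u $ i\<bar> \<le> real r) \<and> norm (fourier_real f u - ?v u)
       \<le> (real CARD('n) / r) ^ Suc d * (\<integral>x. (1 + norm x) ^ Suc d * norm (f x) \<partial>lborel)"
    proof (cases "?z \<in> cell_indices r")
      case True
      then have "- real r \<le> u $ i \<and> u $ i < real r" for i
        using z_iff[of i] by (auto simp: cell_indices_def PiE_iff)
      then have box: "\<forall>i. \<bar>u $ i\<bar> \<le> real r"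
        by (auto simp: abs_le_iff less_imp_le minus_le_iff)
      define w where "w = u - ?corner ?z"
      have "\<bar>w $ i\<bar> \<le> 1 / r" for i
      proof -
        have "w $ i = (real r * u $ i - \<lfloor>real r * u $ i\<rfloor>) / r"
          using r by (simp add: w_def field_simps)
        moreover have "0 \<le> real r * u $ i - \<lfloor>real r * u $ i\<rfloor>" "real r * u $ i - \<lfloor>real r * u $ i\<rfloor> \<le> 1"
          by linarith+
        ultimately show ?thesis by (simp add: divide_right_mono)
      qed
      note fourier_real_taylor[OF f this, of "?corner ?z" d]
      moreover have "?corner ?z + w = u" by (simp add: w_def)
      moreover have "w $ i = u $ i - ?z i / r" for i by (simp add: w_def)
      ultimately show ?thesis
        using True box unfolding v by simp
    next
      case False
      then obtain i where "\<not> (- real r \<le> u $ i \<and> u $ i < real r)"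
        using z_iff by (auto simp: cell_indices_def PiE_iff)
      then have "real r \<le> \<bar>u $ i\<bar>" by auto
      then show ?thesis
        using False component_le_norm_cart[of u i] unfolding v by simp
    qed
  qed
qed

lemma power_scale_cancel:
  fixes x :: "'a::field"
  assumes "x \<noteq> 0"
  shows "(a * x) ^ q * ((b / x) ^ (q + k) * c) = a ^ q * b ^ (q + k) * c / x ^ k"
  using assms by (simp add: power_mult_distrib power_divide power_add)

text \<open>
  Inside the box the weight is of order \<open>r ^ (2 * p)\<close>, which Taylor expansion up to degree \<open>2 * p + J\<close>
  compensates. Outside the box the approximant vanishes, and decay of order \<open>2 * p + J\<close> of the
  Fourier transform suffices. If \<open>r\<close> is too small to admit this degree, then \<open>r\<close> is bounded and the
  zero function will do.
\<close>

lemma weighted_cell_approximation: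
  "\<exists>C\<ge>0. \<exists>N. \<forall>f\<in>schwartz. \<forall>r\<ge>1. \<forall>V. real_subspace V \<longrightarrow> cell_monomials r \<subseteq> V \<longrightarrow>
     (\<exists>v\<in>V. \<forall>u::real^'n. (1 + (norm u)\<^sup>2) ^ p * norm (fourier_real f u - v u) \<le> C * snorm N f / real r ^ J)"
proof -
  let ?n = "real CARD('n)" and ?d = "2 * p + J"
  let ?N1 = "Suc ?d + CARD('n) + 2"
  let ?K = "2 ^ Suc ?N1 * weight_mass TYPE('n)"
  obtain C0 N0 where C0: "C0 \<ge> 0"
    and decay: "\<And>f u. f \<in> schwartz \<Longrightarrow> (1 + norm (u::real^'n)) ^ ?d * norm (fourier_real f u) \<le> C0 * snorm N0 f"
    using fourier_real_decay[of ?d, where 'n = 'n] by blast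
  let ?C1 = "C0 * real (Suc ?d) ^ J" and ?C2 = "(?n + 1) ^ (2 * p) * ?n ^ Suc ?d * ?K"
  let ?N = "max N0 ?N1" and ?C = "?C1 + C0 + ?C2"
  have K: "0 \<le> ?K" using weight_mass_nonneg[where 'n = 'n] by simp
  have "\<exists>v\<in>V. \<forall>u::real^'n. (1 + (norm u)\<^sup>2) ^ p * norm (fourier_real f u - v u) \<le> ?C * snorm ?N f / real r ^ J"
    if f: "f \<in> schwartz" and r: "r \<ge> 1" and V: "real_subspace V" "cell_monomials r \<subseteq> V" for f r V
  proof -
    have S: "0 \<le> snorm ?N f" "snorm N0 f \<le> snorm ?N f" "snorm ?N1 f \<le> snorm ?N f"
      by (intro snorm_nonneg snorm_mono f; simp)+
    have sq: "(1 + (norm u)\<^sup>2) ^ p \<le> (1 + norm u) ^ (2 * p)" for u :: "real^'n"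
      unfolding power_mult by (intro power_mono) (auto simp: power2_eq_square algebra_simps)
    have decay': "(1 + norm u) ^ ?d * norm (fourier_real f u) \<le> C0 * snorm ?N f" for u :: "real^'n"
      using decay[OF f, of u] mult_left_mono[OF S(2) C0] by linarith
    have final: "x \<le> ?C * snorm ?N f / real r ^ J"
      if "x \<le> c * snorm ?N f / real r ^ J" "c = ?C1 \<or> c = C0 \<or> c = ?C2" for x c
    proof -
      have "0 \<le> ?C1" "0 \<le> ?C2"
        using C0 weight_mass_nonneg[where 'n = 'n] by (intro mult_nonneg_nonneg; simp)+
      then have "c \<le> ?C" using that(2) C0 by linarith
      then show ?thesis
        using that(1) S(1) by (elim order_trans) (intro divide_right_mono mult_right_mono; simp)
    qed
    show ?thesis
    proof (cases "?d < r")
      case False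
      have "(1 + (norm u)\<^sup>2) ^ p * norm (fourier_real f u - 0) \<le> ?C1 * snorm ?N f / real r ^ J" for u :: "real^'n"
      proof -
        have "(1 + (norm u)\<^sup>2) ^ p * norm (fourier_real f u) \<le> (1 + norm u) ^ ?d * norm (fourier_real f u)"
          by (intro mult_right_mono order_trans[OF sq] power_increasing) auto
        also have "\<dots> \<le> C0 * snorm ?N f" by (rule decay')
        also have "\<dots> \<le> C0 * snorm ?N f * (real (Suc ?d) ^ J / real r ^ J)"
        proof -
          have "real r ^ J \<le> real (Suc ?d) ^ J"
            using False by (intro power_mono) auto
          then have "1 \<le> real (Suc ?d) ^ J / real r ^ J"
            using r by (simp add: le_divide_eq)
          from mult_left_mono[OF this mult_nonneg_nonneg[OF C0 S(1)]] show ?thesis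
            by (simp only: mult_1_right)
        qed
        finally show ?thesis by (simp add: mult_ac)
      qed
      then have "(1 + (norm u)\<^sup>2) ^ p * norm (fourier_real f u - 0) \<le> ?C * snorm ?N f / real r ^ J" for u :: "real^'n"
        by (rule final) simp
      moreover have "(\<lambda>u. 0) \<in> V" using V(1) by (simp add: real_subspace_def)
      ultimately show ?thesis by (intro bexI[of _ "\<lambda>u. 0"]) auto
    next
      case True
      obtain v where v: "v \<in> V"
        "\<And>u. v u = 0 \<and> real r \<le> norm u \<or> (\<forall>i. \<bar>u $ i\<bar> \<le> real r) \<and> norm (fourier_real f u - v u)
           \<le> (?n / r) ^ Suc ?d * (\<integral>x. (1 + norm x) ^ Suc ?d * norm (f x) \<partial>lborel)"
        by (rule cell_approximation[OF f V True], rule that)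
      have "(1 + (norm u)\<^sup>2) ^ p * norm (fourier_real f u - v u) \<le> ?C * snorm ?N f / real r ^ J" for u
        using v(2)[of u]
      proof (elim disjE conjE)
        assume box: "\<forall>i. \<bar>u $ i\<bar> \<le> real r" and bound: "norm (fourier_real f u - v u)
           \<le> (?n / r) ^ Suc ?d * (\<integral>x. (1 + norm x) ^ Suc ?d * norm (f x) \<partial>lborel)"
        have "norm u \<le> (\<Sum>i\<in>UNIV. \<bar>u $ i\<bar>)" by (rule norm_le_l1_cart)
        also have "\<dots> \<le> ?n * r"
          using sum_bounded_above[of UNIV "\<lambda>i. \<bar>u $ i\<bar>" "real r"] box by simp
        finally have "1 + norm u \<le> (?n + 1) * r"
          using r by (simp add: algebra_simps)
        then have "(1 + (norm u)\<^sup>2) ^ p \<le> ((?n + 1) * r) ^ (2 * p)"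
          by (intro order_trans[OF sq] power_mono) auto
        moreover have "norm (fourier_real f u - v u) \<le> (?n / r) ^ Suc ?d * (?K * snorm ?N f)"
        proof -
          have "(\<integral>x. (1 + norm x) ^ Suc ?d * norm (f x) \<partial>lborel) \<le> ?K * snorm ?N1 f"
            using integral_schwartz_moment[OF f order_refl, where j = "Suc ?d" and js = "[]"] by simp
          also have "\<dots> \<le> ?K * snorm ?N f"
            by (rule mult_left_mono[OF S(3) K])
          finally show ?thesis
            by (intro order_trans[OF bound] mult_left_mono) auto
        qed
        ultimately have "(1 + (norm u)\<^sup>2) ^ p * norm (fourier_real f u - v u)
            \<le> ((?n + 1) * r) ^ (2 * p) * ((?n / r) ^ Suc ?d * (?K * snorm ?N f))"
          by (intro mult_mono) auto
        also have "\<dots> = ?C2 * snorm ?N f / real r ^ Suc J"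
          using r power_scale_cancel[of "real r" "?n + 1" "2 * p" ?n "Suc J" "?K * snorm ?N f"] by (simp add: mult.assoc)
        also have "\<dots> \<le> ?C2 * snorm ?N f / real r ^ J"
          using r weight_mass_nonneg[where 'n = 'n] S(1) by (intro divide_left_mono mult_nonneg_nonneg power_increasing mult_pos_pos) auto
        finally show ?thesis by (rule final) simp
      next
        assume zero: "v u = 0" and ru: "real r \<le> norm u"
        have "(1 + (norm u)\<^sup>2) ^ p * norm (fourier_real f u) * real r ^ J \<le> (1 + norm u) ^ (2 * p) * norm (fourier_real f u) * (1 + norm u) ^ J"
          using ru by (intro mult_mono sq power_mono) auto
        also have "\<dots> = (1 + norm u) ^ ?d * norm (fourier_real f u)" by (simp add: power_add mult_ac)
        also have "\<dots> \<le> C0 * snorm ?N f" by (rule decay')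
        finally have "(1 + (norm u)\<^sup>2) ^ p * norm (fourier_real f u - v u) \<le> C0 * snorm ?N f / real r ^ J"
          using r zero by (simp add: le_divide_eq)
        then show ?thesis by (rule final) simp
      qed
      then show ?thesis using v(1) by blast
    qed
  qed
  moreover have "0 \<le> ?C" using C0 weight_mass_nonneg[where 'n = 'n]
    by (intro add_nonneg_nonneg mult_nonneg_nonneg) auto
  ultimately show ?thesis by blast
qed

text \<open>
  There are \<open>(2 * r\<^sup>2) ^ n\<close> cells, \<open>r ^ n\<close> exponents and two values of \<open>\<epsilon>\<close>. What matters is that their
  number grows only polynomially in \<open>r\<close>.
\<close>

lemma card_cell_monomials:
  "finite (cell_monomials r :: (real^'n \<Rightarrow> complex) set) \<and>
   card (cell_monomials r :: (real^'n \<Rightarrow> complex) set) \<le> (r + 1) ^ (4 * CARD('n) + 1)"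
proof -
  let ?I = "(cell_indices r :: ('n \<Rightarrow> int) set) \<times> (PiE UNIV (\<lambda>_. {..<r}) :: ('n \<Rightarrow> nat) set) \<times> {1, \<i> :: complex}"
  have fin: "finite ?I"
    by (intro finite_cartesian_product finite_cell_indices finite_PiE) auto
  have "card (cell_monomials r :: (real^'n \<Rightarrow> complex) set) \<le> card ?I"
    unfolding cell_monomials_def by (rule card_image_le[OF fin])
  also have "\<dots> = nat (2 * (int r)\<^sup>2) ^ CARD('n) * (r ^ CARD('n) * 2)"
    by (simp add: card_cartesian_product cell_indices_def card_PiE complex_eq_iff card_insert_if)
  also have "\<dots> = (2 * r\<^sup>2) ^ CARD('n) * (r ^ CARD('n) * 2)"
    by (simp add: nat_mult_distrib nat_power_eq)
  also have "\<dots> \<le> (r + 1) ^ (4 * CARD('n) + 1)"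
  proof (cases "r = 0")
    case False
    have "(2 * r\<^sup>2) ^ CARD('n) * (r ^ CARD('n) * 2) \<le> ((r + 1) ^ 3) ^ CARD('n) * ((r + 1) ^ CARD('n) * (r + 1))"
    proof (intro mult_mono power_mono)
      have "2 * r\<^sup>2 \<le> (r + 1) * (r + 1)\<^sup>2" using False by (intro mult_mono power_mono) auto
      then show "2 * r\<^sup>2 \<le> (r + 1) ^ 3" by (simp only: power3_eq_cube power2_eq_square mult.assoc)
    qed (use False in auto)
    also have "\<dots> = (r + 1) ^ (4 * CARD('n) + 1)"
    proof -
      have e: "4 * CARD('n) + 1 = 3 * CARD('n) + (CARD('n) + 1)" by simp
      show ?thesis unfolding e power_add power_mult power_one_right ..
    qed
    finally show ?thesis .
  qed (simp add: power_0_left)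
  finally show ?thesis
    using fin unfolding cell_monomials_def by blast
qed

lemma cell_monomials_bounded:
  assumes "g \<in> cell_monomials r"
  shows "g \<in> borel_measurable borel" "\<exists>B. \<forall>u::real^'n. (1 + (norm u)\<^sup>2) ^ p * (norm (g u))\<^sup>2 \<le> B"
proof -
  obtain z \<alpha> \<epsilon> where g: "g = cell_monomial r z \<alpha> \<epsilon>" and z: "z \<in> cell_indices r"
    and a: "\<alpha> \<in> PiE UNIV (\<lambda>_. {..<r})" and \<epsilon>: "\<epsilon> = 1 \<or> \<epsilon> = \<i>"
    using assms unfolding cell_monomials_def by auto
  have r: "0 < r" using a by (auto simp: PiE_iff)
  show "g \<in> borel_measurable borel"
    unfolding g cell_monomial_def by measurable
  have "(1 + (norm u)\<^sup>2) ^ p * (norm (g u))\<^sup>2 \<le> (1 + (real CARD('n) * real r)\<^sup>2) ^ p" for u :: "real^'n"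
  proof (cases "\<forall>i. \<lfloor>real r * u $ i\<rfloor> = z i")
    case True
    have le: "\<bar>u $ i\<bar> \<le> real r" "0 \<le> u $ i - z i / r" "u $ i - z i / r \<le> 1" for i
    proof -
      have z: "z i = \<lfloor>real r * u $ i\<rfloor>" "- (int r)\<^sup>2 \<le> \<lfloor>real r * u $ i\<rfloor>" "\<lfloor>real r * u $ i\<rfloor> < (int r)\<^sup>2"
        using True z unfolding cell_indices_def by (auto simp: PiE_iff)
      then have "real r * (- real r) \<le> real r * u $ i" "real r * u $ i < real r * real r"
        by (simp_all add: le_floor_iff floor_less_iff power2_eq_square)
      then have "- real r \<le> u $ i" "u $ i < real r"
        using r by (simp_all only: mult_le_cancel_left_pos mult_less_cancel_left_pos of_nat_0_less_iff)
      then show "\<bar>u $ i\<bar> \<le> real r" by simp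
      have eq: "u $ i - z i / r = (real r * u $ i - \<lfloor>real r * u $ i\<rfloor>) / r"
        using r by (simp add: z(1) field_simps)
      have frac: "0 \<le> real r * u $ i - \<lfloor>real r * u $ i\<rfloor>" "real r * u $ i - \<lfloor>real r * u $ i\<rfloor> \<le> 1"
        by linarith+
      show "0 \<le> u $ i - z i / r" using frac unfolding eq by simp
      have "(real r * u $ i - \<lfloor>real r * u $ i\<rfloor>) / r \<le> 1 / 1"
        using frac r by (intro frac_le) auto
      then show "u $ i - z i / r \<le> 1" unfolding eq by simp
    qed
    have "norm u \<le> (\<Sum>i\<in>UNIV. \<bar>u $ i\<bar>)" by (rule norm_le_l1_cart)
    also have "\<dots> \<le> real CARD('n) * r"
      using sum_bounded_above[of UNIV "\<lambda>i. \<bar>u $ i\<bar>" "real r"] le(1) by simp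
    finally have "(1 + (norm u)\<^sup>2) ^ p \<le> (1 + (real CARD('n) * real r)\<^sup>2) ^ p"
      by (intro power_mono add_left_mono) auto
    moreover have "norm (g u) \<le> 1"
    proof -
      have "norm (g u) = (\<Prod>i\<in>UNIV. (u $ i - z i / r) ^ \<alpha> i)"
      proof -
        have "norm (g u) = \<bar>\<Prod>i\<in>UNIV. (u $ i - z i / r) ^ \<alpha> i\<bar>"
          using True \<epsilon> by (auto simp: g cell_monomial_def norm_mult simp del: of_real_prod)
        then show ?thesis
          using le(2) by (simp add: prod_nonneg)
      qed
      also have "\<dots> \<le> 1"
        using le(2,3) by (intro prod_le_1) (auto intro: power_le_one)
      finally show ?thesis .
    qed
    ultimately have "(1 + (norm u)\<^sup>2) ^ p * (norm (g u))\<^sup>2 \<le> (1 + (real CARD('n) * real r)\<^sup>2) ^ p * 1"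
      by (intro mult_mono power_le_one) auto
    then show ?thesis by simp
  next
    case False
    then have "g u = 0" unfolding g cell_monomial_def by (rule if_not_P)
    then show ?thesis by simp
  qed
  then show "\<exists>B. \<forall>u::real^'n. (1 + (norm u)\<^sup>2) ^ p * (norm (g u))\<^sup>2 \<le> B" by blast
qed

text \<open>
  The \<open>s\<close>-th element of the \<open>r\<close>-th set is put at the position that Cantor's pairing function assigns
  to \<open>(r, s)\<close>. This function grows quadratically, so polynomially many elements occupy polynomially
  bounded positions.
\<close>

lemma polynomial_enumeration:
  fixes F :: "nat \<Rightarrow> 'a set"
  assumes F: "\<And>r. finite (F r)" "\<And>r. card (F r) \<le> (r + 1) ^ K"
  obtains g :: "nat \<Rightarrow> 'a" where "\<And>j. g j = d \<or> (\<exists>r. g j \<in> F r)"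
    "\<And>r. F r \<subseteq> g ` {..<(r + 2) ^ (2 * (K + 2))}"
proof -
  have "\<exists>h. bij_betw h {0..<card (F r)} (F r)" for r
    using ex_bij_betw_nat_finite[OF F(1)] .
  then obtain h where h: "\<And>r. bij_betw (h r) {0..<card (F r)} (F r)" by metis
  define g where "g j = (case prod_decode j of (r, s) \<Rightarrow> if s < card (F r) then h r s else d)" for j
  show thesis
  proof
    show "g j = d \<or> (\<exists>r. g j \<in> F r)" for j
      using bij_betwE[OF h] unfolding g_def by (fastforce split: prod.split)
    show "F r \<subseteq> g ` {..<(r + 2) ^ (2 * (K + 2))}" for r
    proof
      fix x assume "x \<in> F r"
      then have "x \<in> h r ` {0..<card (F r)}"
        using bij_betw_imp_surj_on[OF h[of r]] by simp
      then obtain s where s: "s < card (F r)" "x = h r s" by auto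
      have "g (prod_encode (r, s)) = x" using s by (simp add: g_def)
      moreover have "prod_encode (r, s) < (r + 2) ^ (2 * (K + 2))"
      proof -
        have "prod_encode (r, s) < (r + s + 1)\<^sup>2"
        proof -
          have "triangle n \<le> n * Suc n" for n by (simp add: triangle_def)
          from this[of "r + s"] show ?thesis
            by (simp add: prod_encode_def power2_eq_square algebra_simps)
        qed
        also have "r + s + 1 \<le> (r + 2) ^ (K + 2)"
        proof -
          have "s \<le> (r + 1) ^ K" using s(1) F(2)[of r] by linarith
          then have "r + s + 1 \<le> (r + 1) * 1 + 1 * (r + 1) ^ K" by simp
          also have "\<dots> \<le> (r + 1) * (r + 1) ^ K + (r + 1) * (r + 1) ^ K"
            by (intro add_mono mult_mono) auto
          also have "\<dots> = 2 * (r + 1) ^ (K + 1)" by simp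
          also have "\<dots> \<le> (r + 2) * (r + 2) ^ (K + 1)"
            by (intro mult_mono power_mono) auto
          finally show ?thesis by simp
        qed
        then have "(r + s + 1)\<^sup>2 \<le> ((r + 2) ^ (K + 2))\<^sup>2" by (rule power_mono) simp
        finally show ?thesis by (simp only: power_mult[symmetric] mult.commute)
      qed
      ultimately show "x \<in> g ` {..<(r + 2) ^ (2 * (K + 2))}" by blast
    qed
  qed
qed

text \<open>
  If the \<open>r\<close>-th family is found among the first \<open>(r + 2) ^ M\<close> members of the sequence, then the first
  \<open>k\<close> members contain a family with \<open>r\<close> of order \<open>k\<close> to the power \<open>1 / M\<close>, and an error of order
  \<open>1 / r ^ (M * J)\<close> is one of order \<open>1 / k ^ J\<close>. The sequence is the same for all \<open>J\<close>: the degree of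
  the polynomials grows with \<open>r\<close>, so one orthonormal system gives all rates of decay at once.
\<close>

lemma rapidly_approximating_sequence:
  obtains g :: "nat \<Rightarrow> real^'n \<Rightarrow> complex" where
    "\<And>j. g j \<in> borel_measurable borel"
    "\<And>j. \<exists>B. \<forall>u. (1 + (norm u)\<^sup>2) ^ p * (norm (g j u))\<^sup>2 \<le> B"
    "\<And>J. \<exists>C\<ge>0. \<exists>N. \<forall>f\<in>schwartz. \<forall>k. \<exists>b. \<forall>u.
       (1 + (norm u)\<^sup>2) ^ p * norm (fourier_real f u - (\<Sum>j<k. b j *\<^sub>R g j u)) \<le> C * snorm N f / (1 + real k) ^ J"
proof -
  let ?F = "cell_monomials :: nat \<Rightarrow> (real^'n \<Rightarrow> complex) set"
  let ?K = "4 * CARD('n) + 1"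
  obtain g where g: "\<And>j. g j = (\<lambda>u. 0) \<or> (\<exists>r. g j \<in> ?F r)"
    "\<And>r. ?F r \<subseteq> g ` {..<(r + 2) ^ (2 * (?K + 2))}"
    using polynomial_enumeration[of ?F ?K "\<lambda>u. 0"] card_cell_monomials by blast
  define M where "M = 2 * (?K + 2)"
  show thesis
  proof
    show "g j \<in> borel_measurable borel" for j
      using g(1)[of j] cell_monomials_bounded(1) by auto
    show "\<exists>B. \<forall>u. (1 + (norm u)\<^sup>2) ^ p * (norm (g j u))\<^sup>2 \<le> B" for j
      using g(1)[of j] cell_monomials_bounded(2) by auto
    fix J
    obtain C1 N1 where C1: "C1 \<ge> 0" and approx: "\<And>f r V. f \<in> schwartz \<Longrightarrow> r \<ge> 1 \<Longrightarrow> real_subspace V \<Longrightarrow>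
       ?F r \<subseteq> V \<Longrightarrow> (\<exists>v\<in>V. \<forall>u::real^'n. (1 + (norm u)\<^sup>2) ^ p * norm (fourier_real f u - v u)
         \<le> C1 * snorm N1 f / real r ^ (M * J))"
      using weighted_cell_approximation[of p "M * J", where 'n = 'n] by metis
    obtain C0 N0 where C0: "C0 \<ge> 0"
      and decay: "\<And>f u. f \<in> schwartz \<Longrightarrow> (1 + norm (u::real^'n)) ^ (2 * p) * norm (fourier_real f u) \<le> C0 * snorm N0 f"
      using fourier_real_decay[of "2 * p", where 'n = 'n] by blast
    let ?D = "4 ^ (M * J) :: real" and ?N = "max N0 N1"
    have "\<exists>b. \<forall>u. (1 + (norm u)\<^sup>2) ^ p * norm (fourier_real f u - (\<Sum>j<k. b j *\<^sub>R g j u))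
          \<le> (C0 + C1) * ?D * snorm ?N f / (1 + real k) ^ J" if f: "f \<in> schwartz" for f k
    proof -
      have S: "0 \<le> snorm ?N f" "snorm N0 f \<le> snorm ?N f" "snorm N1 f \<le> snorm ?N f"
        by (intro snorm_nonneg snorm_mono f; simp)+
      have final: "x \<le> (C0 + C1) * ?D * snorm ?N f / (1 + real k) ^ J"
        if x: "x \<le> c * snorm ?N f / real r ^ (M * J)" and c: "c \<le> C0 + C1" "0 \<le> c"
          and r: "1 \<le> r" "k < (r + 3) ^ M" for x c r
      proof -
        \<comment> \<open>\<open>r + 3 \<le> 4 * r\<close>, as \<open>r \<ge> 1\<close>\<close>
        have "1 + k \<le> (4 * r) ^ M"
          using r power_mono[of "r + 3" "4 * r" M] by linarith
        then have "(1 + real k) ^ J \<le> (real ((4 * r) ^ M)) ^ J"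
        proof (intro power_mono)
          show "1 + real k \<le> real ((4 * r) ^ M)"
            using \<open>1 + k \<le> (4 * r) ^ M\<close> by (metis of_nat_1 of_nat_add of_nat_le_iff)
        qed simp
        also have "\<dots> = ?D * real r ^ (M * J)"
          by (simp add: power_mult_distrib flip: power_mult)
        finally have "1 / real r ^ (M * J) \<le> ?D / (1 + real k) ^ J"
          using r by (simp add: field_simps)
        then have "c * snorm ?N f * (1 / real r ^ (M * J)) \<le> (C0 + C1) * snorm ?N f * (?D / (1 + real k) ^ J)"
          using c S(1) by (intro mult_mono mult_right_mono) auto
        then show ?thesis using x by (simp add: mult_ac)
      qed
      define V where "V = {v. \<exists>b. v = (\<lambda>u. \<Sum>j<k. b j *\<^sub>R g j u)}"
      have V: "real_subspace V"
        unfolding real_subspace_def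
      proof (intro conjI ballI allI)
        show "(\<lambda>u. 0) \<in> V" unfolding V_def by (auto intro!: exI[of _ "\<lambda>_. 0"])
        fix v w a b assume "v \<in> V" "w \<in> V"
        then obtain c d where "v = (\<lambda>u. \<Sum>j<k. c j *\<^sub>R g j u)" "w = (\<lambda>u. \<Sum>j<k. d j *\<^sub>R g j u)"
          unfolding V_def by blast
        then show "(\<lambda>u. a *\<^sub>R v u + b *\<^sub>R w u) \<in> V"
          unfolding V_def by (auto intro!: exI[of _ "\<lambda>j. a * c j + b * d j"]
            simp: scaleR_sum_right scaleR_add_left sum.distrib)
      qed
      have gV: "g j \<in> V" if "j < k" for j
        unfolding V_def using that
        by (auto intro!: exI[of _ "\<lambda>i. if i = j then 1 else 0"] simp: if_distrib[of "\<lambda>c. c *\<^sub>R _"] sum.delta cong: if_cong)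
      show ?thesis
      proof (cases "k < 3 ^ M")
        case True
        have "(1 + (norm u)\<^sup>2) ^ p * norm (fourier_real f u) \<le> C0 * snorm ?N f" for u
        proof -
          have "(1 + (norm u)\<^sup>2) ^ p \<le> (1 + norm u) ^ (2 * p)"
            unfolding power_mult by (intro power_mono) (auto simp: power2_eq_square algebra_simps)
          then have "(1 + (norm u)\<^sup>2) ^ p * norm (fourier_real f u) \<le> (1 + norm u) ^ (2 * p) * norm (fourier_real f u)"
            by (rule mult_right_mono) simp
          also have "\<dots> \<le> C0 * snorm ?N f"
            using decay[OF f, of u] mult_left_mono[OF S(2) C0] by linarith
          finally show ?thesis .
        qed
        moreover have "k < (1 + 3) ^ M"
          using True power_mono[of 3 "1 + 3 :: nat" M] by linarith
        ultimately have "(1 + (norm u)\<^sup>2) ^ p * norm (fourier_real f u - (\<Sum>j<k. 0 *\<^sub>R g j u))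
            \<le> (C0 + C1) * ?D * snorm ?N f / (1 + real k) ^ J" for u
          using C0 C1 by (intro final[of _ C0 1]) auto
        then show ?thesis by (intro exI[of _ "\<lambda>_. 0"]) simp
      next
        case False
        \<comment> \<open>This \<open>r\<close> satisfies \<open>(r + 2) ^ M \<le> k < (r + 3) ^ M\<close>.\<close>
        define r where "r = (LEAST r. k < (r + 3) ^ M)"
        have "k < (k + 3) ^ M"
        proof -
          have "0 < M" by (simp add: M_def)
          then have "k + 3 \<le> (k + 3) ^ M" by (intro self_le_power) auto
          then show ?thesis by linarith
        qed
        then have r: "k < (r + 3) ^ M"
          unfolding r_def by (rule LeastI)
        have "r \<noteq> 0" using r False by (intro notI) simp
        then have "\<not> k < (r - 1 + 3) ^ M"
          unfolding r_def by (intro not_less_Least) simp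
        then have "(r + 2) ^ M \<le> k" using \<open>r \<noteq> 0\<close> by (simp add: not_less)
        have "?F r \<subseteq> V"
        proof
          fix v assume "v \<in> ?F r"
          then obtain j where "v = g j" "j < (r + 2) ^ M"
            using g(2)[of r] unfolding M_def by blast
          then show "v \<in> V" using gV \<open>(r + 2) ^ M \<le> k\<close> by simp
        qed
        then obtain v where v: "v \<in> V" "\<And>u. (1 + (norm u)\<^sup>2) ^ p * norm (fourier_real f u - v u)
         \<le> C1 * snorm N1 f / real r ^ (M * J)"
          using approx[OF f _ V, of r] \<open>r \<noteq> 0\<close> by auto
        have "(1 + (norm u)\<^sup>2) ^ p * norm (fourier_real f u - v u) \<le> (C0 + C1) * ?D * snorm ?N f / (1 + real k) ^ J" for u
        proof (rule final)
          have "C1 * snorm N1 f / real r ^ (M * J) \<le> C1 * snorm ?N f / real r ^ (M * J)"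
            by (intro divide_right_mono mult_left_mono C1 S) auto
          with v(2)[of u] show "(1 + (norm u)\<^sup>2) ^ p * norm (fourier_real f u - v u) \<le> C1 * snorm ?N f / real r ^ (M * J)"
            by linarith
        qed (use C0 C1 r \<open>r \<noteq> 0\<close> in auto)
        then show ?thesis using v(1) unfolding V_def by auto
      qed
    qed
    then show "\<exists>C\<ge>0. \<exists>N. \<forall>f\<in>schwartz. \<forall>k. \<exists>b. \<forall>u.
       (1 + (norm u)\<^sup>2) ^ p * norm (fourier_real f u - (\<Sum>j<k. b j *\<^sub>R g j u)) \<le> C * snorm N f / (1 + real k) ^ J"
      using C0 C1 by (intro exI[of _ "(C0 + C1) * ?D"] conjI exI[of _ ?N]) auto
  qed
qed

section \<open>Gram-Schmidt orthogonalisation of square-integrable functions\<close>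

text \<open>
  On complex numbers \<open>z \<bullet> w\<close> is the real part of \<open>z * cnj w\<close>, so \<open>L\<^sub>2\<close> is regarded as a real inner
  product space here.
\<close>

definition l2_inner :: "'a measure \<Rightarrow> ('a \<Rightarrow> complex) \<Rightarrow> ('a \<Rightarrow> complex) \<Rightarrow> real" where
  "l2_inner M f g = (\<integral>u. f u \<bullet> g u \<partial>M)"

lemma L2_integrable_inner:
  fixes f g :: "'a \<Rightarrow> complex"
  assumes "f \<in> L2 M" "g \<in> L2 M"
  shows "integrable M (\<lambda>u. f u \<bullet> g u)"
proof (rule Bochner_Integration.integrable_bound)
  have [measurable]: "f \<in> borel_measurable M" "g \<in> borel_measurable M"
    using assms by (auto simp: L2_def)
  show "integrable M (\<lambda>u. (norm (f u))\<^sup>2 + (norm (g u))\<^sup>2)"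
    using assms by (auto simp: L2_def)
  show "(\<lambda>u. f u \<bullet> g u) \<in> borel_measurable M" by measurable
  have "\<bar>f u \<bullet> g u\<bar> \<le> (norm (f u))\<^sup>2 + (norm (g u))\<^sup>2" for u
  proof -
    have "\<bar>f u \<bullet> g u\<bar> \<le> norm (f u) * norm (g u)" by (rule Cauchy_Schwarz_ineq2)
    moreover have "2 * norm (f u) * norm (g u) \<le> (norm (f u))\<^sup>2 + (norm (g u))\<^sup>2"
      by (rule sum_squares_bound)
    moreover have "0 \<le> norm (f u) * norm (g u)" by simp
    ultimately show ?thesis by linarith
  qed
  then show "AE u in M. norm (f u \<bullet> g u) \<le> norm ((norm (f u))\<^sup>2 + (norm (g u))\<^sup>2)"
    by (intro AE_I2) simp
qed

lemma L2_lincomb: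
  fixes f g :: "'a \<Rightarrow> complex"
  assumes "f \<in> L2 M" "g \<in> L2 M"
  shows "(\<lambda>u. a *\<^sub>R f u + b *\<^sub>R g u) \<in> L2 M"
proof -
  have [measurable]: "f \<in> borel_measurable M" "g \<in> borel_measurable M"
    using assms by (auto simp: L2_def)
  have "(norm (a *\<^sub>R f u + b *\<^sub>R g u))\<^sup>2
     = a\<^sup>2 * (f u \<bullet> f u) + 2 * a * b * (f u \<bullet> g u) + b\<^sup>2 * (g u \<bullet> g u)" for u
    unfolding power2_norm_eq_inner
    by (simp only: inner_add_left inner_add_right inner_scaleR_left inner_scaleR_right inner_commute[of "g u" "f u"])
      (simp add: power2_eq_square algebra_simps)
  then show ?thesis
    using L2_integrable_inner[OF assms(1,1)] L2_integrable_inner[OF assms(1,2)] L2_integrable_inner[OF assms(2,2)]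
    by (simp add: L2_def)
qed

lemma L2_zero: "(\<lambda>u. 0 :: complex) \<in> L2 M"
  by (simp add: L2_def)

lemma L2_sum:
  fixes f :: "'i \<Rightarrow> 'a \<Rightarrow> complex"
  assumes "\<And>i. i \<in> I \<Longrightarrow> f i \<in> L2 M"
  shows "(\<lambda>u. \<Sum>i\<in>I. c i *\<^sub>R f i u) \<in> L2 M"
  using assms
proof (induction I rule: infinite_finite_induct)
  case (insert i I)
  then show ?case using L2_lincomb[of "f i" M "\<lambda>u. \<Sum>i\<in>I. c i *\<^sub>R f i u" "c i" 1] by simp
qed (simp_all add: L2_zero)

lemma l2_inner_commute: "l2_inner M f g = l2_inner M g f"
  unfolding l2_inner_def by (simp add: inner_commute)

lemma l2_inner_lincomb_left:
  assumes "f \<in> L2 M" "g \<in> L2 M" "h \<in> L2 M"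
  shows "l2_inner M (\<lambda>u. a *\<^sub>R f u + b *\<^sub>R g u) h = a * l2_inner M f h + b * l2_inner M g h"
  unfolding l2_inner_def
  using L2_integrable_inner[OF assms(1,3)] L2_integrable_inner[OF assms(2,3)]
  by (simp add: inner_add_left)

lemma l2_inner_sum_left:
  assumes "\<And>i. i \<in> I \<Longrightarrow> f i \<in> L2 M" "h \<in> L2 M"
  shows "l2_inner M (\<lambda>u. \<Sum>i\<in>I. c i *\<^sub>R f i u) h = (\<Sum>i\<in>I. c i * l2_inner M (f i) h)"
proof -
  have "integrable M (\<lambda>u. f i u \<bullet> h u)" if "i \<in> I" for i
    using that by (intro L2_integrable_inner assms)
  then show ?thesis
    unfolding l2_inner_def by (simp add: inner_sum_left Bochner_Integration.integral_sum)
qed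

lemma l2_inner_nonneg: "0 \<le> l2_inner M f f"
  unfolding l2_inner_def by (intro integral_nonneg_AE) auto

lemma l2_inner_self: "l2_inner M f f = (l2_norm M f)\<^sup>2"
  unfolding l2_inner_def l2_norm_def by (simp add: power2_norm_eq_inner integral_nonneg_AE)

lemma l2_Cauchy_Schwarz:
  assumes f: "f \<in> L2 M" and g: "g \<in> L2 M"
  shows "(l2_inner M f g)\<^sup>2 \<le> l2_inner M f f * l2_inner M g g"
proof -
  let ?i = "l2_inner M"
  have expand: "0 \<le> a\<^sup>2 * ?i f f + 2 * a * b * ?i f g + b\<^sup>2 * ?i g g" for a b
  proof -
    let ?h = "\<lambda>u. a *\<^sub>R f u + b *\<^sub>R g u"
    have h: "?h \<in> L2 M" by (rule L2_lincomb[OF f g])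
    have "?i ?h ?h = a * ?i f ?h + b * ?i g ?h"
      by (rule l2_inner_lincomb_left[OF f g h])
    also have "\<dots> = a\<^sup>2 * ?i f f + 2 * a * b * ?i f g + b\<^sup>2 * ?i g g"
      using l2_inner_lincomb_left[OF f g f, of a b] l2_inner_lincomb_left[OF f g g, of a b]
      by (simp add: l2_inner_commute[of M _ ?h] l2_inner_commute[of M g f] power2_eq_square algebra_simps)
    finally show ?thesis using l2_inner_nonneg[of M ?h] by simp
  qed
  show ?thesis
  proof (cases "?i g g = 0")
    case True
    have "?i f g = 0"
    proof (rule ccontr)
      assume nz: "?i f g \<noteq> 0"
      have "0 \<le> ?i f f + 2 * (- (?i f f + 1) / (2 * ?i f g)) * ?i f g"
        using expand[of 1 "- (?i f f + 1) / (2 * ?i f g)"] True by simp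
      then show False using nz by (simp add: field_simps)
    qed
    then show ?thesis using True by simp
  next
    case False
    then have pos: "0 < ?i g g" using l2_inner_nonneg[of M g] by simp
    have "0 \<le> ?i g g * (?i g g * ?i f f - (?i f g)\<^sup>2)"
      using expand[of "?i g g" "- ?i f g"] by (simp add: power2_eq_square algebra_simps)
    then show ?thesis using pos by (simp add: zero_le_mult_iff mult.commute)
  qed
qed

text \<open>
  If \<open>g k\<close> depends on its predecessors, then \<open>h\<close> has norm zero and the quotient by zero makes the
  \<open>k\<close>-th vector the zero function. So the vectors are orthogonal and each is either a unit vector or
  zero; for Bessel's inequality this is as good as orthonormal.
\<close>

function gram_schmidt :: "'a measure \<Rightarrow> (nat \<Rightarrow> 'a \<Rightarrow> complex) \<Rightarrow> nat \<Rightarrow> 'a \<Rightarrow> complex" where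
  "gram_schmidt M g k =
     (let h = (\<lambda>u. g k u - (\<Sum>j<k. l2_inner M (g k) (gram_schmidt M g j) *\<^sub>R gram_schmidt M g j u))
      in (\<lambda>u. (1 / l2_norm M h) *\<^sub>R h u))"
  by pat_completeness auto
termination by (relation "Wellfounded.measure (\<lambda>(M, g, k). k)") auto

declare gram_schmidt.simps [simp del]

context
  fixes M :: "'a measure" and g :: "nat \<Rightarrow> 'a \<Rightarrow> complex"
  assumes g: "\<And>j. g j \<in> L2 M"
begin

private abbreviation "e \<equiv> gram_schmidt M g"
private abbreviation "ip \<equiv> l2_inner M"
private definition "res k f = (\<lambda>u. f u - (\<Sum>j<k. ip f (e j) *\<^sub>R e j u))"

private lemma e_eq: "e k = (\<lambda>u. (1 / l2_norm M (res k (g k))) *\<^sub>R res k (g k) u)"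
  by (subst gram_schmidt.simps) (simp add: res_def Let_def)

lemma gram_schmidt_L2: "e k \<in> L2 M"
proof (induction k rule: less_induct)
  case (less k)
  then have "(\<lambda>u. \<Sum>j<k. ip (g k) (e j) *\<^sub>R e j u) \<in> L2 M" by (intro L2_sum) simp
  from L2_lincomb[OF g[of k] this, of 1 "-1"] have "res k (g k) \<in> L2 M"
    by (simp add: res_def)
  from L2_lincomb[OF this L2_zero, of _ 0] show ?case
    by (simp add: e_eq[of k])
qed

private lemma res_L2: "f \<in> L2 M \<Longrightarrow> res k f \<in> L2 M"
  using L2_lincomb[OF _ L2_sum[of "{..<k}" e M "\<lambda>j. ip f (e j)"], of f 1 "-1"] gram_schmidt_L2
  by (simp add: res_def)

private lemma ip_res:
  assumes "f \<in> L2 M" "h \<in> L2 M"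
  shows "ip (res k f) h = ip f h - (\<Sum>j<k. ip f (e j) * ip (e j) h)"
  using l2_inner_lincomb_left[OF assms(1) L2_sum[of "{..<k}" e M "\<lambda>j. ip f (e j)"] assms(2), of 1 "-1"]
    gram_schmidt_L2 l2_inner_sum_left[of "{..<k}" e M h "\<lambda>j. ip f (e j)"] assms
  by (simp add: res_def)

private lemma ip_e: "h \<in> L2 M \<Longrightarrow> ip (e k) h = ip (res k (g k)) h / l2_norm M (res k (g k))"
  using l2_inner_lincomb_left[OF res_L2[OF g[of k], of k] L2_zero, where b = 0 and h = h]
  by (subst e_eq) simp

lemma gram_schmidt_self: "e k = (\<lambda>u. 0) \<or> ip (e k) (e k) = 1"
proof (cases "l2_norm M (res k (g k)) = 0")
  case True
  then show ?thesis by (subst e_eq) simp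
next
  case False
  have "ip (e k) (e k) = ip (res k (g k)) (res k (g k)) / (l2_norm M (res k (g k)))\<^sup>2"
    by (simp add: ip_e gram_schmidt_L2 res_L2 g l2_inner_commute[of M "res k (g k)" "e k"] power2_eq_square)
  then show ?thesis using False by (simp add: l2_inner_self)
qed

private lemma ip_zero: "ip (\<lambda>u. 0) h = 0" "ip h (\<lambda>u. 0) = 0"
  by (simp_all add: l2_inner_def)

private lemma ip_mult_self: "ip h (e k) * ip (e k) (e k) = ip h (e k)"
  using gram_schmidt_self[of k] by (auto simp: ip_zero)

lemma gram_schmidt_orthogonal: "j < k \<Longrightarrow> ip (e k) (e j) = 0"
proof (induction k arbitrary: j rule: less_induct)
  case (less k)
  have *: "ip (e i) (e j) = 0" if "i < k" "i \<noteq> j" for i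
    using that less less_linear[of i j] by (metis l2_inner_commute)
  have "ip (res k (g k)) (e j) = ip (g k) (e j) - (\<Sum>i<k. ip (g k) (e i) * ip (e i) (e j))"
    by (rule ip_res[OF g gram_schmidt_L2])
  also have "(\<Sum>i<k. ip (g k) (e i) * ip (e i) (e j)) = (\<Sum>i<k. if i = j then ip (g k) (e j) * ip (e j) (e j) else 0)"
    using * by (intro sum.cong) auto
  also have "\<dots> = ip (g k) (e j)"
    using less.prems by (simp add: ip_mult_self)
  finally show ?case by (simp add: ip_e gram_schmidt_L2)
qed

private lemma res_orthogonal:
  assumes "f \<in> L2 M" "j < k"
  shows "ip (res k f) (e j) = 0"
proof -
  have *: "ip (e i) (e j) = 0" if "i \<noteq> j" for i
    using that gram_schmidt_orthogonal less_linear[of i j] by (metis l2_inner_commute)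
  have "(\<Sum>i<k. ip f (e i) * ip (e i) (e j)) = (\<Sum>i<k. if i = j then ip f (e j) * ip (e j) (e j) else 0)"
    using * by (intro sum.cong) auto
  also have "\<dots> = ip f (e j)"
    using assms(2) by (simp add: ip_mult_self)
  finally show ?thesis using ip_res[OF assms(1) gram_schmidt_L2] by simp
qed

private lemma ip_res_res:
  assumes "f \<in> L2 M"
  shows "ip (res k f) (res k f) = ip (res k f) f"
    and "ip (res k f) (res k f) = ip f f - (\<Sum>j<k. (ip f (e j))\<^sup>2)"
proof -
  have "ip (res k f) (res k f) = ip f (res k f) - (\<Sum>j<k. ip f (e j) * ip (e j) (res k f))"
    by (rule ip_res[OF assms res_L2[OF assms]])
  also have "(\<Sum>j<k. ip f (e j) * ip (e j) (res k f)) = 0"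
    using res_orthogonal[OF assms] by (intro sum.neutral) (simp add: l2_inner_commute[of M _ "res k f"])
  finally show *: "ip (res k f) (res k f) = ip (res k f) f"
    by (simp add: l2_inner_commute)
  show "ip (res k f) (res k f) = ip f f - (\<Sum>j<k. (ip f (e j))\<^sup>2)"
    unfolding * ip_res[OF assms assms] by (simp add: power2_eq_square l2_inner_commute)
qed

lemma gram_schmidt_Bessel: "f \<in> L2 M \<Longrightarrow> (\<Sum>j<k. (ip f (e j))\<^sup>2) \<le> ip f f"
  using ip_res_res(2)[of f k] l2_inner_nonneg[of M "res k f"] by simp

text \<open>
  Bessel's sum for \<open>g j\<close> is exhausted by its first \<open>j + 1\<close> terms, because the last one of them is the
  squared norm of the residual left by the others.
\<close>

private lemma res_span_null:
  assumes "j < k"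
  shows "ip (res k (g j)) (res k (g j)) = 0"
proof -
  let ?h = "res j (g j)"
  have "(ip (g j) (e j))\<^sup>2 = ip ?h ?h"
  proof (cases "l2_norm M ?h = 0")
    case True
    then have "ip (g j) (e j) = 0"
      by (subst e_eq) (simp add: ip_zero)
    then show ?thesis using True by (simp add: l2_inner_self)
  next
    case False
    have "ip (g j) (e j) = ip ?h (g j) / l2_norm M ?h"
      using ip_e[OF g, of j j] by (simp add: l2_inner_commute)
    also have "\<dots> = l2_norm M ?h"
      using False by (simp add: ip_res_res(1)[OF g, symmetric] l2_inner_self power2_eq_square)
    finally show ?thesis by (simp add: l2_inner_self)
  qed
  then have "(\<Sum>i<Suc j. (ip (g j) (e i))\<^sup>2) = ip (g j) (g j)"
    using ip_res_res(2)[OF g, of j j] by simp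
  moreover have "(\<Sum>i<Suc j. (ip (g j) (e i))\<^sup>2) \<le> (\<Sum>i<k. (ip (g j) (e i))\<^sup>2)"
    using assms by (intro sum_mono2) auto
  ultimately show ?thesis
    using ip_res_res(2)[OF g, of k j] l2_inner_nonneg[of M "res k (g j)"] by simp
qed

private lemma ip_null:
  assumes "f \<in> L2 M" "h \<in> L2 M" "ip h h = 0"
  shows "ip f h = 0"
  using l2_Cauchy_Schwarz[OF assms(1,2)] assms(3) by simp

private lemma res_orthogonal_span:
  assumes f: "f \<in> L2 M" and j: "j < k"
  shows "ip (res k f) (g j) = 0"
proof -
  have "ip (res k (g j)) (res k f) = ip (g j) (res k f) - (\<Sum>i<k. ip (g j) (e i) * ip (e i) (res k f))"
    by (rule ip_res[OF g res_L2[OF f]])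
  also have "(\<Sum>i<k. ip (g j) (e i) * ip (e i) (res k f)) = 0"
    using res_orthogonal[OF f] by (intro sum.neutral) (simp add: l2_inner_commute[of M _ "res k f"])
  finally have "ip (g j) (res k f) = ip (res k (g j)) (res k f)" by simp
  also have "\<dots> = 0"
    using ip_null[OF res_L2[OF f] res_L2[OF g] res_span_null[OF j]] by (simp add: l2_inner_commute)
  finally show ?thesis by (simp add: l2_inner_commute)
qed

text \<open>
  The \<open>k\<close>-th vector is orthogonal to \<open>g j\<close> for all \<open>j < k\<close>, so the coefficient does not change when a
  combination of these is subtracted. Rapid approximation thereby turns into rapid decrease of
  coefficients.
\<close>

lemma gram_schmidt_coeff_le:
  assumes f: "f \<in> L2 M"
  shows "(ip f (e k))\<^sup>2 \<le> ip (\<lambda>u. f u - (\<Sum>j<k. b j *\<^sub>R g j u)) (\<lambda>u. f u - (\<Sum>j<k. b j *\<^sub>R g j u))"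
    (is "_ \<le> ip ?w ?w")
proof -
  have v: "(\<lambda>u. \<Sum>j<k. b j *\<^sub>R g j u) \<in> L2 M" by (intro L2_sum g)
  have w: "?w \<in> L2 M" using L2_lincomb[OF f v, of 1 "-1"] by simp
  have "ip (\<lambda>u. \<Sum>j<k. b j *\<^sub>R g j u) (e k) = 0"
  proof -
    have "ip (g j) (e k) = 0" if "j < k" for j
      using res_orthogonal_span[OF g that, of k] by (simp add: l2_inner_commute[of M "g j"] ip_e g)
    then show ?thesis using g gram_schmidt_L2 by (simp add: l2_inner_sum_left)
  qed
  then have "ip f (e k) = ip ?w (e k)"
    using l2_inner_lincomb_left[OF f v gram_schmidt_L2, of 1 "-1"] by simp
  then have "(ip f (e k))\<^sup>2 \<le> ip ?w ?w * ip (e k) (e k)"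
    using l2_Cauchy_Schwarz[OF w gram_schmidt_L2] by simp
  also have "\<dots> \<le> ip ?w ?w * 1"
    using gram_schmidt_self[of k] by (intro mult_left_mono l2_inner_nonneg) (auto simp: ip_zero)
  finally show ?thesis by simp
qed

text \<open>
  The residual of \<open>f\<close> is orthogonal to \<open>g j\<close> for all \<open>j < k\<close>. Its squared norm is therefore its inner
  product with \<open>f - v\<close>, for any combination \<open>v\<close> of these, and the Cauchy-Schwarz inequality applies.
\<close>

lemma gram_schmidt_best_approximation:
  assumes f: "f \<in> L2 M"
  shows "ip f f - (\<Sum>j<k. (ip f (e j))\<^sup>2)
    \<le> ip (\<lambda>u. f u - (\<Sum>j<k. b j *\<^sub>R g j u)) (\<lambda>u. f u - (\<Sum>j<k. b j *\<^sub>R g j u))"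
    (is "_ \<le> ip ?w ?w")
proof -
  let ?v = "\<lambda>u. \<Sum>j<k. b j *\<^sub>R g j u" and ?r = "res k f"
  have v: "?v \<in> L2 M" by (intro L2_sum g)
  have w: "?w \<in> L2 M" using L2_lincomb[OF f v, of 1 "-1"] by simp
  have r: "?r \<in> L2 M" by (rule res_L2[OF f])
  have "ip ?v ?r = (\<Sum>j<k. b j * ip (g j) ?r)"
    by (rule l2_inner_sum_left[OF g r])
  also have "\<dots> = 0"
    using res_orthogonal_span[OF f] by (intro sum.neutral) (simp add: l2_inner_commute[of M _ ?r])
  finally have "ip ?v ?r = 0" .
  then have "ip ?r ?r = ip ?w ?r"
    using l2_inner_lincomb_left[OF f v r, of 1 "-1"] ip_res_res(1)[OF f]
    by (simp add: l2_inner_commute[of M f])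
  then have "(ip ?r ?r)\<^sup>2 \<le> ip ?w ?w * ip ?r ?r"
    using l2_Cauchy_Schwarz[OF w r] by simp
  then have "ip ?r ?r \<le> ip ?w ?w"
    using l2_inner_nonneg[of M ?r] l2_inner_nonneg[of M ?w]
    by (cases "ip ?r ?r = 0") (auto simp: power2_eq_square)
  then show ?thesis using ip_res_res(2)[OF f] by simp
qed

end

section \<open>Sums of disjoint smooth bumps\<close>

text \<open>
  For \<open>P = 1\<close> and \<open>m = 0\<close> this is the standard smooth bump on the unit interval. All its derivatives
  have this form.
\<close>

definition bump_term :: "real poly \<Rightarrow> nat \<Rightarrow> real \<Rightarrow> real" where
  "bump_term P m t =
     (if 0 < t \<and> t < 1 then poly P t / (t * (1 - t)) ^ m * exp (- 1 / (t * (1 - t))) else 0)"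

text \<open>
  With \<open>s = t * (1 - t)\<close> the polynomials \<open>[:0, 1, -1:]\<close> and \<open>[:1, -2:]\<close> are \<open>s\<close> and its derivative. This is
  the new numerator after differentiation, which raises the power of \<open>s\<close> in the denominator by two.
\<close>

definition bump_step :: "nat \<Rightarrow> real poly \<Rightarrow> real poly" where
  "bump_step m P = pderiv P * [:0, 1, -1:]\<^sup>2 - smult (of_nat m) (P * [:1, -2:] * [:0, 1, -1:]) + P * [:1, -2:]"

lemma exp_minus_inverse_le_power:
  fixes s :: real
  assumes "0 < s"
  shows "exp (- 1 / s) \<le> fact k * s ^ k"
proof -
  have "inverse (fact k) * (1 / s) ^ k \<le> exp (1 / s)"
    unfolding exp_def using assms sum_le_suminf[OF summable_exp, of "{k}" "1 / s"]
    by (simp add: scaleR_conv_of_real)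
  then have "1 / exp (1 / s) \<le> 1 / (inverse (fact k) * (1 / s) ^ k)"
    using assms by (intro divide_left_mono mult_pos_pos) auto
  then show ?thesis
    by (simp add: exp_minus field_simps power_divide inverse_eq_divide)
qed

text \<open>
  The exponential is smaller than every power of \<open>t * (1 - t)\<close>. Quadratic decrease is enough to make
  the derivative vanish at both end points.
\<close>

lemma bump_term_quadratic_bound:
  "\<exists>C\<ge>0. \<forall>t. \<bar>bump_term P m t\<bar> \<le> C \<and> \<bar>bump_term P m t\<bar> \<le> C * t\<^sup>2 \<and> \<bar>bump_term P m t\<bar> \<le> C * (t - 1)\<^sup>2"
proof -
  have "bounded (poly P ` {0..1})"
    by (intro compact_imp_bounded compact_continuous_image continuous_intros) auto
  then obtain B where B: "B > 0" "\<And>t. t \<in> {0..1} \<Longrightarrow> \<bar>poly P t\<bar> \<le> B"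
    unfolding bounded_pos by auto
  let ?C = "B * fact (m + 2)"
  have "\<bar>bump_term P m t\<bar> \<le> ?C \<and> \<bar>bump_term P m t\<bar> \<le> ?C * t\<^sup>2 \<and> \<bar>bump_term P m t\<bar> \<le> ?C * (t - 1)\<^sup>2" for t
  proof (cases "0 < t \<and> t < 1")
    case True
    define s where "s = t * (1 - t)"
    have s: "0 < s" using True by (simp add: s_def)
    have "\<bar>bump_term P m t\<bar> = \<bar>poly P t\<bar> * (exp (- 1 / s) / s ^ m)"
      using True s by (simp add: bump_term_def s_def abs_mult)
    also have "\<dots> \<le> B * (fact (m + 2) * s ^ (m + 2) / s ^ m)"
      using True s B exp_minus_inverse_le_power[OF s, of "m + 2"]
      by (intro mult_mono divide_right_mono) auto
    also have "\<dots> = ?C * s\<^sup>2"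
      using s by (simp add: power_add power2_eq_square)
    finally have *: "\<bar>bump_term P m t\<bar> \<le> ?C * s\<^sup>2" .
    have "s \<le> 1 * 1" "s \<le> t * 1" "s \<le> 1 * (1 - t)"
      unfolding s_def using True by (intro mult_mono; simp)+
    then have "s\<^sup>2 \<le> 1" "s\<^sup>2 \<le> t\<^sup>2" "s\<^sup>2 \<le> (t - 1)\<^sup>2"
      using s True power_mono[of s 1 2] power_mono[of s t 2] power_mono[of s "1 - t" 2]
      by (simp_all add: power2_commute)
    then have "?C * s\<^sup>2 \<le> ?C * 1" "?C * s\<^sup>2 \<le> ?C * t\<^sup>2" "?C * s\<^sup>2 \<le> ?C * (t - 1)\<^sup>2"
      using B(1) by (intro mult_left_mono; simp)+
    with * show ?thesis by linarith
  qed (use B in \<open>auto simp: bump_term_def\<close>)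
  moreover have "0 \<le> ?C" using B by simp
  ultimately show ?thesis by blast
qed

lemma has_real_derivative_zero_quadratic:
  fixes f :: "real \<Rightarrow> real"
  assumes "\<And>t. \<bar>f t\<bar> \<le> C * (t - a)\<^sup>2"
  shows "(f has_real_derivative 0) (at a)"
proof -
  have fa: "f a = 0" using assms[of a] by simp
  have "((\<lambda>t. C * \<bar>t - a\<bar>) \<longlongrightarrow> C * \<bar>a - a\<bar>) (at a)"
    by (intro tendsto_intros)
  then have lim: "((\<lambda>t. C * \<bar>t - a\<bar>) \<longlongrightarrow> 0) (at a)" by simp
  have "((\<lambda>t. (f t - f a) / (t - a)) \<longlongrightarrow> 0) (at a)"
  proof (rule Lim_null_comparison[OF _ lim])
    have "norm ((f t - f a) / (t - a)) \<le> C * \<bar>t - a\<bar>" if "t \<noteq> a" for t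
    proof -
      have "(t - a)\<^sup>2 = \<bar>t - a\<bar> * \<bar>t - a\<bar>" by (simp add: power2_eq_square)
      then have "\<bar>f t\<bar> \<le> C * \<bar>t - a\<bar> * \<bar>t - a\<bar>" using assms[of t] by (simp only: mult.assoc)
      then show ?thesis using that by (simp add: fa pos_divide_le_eq)
    qed
    then show "\<forall>\<^sub>F t in at a. norm ((f t - f a) / (t - a)) \<le> C * \<bar>t - a\<bar>"
      by (auto simp: eventually_at_filter)
  qed
  then show ?thesis by (simp add: has_field_derivative_iff)
qed

lemma bump_step_algebra:
  fixes i s q w m A p S E :: real
  assumes "i * s = 1" "q * i = m * w"
  shows "(A * w + - (i * S * i) * q * p) * E + E * - (- (i * S * i)) * (p * w)
    = (A * (s * s) - m * p * S * s + p * S) * w * i * i * E"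
proof -
  have "(A * (s * s) - m * p * S * s + p * S) * w * i * i * E
      = A * w * ((i * s) * (i * s)) * E - p * S * (m * w) * (i * s) * i * E + p * S * w * i * i * E"
    by (simp add: algebra_simps)
  also have "\<dots> = A * w * E - p * S * (q * i) * i * E + p * S * w * i * i * E"
    by (simp add: assms)
  finally show ?thesis by (simp add: algebra_simps)
qed

lemma bump_term_derivative:
  "(bump_term P m has_real_derivative bump_term (bump_step m P) (m + 2) t) (at t)"
proof -
  obtain C where C: "\<And>t. \<bar>bump_term P m t\<bar> \<le> C * t\<^sup>2" "\<And>t. \<bar>bump_term P m t\<bar> \<le> C * (t - 1)\<^sup>2"
    using bump_term_quadratic_bound[of P m] by blast
  consider "0 < t" "t < 1" | "t = 0" | "t = 1" | "t < 0" | "1 < t" by linarith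
  then show ?thesis
  proof cases
    case 1
    define s where "s = t * (1 - t)"
    have s: "s \<noteq> 0" "0 < s" using 1 by (simp_all add: s_def)
    define i where "i = inverse s"
    have "((\<lambda>t. t * (1 - t)) has_real_derivative (1 - 2 * t)) (at t)"
      by (auto intro!: derivative_eq_intros)
    from DERIV_inverse'[OF this] have I: "((\<lambda>t. inverse (t * (1 - t))) has_real_derivative - (i * (1 - 2 * t) * i)) (at t)"
      using s by (simp add: i_def s_def)
    have is1: "i * s = 1" using s by (simp add: i_def)
    have pow: "(real m * i ^ (m - Suc 0)) * i = real m * i ^ m" by (cases m) auto
    have "((\<lambda>t. poly P t * (inverse (t * (1 - t))) ^ m * exp (- inverse (t * (1 - t)))) has_real_derivative
       poly (bump_step m P) t / s ^ (m + 2) * exp (- 1 / s)) (at t)"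
    proof -
      have inv: "inverse (t * (1 - t)) = i" "- 1 / s = - i" "x / s ^ (m + 2) = x * i ^ m * i * i" for x
      proof -
        show "inverse (t * (1 - t)) = i" "- 1 / s = - i" by (simp_all add: i_def s_def divide_inverse)
        show "x / s ^ (m + 2) = x * i ^ m * i * i"
          by (simp add: i_def divide_inverse power_add power_inverse mult.assoc)
      qed
      have poly: "poly (bump_step m P) t
          = poly (pderiv P) t * (s * s) - real m * poly P t * (1 - 2 * t) * s + poly P t * (1 - 2 * t)"
        by (simp add: bump_step_def s_def power2_eq_square algebra_simps)
      have "((\<lambda>t. poly P t * (inverse (t * (1 - t))) ^ m) has_real_derivative
          poly (pderiv P) t * i ^ m + - (i * (1 - 2 * t) * i) * (real m * i ^ (m - Suc 0)) * poly P t) (at t)"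
        by (rule DERIV_cong[OF DERIV_mult[OF poly_DERIV DERIV_power[OF I]]]) (unfold inv(1), simp add: mult_ac)
      moreover have "((\<lambda>t. exp (- inverse (t * (1 - t)))) has_real_derivative exp (- i) * - (- (i * (1 - 2 * t) * i))) (at t)"
        by (rule DERIV_cong[OF DERIV_fun_exp[OF DERIV_minus[OF I]]]) (unfold inv(1), simp)
      ultimately have "((\<lambda>t. poly P t * (inverse (t * (1 - t))) ^ m * exp (- inverse (t * (1 - t)))) has_real_derivative
          (poly (pderiv P) t * i ^ m + - (i * (1 - 2 * t) * i) * (real m * i ^ (m - Suc 0)) * poly P t) * exp (- i)
          + exp (- i) * - (- (i * (1 - 2 * t) * i)) * (poly P t * i ^ m)) (at t)"
        by (rule DERIV_cong[OF DERIV_mult]) (unfold inv(1), simp)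
      then show ?thesis
        unfolding inv poly bump_step_algebra[OF is1 pow] .
    qed
    then have "((\<lambda>t. poly P t / (t * (1 - t)) ^ m * exp (- 1 / (t * (1 - t)))) has_real_derivative
       poly (bump_step m P) t / s ^ (m + 2) * exp (- 1 / s)) (at t)"
      by (simp only: divide_inverse power_inverse mult_minus_left mult_1_left)
    then show ?thesis
      using 1 by (subst DERIV_cong_ev[OF refl _ refl])
        (auto simp: bump_term_def s_def intro!: eventually_mono[OF eventually_nhds_in_open[of "{0<..<1}"]])
  next
    case 2
    then show ?thesis using has_real_derivative_zero_quadratic[of "bump_term P m" C 0] C(1)
      by (simp add: bump_term_def)
  next
    case 3
    then show ?thesis using has_real_derivative_zero_quadratic[of "bump_term P m" C 1] C(2)
      by (simp add: bump_term_def)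
  next
    case 4
    have "(bump_term P m has_real_derivative 0) (at t)"
      by (rule has_field_derivative_transform_within_open[of "\<lambda>t. 0" 0 t "{..<0}"])
        (use 4 in \<open>auto simp: bump_term_def\<close>)
    then show ?thesis using 4 by (simp add: bump_term_def)
  next
    case 5
    have "(bump_term P m has_real_derivative 0) (at t)"
      by (rule has_field_derivative_transform_within_open[of "\<lambda>t. 0" 0 t "{1<..}"])
        (use 5 in \<open>auto simp: bump_term_def\<close>)
    then show ?thesis using 5 by (simp add: bump_term_def)
  qed
qed

fun bump_poly :: "nat \<Rightarrow> real poly" where
  "bump_poly 0 = 1"
| "bump_poly (Suc m) = bump_step (2 * m) (bump_poly m)"

definition bump_deriv :: "nat \<Rightarrow> real \<Rightarrow> real" where
  "bump_deriv m = bump_term (bump_poly m) (2 * m)"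

lemma bump_deriv_derivative: "(bump_deriv m has_real_derivative bump_deriv (Suc m) t) (at t)"
  using bump_term_derivative[of "bump_poly m" "2 * m" t] by (simp add: bump_deriv_def)

lemma bump_deriv_bounded: "\<exists>C\<ge>0. \<forall>t. \<bar>bump_deriv m t\<bar> \<le> C"
  using bump_term_quadratic_bound[of "bump_poly m" "2 * m"] unfolding bump_deriv_def by blast

lemma bump_deriv_zero: "t \<le> 0 \<or> 1 \<le> t \<Longrightarrow> bump_deriv m t = 0"
  by (auto simp: bump_deriv_def bump_term_def)

lemma bump_pos: "0 < t \<Longrightarrow> t < 1 \<Longrightarrow> 0 < bump_deriv 0 t"
  by (simp add: bump_deriv_def bump_term_def)

definition bump_train :: "(nat \<Rightarrow> real) \<Rightarrow> nat \<Rightarrow> real \<Rightarrow> real" where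
  "bump_train a m t = (if t < 0 then 0 else a (nat \<lfloor>t\<rfloor>) * bump_deriv m (t - \<lfloor>t\<rfloor>))"

text \<open>
  On the open interval from \<open>\<lfloor>t\<rfloor> - 1\<close> to \<open>\<lfloor>t\<rfloor> + 1\<close> the train is a sum of two shifted bumps. This covers
  the case of an integer \<open>t\<close>, where two bumps meet.
\<close>

lemma bump_train_derivative: "(bump_train a m has_real_derivative bump_train a (Suc m) t) (at t)"
proof -
  define c where "c j = (if j < 0 then 0 else a (nat j))" for j :: int
  define j where "j = \<lfloor>t\<rfloor>"
  let ?G = "\<lambda>m (x::real). c j * bump_deriv m (x - j) + c (j - 1) * bump_deriv m (x - (j - 1))"
  have eq: "bump_train a m x = ?G m x" if "x \<in> {real_of_int j - 1<..<real_of_int j + 1}" for m x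
  proof (cases "x < j")
    have neg: "x < 0 \<longleftrightarrow> \<lfloor>x\<rfloor> < 0" by linarith
    case True
    then have "\<lfloor>x\<rfloor> = j - 1" using that by (auto simp: floor_eq_iff)
    then show ?thesis using True bump_deriv_zero[of "x - j" m]
      by (simp add: bump_train_def c_def neg)
  next
    have neg: "x < 0 \<longleftrightarrow> \<lfloor>x\<rfloor> < 0" by linarith
    case False
    then have "\<lfloor>x\<rfloor> = j" using that by (auto simp: floor_eq_iff)
    then show ?thesis using False bump_deriv_zero[of "x - (j - 1)" m]
      by (simp add: bump_train_def c_def neg)
  qed
  have t: "t \<in> {real_of_int j - 1<..<real_of_int j + 1}"
    unfolding j_def by (simp; linarith)
  have shift: "((\<lambda>x. bump_deriv m (x - y)) has_real_derivative bump_deriv (Suc m) (t - y)) (at t)" for y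
  proof -
    have "((\<lambda>x. x - y) has_real_derivative 1) (at t)"
      by (auto intro!: derivative_eq_intros)
    from DERIV_chain2[where f = "bump_deriv m", OF bump_deriv_derivative this] show ?thesis by simp
  qed
  have "(?G m has_real_derivative ?G (Suc m) t) (at t)"
    by (intro DERIV_add DERIV_cmult shift)
  then have "(bump_train a m has_real_derivative ?G (Suc m) t) (at t)"
    by (rule has_field_derivative_transform_within_open[OF _ _ t]) (use eq in auto)
  then show ?thesis using eq[OF t] by simp
qed

lemma has_derivative_prod_coordinates:
  fixes D :: "'n::finite \<Rightarrow> nat \<Rightarrow> real \<Rightarrow> real"
  assumes D: "\<And>i m t. (D i m has_real_derivative D i (Suc m) t) (at t)"
  shows "((\<lambda>x::real^'n. \<Prod>i\<in>UNIV. D i (m i) (x $ i)) has_derivative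
     (\<lambda>y. \<Sum>i\<in>UNIV. D i (Suc (m i)) (x $ i) * y $ i * (\<Prod>j\<in>UNIV - {i}. D j (m j) (x $ j)))) (at x)"
proof (rule has_derivative_prod)
  fix i
  have "((\<lambda>x::real^'n. x $ i) has_derivative (\<lambda>y. y $ i)) (at x)"
    by (intro bounded_linear_imp_has_derivative bounded_linear_vec_nth)
  from has_derivative_compose[OF this D[of i "m i" "x $ i", unfolded has_field_derivative_def]]
  show "((\<lambda>x. D i (m i) (x $ i)) has_derivative (\<lambda>y. D i (Suc (m i)) (x $ i) * y $ i)) (at x)" .
qed

lemma iter_partial_prod_coordinates:
  fixes D :: "'n::finite \<Rightarrow> nat \<Rightarrow> real \<Rightarrow> real"
  assumes D: "\<And>i m t. (D i m has_real_derivative D i (Suc m) t) (at t)"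
  shows "iter_partial is (\<lambda>x::real^'n. \<Prod>i\<in>UNIV. D i 0 (x $ i))
     = (\<lambda>x. \<Prod>i\<in>UNIV. D i (count_list is i) (x $ i))"
proof (induction "is")
  case (Cons k "is")
  let ?m = "count_list is"
  have "partial_deriv k (\<lambda>x::real^'n. \<Prod>i\<in>UNIV. D i (?m i) (x $ i)) x
      = (\<Prod>i\<in>UNIV. D i (count_list (k # is) i) (x $ i))" for x
  proof -
    have "partial_deriv k (\<lambda>x::real^'n. \<Prod>i\<in>UNIV. D i (?m i) (x $ i)) x
       = (\<Sum>i\<in>UNIV. D i (Suc (?m i)) (x $ i) * axis k 1 $ i * (\<Prod>j\<in>UNIV - {i}. D j (?m j) (x $ j)))"
      by (rule partial_deriv_eq[OF has_derivative_prod_coordinates[where D = D, OF D]])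
    also have "\<dots> = (\<Sum>i\<in>UNIV. if i = k then D k (Suc (?m k)) (x $ k) * (\<Prod>j\<in>UNIV - {k}. D j (?m j) (x $ j)) else 0)"
      by (intro sum.cong) (auto simp: axis_def)
    also have "\<dots> = D k (Suc (?m k)) (x $ k) * (\<Prod>j\<in>UNIV - {k}. D j (?m j) (x $ j))"
      by simp
    also have "(\<Prod>j\<in>UNIV - {k}. D j (?m j) (x $ j)) = (\<Prod>j\<in>UNIV - {k}. D j (count_list (k # is) j) (x $ j))"
      by (intro prod.cong) auto
    also have "D k (Suc (?m k)) (x $ k) * \<dots> = (\<Prod>i\<in>UNIV. D i (count_list (k # is) i) (x $ i))"
      by (subst prod.remove[of UNIV k]) auto
    finally show ?thesis .
  qed
  then show ?case by (intro ext) (simp add: Cons)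
qed simp

lemma smooth_prod_coordinates:
  fixes D :: "'n::finite \<Rightarrow> nat \<Rightarrow> real \<Rightarrow> real"
  assumes D: "\<And>i m t. (D i m has_real_derivative D i (Suc m) t) (at t)"
  shows "smooth (\<lambda>x::real^'n. \<Prod>i\<in>UNIV. D i 0 (x $ i))"
  unfolding smooth_def iter_partial_prod_coordinates[where D = D, OF D]
  using has_derivative_prod_coordinates[where D = D, OF D] unfolding differentiable_def by blast

text \<open>
  Since \<open>norm x\<close> is at most \<open>n\<close> times the product of all \<open>1 + \<bar>x $ i\<bar>\<close>, the weight can be distributed
  over the factors.
\<close>

lemma prod_decay_bound:
  fixes x :: "real^'n" and F :: "'n \<Rightarrow> real \<Rightarrow> real"
  assumes K: "\<And>i t. (1 + \<bar>t\<bar>) ^ k * \<bar>F i t\<bar> \<le> K i"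
  shows "norm x ^ k * \<bar>\<Prod>i\<in>UNIV. F i (x $ i)\<bar> \<le> real CARD('n) ^ k * (\<Prod>i\<in>UNIV. K i)"
proof -
  have "\<bar>x $ i\<bar> \<le> (\<Prod>j\<in>UNIV. 1 + \<bar>x $ j\<bar>)" for i
  proof -
    have "\<bar>x $ i\<bar> \<le> (\<Prod>j\<in>{i}. 1 + \<bar>x $ j\<bar>)" by simp
    also have "\<dots> \<le> (\<Prod>j\<in>UNIV. 1 + \<bar>x $ j\<bar>)" by (intro prod_mono2) auto
    finally show ?thesis .
  qed
  then have "(\<Sum>i\<in>UNIV. \<bar>x $ i\<bar>) \<le> real CARD('n) * (\<Prod>j\<in>UNIV. 1 + \<bar>x $ j\<bar>)"
    using sum_bounded_above[of UNIV "\<lambda>i. \<bar>x $ i\<bar>" "\<Prod>j\<in>UNIV. 1 + \<bar>x $ j\<bar>"] by simp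
  then have "norm x \<le> real CARD('n) * (\<Prod>j\<in>UNIV. 1 + \<bar>x $ j\<bar>)"
    using norm_le_l1_cart[of x] by linarith
  then have "norm x ^ k * \<bar>\<Prod>i\<in>UNIV. F i (x $ i)\<bar>
      \<le> (real CARD('n) * (\<Prod>j\<in>UNIV. 1 + \<bar>x $ j\<bar>)) ^ k * \<bar>\<Prod>i\<in>UNIV. F i (x $ i)\<bar>"
    by (intro mult_right_mono power_mono) auto
  also have "\<dots> = real CARD('n) ^ k * (\<Prod>i\<in>UNIV. (1 + \<bar>x $ i\<bar>) ^ k * \<bar>F i (x $ i)\<bar>)"
    by (simp add: power_mult_distrib prod.distrib prod_power_distrib abs_prod)
  also have "\<dots> \<le> real CARD('n) ^ k * (\<Prod>i\<in>UNIV. K i)"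
    using K by (intro mult_left_mono prod_mono) auto
  finally show ?thesis .
qed

text \<open>
  The sum over \<open>j\<close> of \<open>a j\<close> times the bump on the unit cube, translated by \<open>j\<close> along the \<open>k\<close>-th axis.
  Writing it as a product of functions of one coordinate each makes its partial derivatives explicit.
\<close>

definition bump_sum :: "'n \<Rightarrow> (nat \<Rightarrow> real) \<Rightarrow> real^'n \<Rightarrow> real" where
  "bump_sum k a x = (\<Prod>i\<in>UNIV. (if i = k then bump_train a else bump_deriv) 0 (x $ i))"

lemma bump_sum_derivative:
  "((if i = k then bump_train a else bump_deriv) m has_real_derivative
    (if i = k then bump_train a else bump_deriv) (Suc m) t) (at t)"
  by (simp add: bump_train_derivative bump_deriv_derivative)

lemma iter_partial_bump_sum:
  "iter_partial is (bump_sum k a) =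
    (\<lambda>x. \<Prod>i\<in>UNIV. (if i = k then bump_train a else bump_deriv) (count_list is i) (x $ i))"
  unfolding bump_sum_def
  by (rule iter_partial_prod_coordinates[where D = "\<lambda>i. if i = k then bump_train a else bump_deriv"])
    (rule bump_sum_derivative)

lemma smooth_bump_sum: "smooth (bump_sum k a)"
  unfolding bump_sum_def
  by (rule smooth_prod_coordinates[where D = "\<lambda>i. if i = k then bump_train a else bump_deriv"])
    (rule bump_sum_derivative)

text \<open>
  The \<open>j\<close>-th bump lives where \<open>1 + \<bar>x $ k\<bar>\<close> is at most \<open>2 + j\<close>.
\<close>

lemma bump_sum_bound:
  "\<exists>C\<ge>0. \<forall>a A. (\<forall>j. (2 + real j) ^ l * \<bar>a j\<bar> \<le> A) \<longrightarrow>
     (\<forall>x::real^'n. norm x ^ l * norm (iter_partial is (bump_sum k a) x) \<le> C * A)"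
proof -
  let ?m = "count_list is"
  have "\<exists>B. \<forall>m. 0 \<le> B m \<and> (\<forall>t. \<bar>bump_deriv m t\<bar> \<le> B m)"
    using bump_deriv_bounded by (intro choice) blast
  then obtain B where B: "\<And>m. 0 \<le> B m" "\<And>m t. \<bar>bump_deriv m t\<bar> \<le> B m" by blast
  let ?K = "\<lambda>i::'n. 2 ^ l * B (?m i)"
  let ?C = "real CARD('n) ^ l * (B (?m k) * (\<Prod>i\<in>UNIV - {k}. ?K i))"
  have "norm x ^ l * norm (iter_partial is (bump_sum k a) x) \<le> ?C * A"
    if A: "\<forall>j. (2 + real j) ^ l * \<bar>a j\<bar> \<le> A" for a A and x :: "real^'n"
  proof -
    let ?L = "\<lambda>i. if i = k then B (?m k) * A else ?K i"
    have A0: "0 \<le> A" using A[rule_format, of 0] by (rule order_trans[rotated]) simp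
    have "(1 + \<bar>t\<bar>) ^ l * \<bar>(if i = k then bump_train a else bump_deriv) (?m i) t\<bar> \<le> ?L i" for i t
    proof (cases "i = k")
      case True
      have "(1 + \<bar>t\<bar>) ^ l * \<bar>bump_train a (?m k) t\<bar> \<le> B (?m k) * A"
      proof (cases "t < 0")
        case False
        let ?j = "nat \<lfloor>t\<rfloor>"
        have "1 + \<bar>t\<bar> \<le> 2 + real ?j" using False by simp linarith
        then have "(1 + \<bar>t\<bar>) ^ l * \<bar>bump_train a (?m k) t\<bar>
            \<le> (2 + real ?j) ^ l * (\<bar>a ?j\<bar> * B (?m k))"
          using False B by (intro mult_mono power_mono) (auto simp: bump_train_def abs_mult mult_left_mono)
        also have "\<dots> = B (?m k) * ((2 + real ?j) ^ l * \<bar>a ?j\<bar>)" by simp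
        also have "\<dots> \<le> B (?m k) * A" using A B(1) by (intro mult_left_mono) auto
        finally show ?thesis .
      qed (use A0 B in \<open>simp add: bump_train_def\<close>)
      then show ?thesis using True by simp
    next
      case False
      have "(1 + \<bar>t\<bar>) ^ l * \<bar>bump_deriv (?m i) t\<bar> \<le> ?K i"
      proof (cases "0 < t \<and> t < 1")
        case True
        then show ?thesis using B by (intro mult_mono power_mono) auto
      next
        case False
        then have "bump_deriv (?m i) t = 0" by (intro bump_deriv_zero) auto
        then show ?thesis using B(1) by simp
      qed
      then show ?thesis using False by simp
    qed
    then have "norm x ^ l * norm (iter_partial is (bump_sum k a) x) \<le> real CARD('n) ^ l * (\<Prod>i\<in>UNIV. ?L i)"
      unfolding iter_partial_bump_sum real_norm_def
      by (rule prod_decay_bound[where F = "\<lambda>i. (if i = k then bump_train a else bump_deriv) (?m i)"])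
    also have "(\<Prod>i\<in>UNIV. ?L i) = (B (?m k) * A) * (\<Prod>i\<in>UNIV - {k}. ?K i)"
      by (subst prod.remove[of UNIV k]) (auto intro!: prod.cong arg_cong2[where f = "(*)"])
    finally show ?thesis by (simp only: mult_ac)
  qed
  moreover have "0 \<le> ?C" using B(1) by (intro mult_nonneg_nonneg prod_nonneg) auto
  ultimately show ?thesis by blast
qed

lemma bump_sum_eq:
  "bump_sum k a x = (if x $ k < 0 then 0 else a (nat \<lfloor>x $ k\<rfloor>)) *
     (bump_deriv 0 (x $ k - \<lfloor>x $ k\<rfloor>) * (\<Prod>i\<in>UNIV - {k}. bump_deriv 0 (x $ i)))"
proof -
  have "(\<Prod>i\<in>UNIV - {k}. (if i = k then bump_train a else bump_deriv) 0 (x $ i))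
      = (\<Prod>i\<in>UNIV - {k}. bump_deriv 0 (x $ i))"
    by (intro prod.cong) auto
  then show ?thesis
    unfolding bump_sum_def by (subst prod.remove[of UNIV k]) (auto simp: bump_train_def)
qed

lemma bump_sum_lincomb: "bump_sum k (\<lambda>j. c * a j + d * b j) x = c * bump_sum k a x + d * bump_sum k b x"
  unfolding bump_sum_eq by (simp add: algebra_simps)

definition cube_bump :: "real^'n \<Rightarrow> real" where
  "cube_bump x = (\<Prod>i\<in>UNIV. bump_deriv 0 (x $ i))"

lemma cube_bump_measurable [measurable]: "cube_bump \<in> borel_measurable borel"
proof -
  have [measurable]: "bump_deriv 0 \<in> borel_measurable borel"
    using bump_deriv_derivative[of 0]
    by (intro borel_measurable_continuous_onI) (auto intro!: continuous_at_imp_continuous_on DERIV_isCont)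
  show ?thesis unfolding cube_bump_def by measurable
qed

lemma cube_bump_mass:
  obtains c where "0 < c" "(\<integral>\<^sup>+x. ennreal ((cube_bump x)\<^sup>2) \<partial>(lborel :: (real^'n) measure)) = ennreal c"
proof -
  let ?I = "\<integral>\<^sup>+x. ennreal ((cube_bump x)\<^sup>2) \<partial>(lborel :: (real^'n) measure)"
  let ?U = "box 0 (\<chi> i. 1) :: (real^'n) set"
  obtain B where B: "0 \<le> B" "\<And>t. \<bar>bump_deriv 0 t\<bar> \<le> B"
    using bump_deriv_bounded by blast
  have U: "x \<in> ?U \<longleftrightarrow> (\<forall>i. 0 < x $ i \<and> x $ i < 1)" for x
    by (auto simp: mem_box_cart)
  have pos: "0 < cube_bump x" if "x \<in> ?U" for x
    using that unfolding cube_bump_def U by (intro prod_pos) (simp add: bump_pos)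
  have zero: "cube_bump x = 0" if "x \<notin> ?U" for x
  proof -
    have "\<exists>i. \<not> (0 < x $ i \<and> x $ i < 1)" using that U by blast
    then obtain i where "\<not> (0 < x $ i \<and> x $ i < 1)" by blast
    then have "x $ i \<le> 0 \<or> 1 \<le> x $ i" by auto
    then have "bump_deriv 0 (x $ i) = 0" by (rule bump_deriv_zero)
    then show ?thesis unfolding cube_bump_def by (intro prod_zero) auto
  qed
  have le: "ennreal ((cube_bump x)\<^sup>2) \<le> ennreal ((B ^ CARD('n))\<^sup>2) * indicator ?U x" for x :: "real^'n"
  proof (cases "x \<in> ?U")
    case True
    have "\<bar>cube_bump x\<bar> \<le> (\<Prod>i\<in>(UNIV::'n set). B)"
      unfolding cube_bump_def abs_prod using B by (intro prod_mono) auto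
    then have "(cube_bump x)\<^sup>2 \<le> (B ^ CARD('n))\<^sup>2"
      using pos[OF True] by (intro power_mono) auto
    then show ?thesis using True by (simp add: ennreal_leI)
  qed (simp add: zero)
  have "?I \<le> (\<integral>\<^sup>+x. ennreal ((B ^ CARD('n))\<^sup>2) * indicator ?U x \<partial>lborel)"
    by (intro nn_integral_mono le)
  also have "\<dots> = ennreal ((B ^ CARD('n))\<^sup>2) * emeasure lborel ?U"
    by (rule nn_integral_cmult_indicator) simp
  also have "\<dots> < \<infinity>"
    using emeasure_bounded_finite[OF bounded_box[of 0 "(\<chi> i. 1) :: real^'n"]] by (simp add: ennreal_mult_less_top)
  finally have fin: "?I < \<infinity>" .
  moreover have "?I \<noteq> 0"
  proof
    assume "?I = 0"
    then have "AE x in (lborel :: (real^'n) measure). ennreal ((cube_bump x)\<^sup>2) = 0"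
      by (subst (asm) nn_integral_0_iff_AE) auto
    then have "AE x in (lborel :: (real^'n) measure). x \<notin> ?U"
      by eventually_elim (use pos in force)
    then have "emeasure lborel ?U = 0"
      using AE_iff_null_sets[of ?U lborel] by auto
    moreover have "emeasure lborel ?U = 1"
    proof -
      have one: "(\<chi> i. 1) \<bullet> b = 1" if "b \<in> Basis" for b :: "real^'n"
        using that by (auto simp: Basis_vec_def inner_axis)
      then have "emeasure lborel ?U = ennreal (\<Prod>b\<in>Basis. ((\<chi> i. 1) - 0 :: real^'n) \<bullet> b)"
        by (intro emeasure_lborel_box) simp
      also have "(\<Prod>b\<in>Basis. ((\<chi> i. 1) - 0 :: real^'n) \<bullet> b) = 1"
        using one by (intro prod.neutral) simp
      finally show ?thesis by simp
    qed
    ultimately show False by simp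
  qed
  ultimately show thesis
    using that[of "enn2real ?I"] by (auto simp: enn2real_positive_iff zero_less_iff_neq_zero)
qed

lemma bump_sum_square:
  fixes x :: "real^'n"
  shows "ennreal ((bump_sum k a x)\<^sup>2) = (\<Sum>j. ennreal ((a j)\<^sup>2) * ennreal ((cube_bump (- (real j *\<^sub>R axis k 1) + x))\<^sup>2))"
proof -
  let ?t = "\<lambda>j. ennreal ((a j)\<^sup>2) * ennreal ((cube_bump (- (real j *\<^sub>R axis k 1) + x))\<^sup>2)"
  have shift: "cube_bump (- (real j *\<^sub>R axis k 1) + x)
      = bump_deriv 0 (x $ k - real j) * (\<Prod>i\<in>UNIV - {k}. bump_deriv 0 (x $ i))" for j
  proof -
    have "(\<Prod>i\<in>UNIV - {k}. bump_deriv 0 ((- (real j *\<^sub>R axis k 1) + x) $ i))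
      = (\<Prod>i\<in>UNIV - {k}. bump_deriv 0 (x $ i))"
      by (intro prod.cong) (auto simp: axis_def)
    then show ?thesis
      unfolding cube_bump_def by (subst prod.remove[of UNIV k]) (auto simp: axis_def)
  qed
  show ?thesis
  proof (cases "x $ k < 0")
    case True
    then have "?t j = 0" for j
      unfolding shift using bump_deriv_zero[of "x $ k - real j" 0] by simp
    then have "(\<Sum>j. ?t j) = 0" by (simp only: suminf_zero)
    then show ?thesis using True by (simp add: bump_sum_eq)
  next
    case False
    define n where "n = nat \<lfloor>x $ k\<rfloor>"
    have n: "real n = \<lfloor>x $ k\<rfloor>" using False by (simp add: n_def)
    have "?t j = 0" if "j \<noteq> n" for j
    proof -
      have "x $ k - real j \<le> 0 \<or> 1 \<le> x $ k - real j"
        using that n by (cases "j < n") linarith+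
      then show ?thesis unfolding shift using bump_deriv_zero by auto
    qed
    then have "(\<Sum>j. ?t j) = (\<Sum>j\<in>{n}. ?t j)" by (intro suminf_finite) auto
    also have "\<dots> = ?t n" by simp
    also have "\<dots> = ennreal ((bump_sum k a x)\<^sup>2)"
    proof -
      have "bump_sum k a x = a n * cube_bump (- (real n *\<^sub>R axis k 1) + x)"
        unfolding bump_sum_eq shift using False by (simp add: n_def)
      then show ?thesis by (simp only: power_mult_distrib ennreal_mult zero_le_power2)
    qed
    finally show ?thesis by simp
  qed
qed

text \<open>
  The translated bumps have disjoint supports and the same mass, by translation invariance of
  Lebesgue measure.
\<close>

lemma bump_sum_norm:
  obtains c where "0 < c" "\<And>a. (\<integral>\<^sup>+x. ennreal ((bump_sum k a x)\<^sup>2) \<partial>(lborel :: (real^'n) measure))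
     = ennreal c * (\<Sum>j. ennreal ((a j)\<^sup>2))"
proof -
  obtain c where c: "0 < c" "(\<integral>\<^sup>+x. ennreal ((cube_bump x)\<^sup>2) \<partial>(lborel :: (real^'n) measure)) = ennreal c"
    by (rule cube_bump_mass)
  have shift: "(\<integral>\<^sup>+x. ennreal ((cube_bump (y + x))\<^sup>2) \<partial>lborel) = ennreal c" for y :: "real^'n"
    unfolding c(2)[symmetric]
    by (subst (2) lborel_distr_plus[of y, symmetric]) (subst nn_integral_distr; simp)
  have "(\<integral>\<^sup>+x. ennreal ((bump_sum k a x)\<^sup>2) \<partial>(lborel :: (real^'n) measure))
     = ennreal c * (\<Sum>j. ennreal ((a j)\<^sup>2))" for a
  proof -
    have "(\<integral>\<^sup>+x. ennreal ((bump_sum k a x)\<^sup>2) \<partial>(lborel :: (real^'n) measure))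
       = (\<Sum>j. \<integral>\<^sup>+x. ennreal ((a j)\<^sup>2) * ennreal ((cube_bump (- (real j *\<^sub>R axis k 1) + x))\<^sup>2) \<partial>(lborel :: (real^'n) measure))"
      unfolding bump_sum_square by (rule nn_integral_suminf) simp
    also have "\<dots> = (\<Sum>j. ennreal ((a j)\<^sup>2) * ennreal c)"
    proof (intro arg_cong[where f = suminf] ext)
      fix j
      have "(\<integral>\<^sup>+x. ennreal ((a j)\<^sup>2) * ennreal ((cube_bump (- (real j *\<^sub>R axis k 1) + x))\<^sup>2) \<partial>(lborel :: (real^'n) measure))
          = ennreal ((a j)\<^sup>2) * (\<integral>\<^sup>+x. ennreal ((cube_bump (- (real j *\<^sub>R axis k 1) + x))\<^sup>2) \<partial>lborel)"
        by (rule nn_integral_cmult) simp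
      then show "(\<integral>\<^sup>+x. ennreal ((a j)\<^sup>2) * ennreal ((cube_bump (- (real j *\<^sub>R axis k 1) + x))\<^sup>2) \<partial>(lborel :: (real^'n) measure))
          = ennreal ((a j)\<^sup>2) * ennreal c"
        unfolding shift .
    qed
    also have "\<dots> = ennreal c * (\<Sum>j. ennreal ((a j)\<^sup>2))"
      unfolding mult.commute[of _ "ennreal c"] by (rule ennreal_suminf_cmult)
    finally show ?thesis .
  qed
  with c(1) show thesis by (rule that)
qed

section \<open>A factorisation of the covariance through Schwartz functions\<close>

lemma weighted_bound_L2:
  fixes f :: "real^'n \<Rightarrow> complex"
  assumes sets: "sets \<sigma> = sets borel"
    and fin: "(\<integral>\<^sup>+u. ennreal (1 / (1 + (norm u)\<^sup>2) ^ p) \<partial>\<sigma>) < \<infinity>"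
    and f: "f \<in> borel_measurable borel" "\<And>u. (1 + (norm u)\<^sup>2) ^ p * (norm (f u))\<^sup>2 \<le> B"
  shows "f \<in> L2 \<sigma>"
    and "l2_inner \<sigma> f f \<le> B * (\<integral>u. 1 / (1 + (norm u)\<^sup>2) ^ p \<partial>\<sigma>)"
proof -
  have meas: "g \<in> borel_measurable \<sigma>" if "g \<in> borel_measurable borel" for g :: "real^'n \<Rightarrow> 'c::topological_space"
    using that sets by (simp cong: measurable_cong_sets)
  have int: "integrable \<sigma> (\<lambda>u. 1 / (1 + (norm u)\<^sup>2) ^ p)"
    using fin by (intro integrableI_bounded meas) auto
  have le: "(norm (f u))\<^sup>2 \<le> B * (1 / (1 + (norm u)\<^sup>2) ^ p)" for u
    using f(2)[of u] by (simp add: pos_le_divide_eq add_pos_nonneg mult.commute)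
  have int2: "integrable \<sigma> (\<lambda>u. (norm (f u))\<^sup>2)"
  proof (rule Bochner_Integration.integrable_bound[OF integrable_mult_right[OF int, of B]])
    show "(\<lambda>u. (norm (f u))\<^sup>2) \<in> borel_measurable \<sigma>"
      using f(1) by (intro meas) measurable
    show "AE u in \<sigma>. norm ((norm (f u))\<^sup>2) \<le> norm (B * (1 / (1 + (norm u)\<^sup>2) ^ p))"
      using le by (intro AE_I2) (simp only: real_norm_def abs_of_nonneg zero_le_power2 order_trans[OF le abs_ge_self])
  qed
  then show L: "f \<in> L2 \<sigma>"
    using meas[OF f(1)] by (simp add: L2_def)
  have "l2_inner \<sigma> f f = (\<integral>u. (norm (f u))\<^sup>2 \<partial>\<sigma>)"
    by (simp add: l2_inner_def power2_norm_eq_inner)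
  also have "\<dots> \<le> (\<integral>u. B * (1 / (1 + (norm u)\<^sup>2) ^ p) \<partial>\<sigma>)"
    by (intro integral_mono int2 integrable_mult_right int le)
  also have "\<dots> = B * (\<integral>u. 1 / (1 + (norm u)\<^sup>2) ^ p \<partial>\<sigma>)"
    by (rule integral_mult_right_zero)
  finally show "l2_inner \<sigma> f f \<le> B * (\<integral>u. 1 / (1 + (norm u)\<^sup>2) ^ p \<partial>\<sigma>)" .
qed

lemma power2_weight_le:
  fixes w x b :: real
  assumes "1 \<le> w" "0 \<le> x" "w * x \<le> b"
  shows "w * x\<^sup>2 \<le> b\<^sup>2"
proof -
  have "w * x\<^sup>2 \<le> (w * x)\<^sup>2"
    using mult_right_mono[OF assms(1), of "w * x\<^sup>2"] assms(1) by (simp add: power2_eq_square mult_ac)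
  also have "\<dots> \<le> b\<^sup>2" using assms by (intro power_mono) auto
  finally show ?thesis .
qed

text \<open>
  Take \<open>p\<close> such that \<open>\<sigma>\<close> becomes finite when divided by \<open>(1 + (norm u)\<^sup>2) ^ p\<close>. Pointwise errors
  weighted by this factor are errors in \<open>L\<^sub>2(\<sigma>)\<close>. Parseval's identity holds for Fourier transforms of
  Schwartz functions because these are limits of combinations of the approximating sequence.
\<close>

lemma rapidly_decreasing_coefficients:
  fixes \<sigma> :: "(real^'n) measure"
  assumes "\<sigma> \<in> spectral_measures"
  obtains e :: "nat \<Rightarrow> real^'n \<Rightarrow> complex" where
    "\<And>k. e k \<in> L2 \<sigma>" "\<And>\<psi>. \<psi> \<in> schwartz \<Longrightarrow> fourier_real \<psi> \<in> L2 \<sigma>"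
    "\<And>l. \<exists>C\<ge>0. \<exists>N. \<forall>\<psi>\<in>schwartz. \<forall>k. (2 + real k) ^ l * \<bar>l2_inner \<sigma> (fourier_real \<psi>) (e k)\<bar> \<le> C * snorm N \<psi>"
    "\<And>\<psi>. \<psi> \<in> schwartz \<Longrightarrow> (\<lambda>k. (l2_inner \<sigma> (fourier_real \<psi>) (e k))\<^sup>2) sums (l2_norm \<sigma> (fourier_real \<psi>))\<^sup>2"
proof -
  obtain p where sets: "sets \<sigma> = sets borel"
    and fin: "(\<integral>\<^sup>+u. ennreal (1 / (1 + (norm u)\<^sup>2) ^ p) \<partial>\<sigma>) < \<infinity>"
    using assms unfolding spectral_measures_def regular_borel_measure_def by blast
  let ?A = "\<integral>u. 1 / (1 + (norm u)\<^sup>2) ^ p \<partial>\<sigma>"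
  have A: "0 \<le> ?A" by (intro integral_nonneg_AE) auto
  have one_le: "1 \<le> (1 + (norm u)\<^sup>2) ^ p" for u :: "real^'n" by (intro one_le_power) simp
  obtain g :: "nat \<Rightarrow> real^'n \<Rightarrow> complex" where
    g: "\<And>j. g j \<in> borel_measurable borel" "\<And>j. \<exists>B. \<forall>u. (1 + (norm u)\<^sup>2) ^ p * (norm (g j u))\<^sup>2 \<le> B"
    and approx: "\<And>J. \<exists>C\<ge>0. \<exists>N. \<forall>f\<in>schwartz. \<forall>k. \<exists>b. \<forall>u.
       (1 + (norm u)\<^sup>2) ^ p * norm (fourier_real f u - (\<Sum>j<k. b j *\<^sub>R g j u)) \<le> C * snorm N f / (1 + real k) ^ J"
    by (rule rapidly_approximating_sequence[of p], rule that)
  have gL2: "g j \<in> L2 \<sigma>" for j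
    using g(2)[of j] weighted_bound_L2(1)[OF sets fin g(1)[of j]] by blast
  let ?r = "\<lambda>\<psi> k b u. fourier_real \<psi> u - (\<Sum>j<k. b j *\<^sub>R g j u)"
  define e where "e = gram_schmidt \<sigma> g"
  have dist: "\<exists>C\<ge>0. \<exists>N. \<forall>\<psi>\<in>schwartz. \<forall>k. \<exists>b.
      l2_inner \<sigma> (?r \<psi> k b) (?r \<psi> k b)
        \<le> (C * snorm N \<psi> / (1 + real k) ^ J)\<^sup>2" for J
  proof -
    obtain C N where C: "C \<ge> 0" and b: "\<And>f k. f \<in> schwartz \<Longrightarrow> \<exists>b. \<forall>u.
       (1 + (norm u)\<^sup>2) ^ p * norm (fourier_real f u - (\<Sum>j<k. b j *\<^sub>R g j u)) \<le> C * snorm N f / (1 + real k) ^ J"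
      using approx[of J] by blast
    have "\<exists>b. l2_inner \<sigma> (?r \<psi> k b) (?r \<psi> k b)
        \<le> (sqrt ?A * C * snorm N \<psi> / (1 + real k) ^ J)\<^sup>2" if \<psi>: "\<psi> \<in> schwartz" for \<psi> k
    proof -
      obtain b where b: "\<And>u. (1 + (norm u)\<^sup>2) ^ p * norm (fourier_real \<psi> u - (\<Sum>j<k. b j *\<^sub>R g j u))
          \<le> C * snorm N \<psi> / (1 + real k) ^ J"
        using b[OF \<psi>, of k] by blast
      let ?w = "\<lambda>u. fourier_real \<psi> u - (\<Sum>j<k. b j *\<^sub>R g j u)"
      have [measurable]: "\<psi> \<in> borel_measurable borel" "\<And>j. g j \<in> borel_measurable borel"
        using schwartz_measurable[OF \<psi>] g(1) by auto
      have "l2_inner \<sigma> ?w ?w \<le> (C * snorm N \<psi> / (1 + real k) ^ J)\<^sup>2 * ?A"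
        by (rule weighted_bound_L2(2)[OF sets fin]) (measurable, rule power2_weight_le[OF one_le norm_ge_zero b])
      also have "\<dots> = (sqrt ?A * C * snorm N \<psi> / (1 + real k) ^ J)\<^sup>2"
        using A by (simp add: power_mult_distrib power_divide)
      finally show ?thesis by blast
    qed
    moreover have "0 \<le> sqrt ?A * C" using A C by simp
    ultimately show ?thesis by blast
  qed
  have ftL2: "fourier_real \<psi> \<in> L2 \<sigma>" if \<psi>: "\<psi> \<in> schwartz" for \<psi> :: "real^'n \<Rightarrow> real"
  proof -
    obtain C N where *: "\<forall>f\<in>schwartz. \<forall>k. \<exists>b. \<forall>u.
       (1 + (norm u)\<^sup>2) ^ p * norm (fourier_real f u - (\<Sum>j<k. b j *\<^sub>R g j u)) \<le> C * snorm N f / (1 + real k) ^ 0"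
      using approx[of 0] by blast
    obtain b where "\<forall>u. (1 + (norm u)\<^sup>2) ^ p * norm (fourier_real \<psi> u - (\<Sum>j<0. b j *\<^sub>R g j u)) \<le> C * snorm N \<psi> / (1 + real 0) ^ 0"
      using *[rule_format, OF \<psi>, of 0] by blast
    then have "(1 + (norm u)\<^sup>2) ^ p * norm (fourier_real \<psi> u) \<le> C * snorm N \<psi>" for u by simp
    then have "(1 + (norm u)\<^sup>2) ^ p * (norm (fourier_real \<psi> u))\<^sup>2 \<le> (C * snorm N \<psi>)\<^sup>2" for u
      by (rule power2_weight_le[OF one_le norm_ge_zero])
    then show ?thesis
      using weighted_bound_L2(1)[OF sets fin fourier_real_measurable[OF schwartz_measurable[OF \<psi>]]] by blast
  qed
  show thesis
  proof
    show "e k \<in> L2 \<sigma>" for k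
      unfolding e_def by (rule gram_schmidt_L2[OF gL2])
    show "fourier_real \<psi> \<in> L2 \<sigma>" if "\<psi> \<in> schwartz" for \<psi> :: "real^'n \<Rightarrow> real" by (rule ftL2[OF that])
    show "\<exists>C\<ge>0. \<exists>N. \<forall>\<psi>\<in>schwartz. \<forall>k. (2 + real k) ^ l * \<bar>l2_inner \<sigma> (fourier_real \<psi>) (e k)\<bar> \<le> C * snorm N \<psi>" for l
    proof -
      obtain C N where C: "C \<ge> 0" and b: "\<And>\<psi> k. \<psi> \<in> schwartz \<Longrightarrow> \<exists>b.
        l2_inner \<sigma> (?r \<psi> k b) (?r \<psi> k b)
          \<le> (C * snorm N \<psi> / (1 + real k) ^ l)\<^sup>2"
        using dist[of l] by blast
      have "(2 + real k) ^ l * \<bar>l2_inner \<sigma> (fourier_real \<psi>) (e k)\<bar> \<le> 2 ^ l * C * snorm N \<psi>" if \<psi>: "\<psi> \<in> schwartz" for \<psi> k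
      proof -
        let ?R = "C * snorm N \<psi> / (1 + real k) ^ l"
        obtain b where "l2_inner \<sigma> (?r \<psi> k b) (?r \<psi> k b) \<le> ?R\<^sup>2"
          using b[OF \<psi>] by blast
        then have "(l2_inner \<sigma> (fourier_real \<psi>) (e k))\<^sup>2 \<le> ?R\<^sup>2"
          unfolding e_def by (rule order_trans[OF gram_schmidt_coeff_le[OF gL2 ftL2[OF \<psi>]]])
        moreover have "0 \<le> ?R" using C snorm_nonneg[OF \<psi>] by simp
        ultimately have le: "\<bar>l2_inner \<sigma> (fourier_real \<psi>) (e k)\<bar> \<le> ?R"
          by (metis abs_le_square_iff abs_of_nonneg)
        have "(2 + real k) ^ l * \<bar>l2_inner \<sigma> (fourier_real \<psi>) (e k)\<bar> \<le> (2 * (1 + real k)) ^ l * ?R"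
          using le by (intro mult_mono power_mono) auto
        also have "\<dots> = 2 ^ l * C * snorm N \<psi>"
          by (simp only: power_mult_distrib) simp
        finally show ?thesis .
      qed
      moreover have "0 \<le> 2 ^ l * C" using C by simp
      ultimately show ?thesis by blast
    qed
    fix \<psi> :: "real^'n \<Rightarrow> real"
    assume \<psi>: "\<psi> \<in> schwartz"
    obtain C N where b: "\<And>k. \<exists>b.
        l2_inner \<sigma> (?r \<psi> k b) (?r \<psi> k b)
          \<le> (C * snorm N \<psi> / (1 + real k) ^ 1)\<^sup>2"
      using dist[of 1] \<psi> by blast
    let ?n = "(l2_norm \<sigma> (fourier_real \<psi>))\<^sup>2"
    let ?E = "\<lambda>k. C * snorm N \<psi> * inverse (real (Suc k))"
    have lower: "?n - (?E k)\<^sup>2 \<le> (\<Sum>j<k. (l2_inner \<sigma> (fourier_real \<psi>) (e j))\<^sup>2)" for k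
    proof -
      obtain b where "l2_inner \<sigma> (?r \<psi> k b) (?r \<psi> k b)
          \<le> (?E k)\<^sup>2"
        using b[of k] by (auto simp: divide_inverse)
      from order_trans[OF gram_schmidt_best_approximation[OF gL2 ftL2[OF \<psi>]] this]
      show ?thesis unfolding e_def by (simp add: l2_inner_self)
    qed
    have upper: "(\<Sum>j<k. (l2_inner \<sigma> (fourier_real \<psi>) (e j))\<^sup>2) \<le> ?n" for k
      unfolding e_def l2_inner_self[symmetric] by (rule gram_schmidt_Bessel[OF gL2 ftL2[OF \<psi>]])
    have "(\<lambda>k. ?n - (?E k)\<^sup>2) \<longlonglongrightarrow> ?n - (C * snorm N \<psi> * 0)\<^sup>2"
      by (intro tendsto_intros LIMSEQ_inverse_real_of_nat)
    then have "(\<lambda>k. ?n - (?E k)\<^sup>2) \<longlonglongrightarrow> ?n" by simp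
    then show "(\<lambda>k. (l2_inner \<sigma> (fourier_real \<psi>) (e k))\<^sup>2) sums ?n"
      unfolding sums_def by (rule tendsto_sandwich[rotated 2, OF _ tendsto_const]) (use lower upper in auto)
  qed
qed

text \<open>
  Spread the coefficients over disjoint bumps. Their rapid decrease makes \<open>Q \<psi>\<close> a Schwartz function
  that depends continuously on \<open>\<psi>\<close>, and Parseval's identity computes its norm.
\<close>

lemma spectral_factor:
  fixes \<sigma> :: "(real^'n) measure"
  assumes "\<sigma> \<in> spectral_measures"
  obtains Q :: "(real^'n \<Rightarrow> real) \<Rightarrow> real^'n \<Rightarrow> real" where
    "\<And>\<psi>. \<psi> \<in> schwartz \<Longrightarrow> Q \<psi> \<in> schwartz"
    "\<And>\<phi> \<psi> a b. \<phi> \<in> schwartz \<Longrightarrow> \<psi> \<in> schwartz \<Longrightarrow>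
       Q (\<lambda>x. a * \<phi> x + b * \<psi> x) = (\<lambda>x. a * Q \<phi> x + b * Q \<psi> x)"
    "\<And>k is. \<exists>C\<ge>0. \<exists>N. \<forall>\<psi>\<in>schwartz. schwartz_seminorm k is (Q \<psi>) \<le> C * snorm N \<psi>"
    "\<And>\<psi>. \<psi> \<in> schwartz \<Longrightarrow> l2_norm lborel (Q \<psi>) = l2_norm \<sigma> (fourier_real \<psi>)"
proof -
  obtain e :: "nat \<Rightarrow> real^'n \<Rightarrow> complex" where e: "\<And>k. e k \<in> L2 \<sigma>"
    and ftL2: "\<And>\<psi>. \<psi> \<in> schwartz \<Longrightarrow> fourier_real \<psi> \<in> L2 \<sigma>"
    and decay: "\<And>l. \<exists>C\<ge>0. \<exists>N. \<forall>\<psi>\<in>schwartz. \<forall>k. (2 + real k) ^ l * \<bar>l2_inner \<sigma> (fourier_real \<psi>) (e k)\<bar> \<le> C * snorm N \<psi>"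
    and parseval: "\<And>\<psi>. \<psi> \<in> schwartz \<Longrightarrow> (\<lambda>k. (l2_inner \<sigma> (fourier_real \<psi>) (e k))\<^sup>2) sums (l2_norm \<sigma> (fourier_real \<psi>))\<^sup>2"
    by (rule rapidly_decreasing_coefficients[OF assms], rule that)
  \<comment> \<open>Any coordinate axis serves for arranging the bumps.\<close>
  define i0 where "i0 = (undefined :: 'n)"
  obtain c where c: "0 < c" "\<And>a. (\<integral>\<^sup>+x. ennreal ((bump_sum i0 a x)\<^sup>2) \<partial>(lborel :: (real^'n) measure))
     = ennreal c * (\<Sum>j. ennreal ((a j)\<^sup>2))"
    by (rule bump_sum_norm, rule that)
  let ?a = "\<lambda>\<psi> k. l2_inner \<sigma> (fourier_real \<psi>) (e k)"
  define Q where "Q \<psi> = (\<lambda>x. (1 / sqrt c) * bump_sum i0 (?a \<psi>) x)" for \<psi>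
  have iter: "iter_partial is (Q \<psi>) = (\<lambda>x. (1 / sqrt c) * iter_partial is (bump_sum i0 (?a \<psi>)) x)" for "is" \<psi>
    unfolding Q_def by (rule iter_partial_bounded_linear[OF bounded_linear_mult_right smooth_bump_sum])
  have bound: "\<exists>C\<ge>0. \<exists>N. \<forall>\<psi>\<in>schwartz. \<forall>x. norm x ^ k * norm (iter_partial is (Q \<psi>) x) \<le> C * snorm N \<psi>" for k "is"
  proof -
    obtain C where C: "C \<ge> 0" "\<And>a A x. \<forall>j. (2 + real j) ^ k * \<bar>a j\<bar> \<le> A \<Longrightarrow>
       norm (x::real^'n) ^ k * norm (iter_partial is (bump_sum i0 a) x) \<le> C * A"
      using bump_sum_bound[of k "is" i0] by blast
    obtain D N where D: "D \<ge> 0" "\<And>\<psi> j. \<psi> \<in> schwartz \<Longrightarrow> (2 + real j) ^ k * \<bar>?a \<psi> j\<bar> \<le> D * snorm N \<psi>"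
      using decay[of k] by blast
    have "norm x ^ k * norm (iter_partial is (Q \<psi>) x) \<le> 1 / sqrt c * C * D * snorm N \<psi>" if "\<psi> \<in> schwartz" for \<psi> x
    proof -
      have "norm x ^ k * norm (iter_partial is (bump_sum i0 (?a \<psi>)) x) \<le> C * (D * snorm N \<psi>)"
        by (rule C(2)) (use D(2)[OF that] in blast)
      then have "1 / sqrt c * (norm x ^ k * norm (iter_partial is (bump_sum i0 (?a \<psi>)) x)) \<le> 1 / sqrt c * (C * (D * snorm N \<psi>))"
        using c(1) by (intro mult_left_mono) auto
      then show ?thesis
        using c(1) by (simp add: iter abs_mult mult_ac)
    qed
    moreover have "0 \<le> 1 / sqrt c * C * D" using c(1) C(1) D(1) by simp
    ultimately show ?thesis by blast
  qed
  show thesis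
  proof
    show Q: "Q \<psi> \<in> schwartz" if "\<psi> \<in> schwartz" for \<psi>
    proof (rule schwartzI)
      show "smooth (Q \<psi>)"
        unfolding Q_def by (rule smooth_bounded_linear[OF bounded_linear_mult_right smooth_bump_sum])
      show "\<exists>C. \<forall>x. norm x ^ k * norm (iter_partial is (Q \<psi>) x) \<le> C" for k "is"
        using bound[of k "is"] that by blast
    qed
    show "Q (\<lambda>x. a * \<phi> x + b * \<psi> x) = (\<lambda>x. a * Q \<phi> x + b * Q \<psi> x)"
      if "\<phi> \<in> schwartz" "\<psi> \<in> schwartz" for \<phi> \<psi> a b
    proof -
      have "fourier_real (\<lambda>x. a * \<phi> x + b * \<psi> x) = (\<lambda>u. a *\<^sub>R fourier_real \<phi> u + b *\<^sub>R fourier_real \<psi> u)"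
        using fourier_real_lincomb[OF integrable_schwartz[OF that(1)] integrable_schwartz[OF that(2)]]
        by (intro ext) (simp add: scaleR_conv_of_real)
      then have "?a (\<lambda>x. a * \<phi> x + b * \<psi> x) = (\<lambda>k. a * ?a \<phi> k + b * ?a \<psi> k)"
        using l2_inner_lincomb_left[OF ftL2[OF that(1)] ftL2[OF that(2)] e] by simp
      then show ?thesis
        unfolding Q_def by (simp add: bump_sum_lincomb distrib_left mult_ac)
    qed
    show "\<exists>C\<ge>0. \<exists>N. \<forall>\<psi>\<in>schwartz. schwartz_seminorm k is (Q \<psi>) \<le> C * snorm N \<psi>" for k "is"
      using bound[of k "is"] by (meson schwartz_seminorm_least)
    show "l2_norm lborel (Q \<psi>) = l2_norm \<sigma> (fourier_real \<psi>)" if \<psi>: "\<psi> \<in> schwartz" for \<psi>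
    proof -
      have [measurable]: "Q \<psi> \<in> borel_measurable borel"
        by (rule schwartz_measurable[OF Q[OF \<psi>]])
      have [measurable]: "bump_sum i0 (?a \<psi>) \<in> borel_measurable borel"
      proof -
        have "bump_sum i0 (?a \<psi>) = (\<lambda>x. sqrt c * Q \<psi> x)" using c(1) by (simp add: Q_def)
        then show ?thesis by simp
      qed
      have "(\<integral>\<^sup>+x. ennreal ((norm (Q \<psi> x))\<^sup>2) \<partial>lborel) = (\<integral>\<^sup>+x. ennreal (1 / c) * ennreal ((bump_sum i0 (?a \<psi>) x)\<^sup>2) \<partial>lborel)"
        using c(1) by (intro nn_integral_cong) (simp add: Q_def power_mult_distrib power_divide abs_mult flip: ennreal_mult)
      also have "\<dots> = ennreal (1 / c) * (ennreal c * (\<Sum>j. ennreal ((?a \<psi> j)\<^sup>2)))"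
        by (subst nn_integral_cmult) (simp_all add: c(2))
      also have "(\<Sum>j. ennreal ((?a \<psi> j)\<^sup>2)) = ennreal ((l2_norm \<sigma> (fourier_real \<psi>))\<^sup>2)"
        using parseval[OF \<psi>] by (subst suminf_ennreal2) (auto simp: sums_iff)
      also have "ennreal (1 / c) * (ennreal c * ennreal ((l2_norm \<sigma> (fourier_real \<psi>))\<^sup>2)) = ennreal ((l2_norm \<sigma> (fourier_real \<psi>))\<^sup>2)"
        using c(1) by (simp flip: ennreal_mult)
      finally have "(\<integral>x. (norm (Q \<psi> x))\<^sup>2 \<partial>lborel) = (l2_norm \<sigma> (fourier_real \<psi>))\<^sup>2"
        by (subst integral_eq_nn_integral) auto
      then show ?thesis
        unfolding l2_norm_def[of lborel] by (simp add: l2_norm_def integral_nonneg_AE)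
    qed
  qed
qed

section \<open>Topology and measurability on tempered distributions\<close>

lemma openin_schwartz_topologyI:
  fixes A :: "(real^'n \<Rightarrow> real) set"
  assumes "A \<subseteq> schwartz"
    and "\<And>h. h \<in> A \<Longrightarrow> \<exists>N \<delta>. 0 < \<delta> \<and> (\<forall>f\<in>schwartz. snorm N (\<lambda>x. f x - h x) < \<delta> \<longrightarrow> f \<in> A)"
  shows "openin schwartz_topology A"
proof (subst openin_subopen, intro ballI)
  fix h assume h: "h \<in> A"
  obtain N \<delta> where \<delta>: "0 < \<delta>" "\<And>f. f \<in> schwartz \<Longrightarrow> snorm N (\<lambda>x. f x - h x) < \<delta> \<Longrightarrow> f \<in> A"
    using assms(2)[OF h] by blast
  have hS: "h \<in> schwartz" using h assms(1) by blast
  let ?L = "{is :: 'n list. length is \<le> N}"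
  let ?I = "{..N} \<times> ?L"
  have fin: "finite ?I" by (intro finite_cartesian_product finite_short_lists) simp
  have ne: "?I \<noteq> {}" by (auto intro!: exI[of _ "[]"])
  have card: "0 < card ?I" using fin ne by (simp only: card_gt_0_iff) simp
  \<comment> \<open>If each of the seminorms in \<open>snorm N\<close> is less than \<open>\<epsilon>\<close>, then their sum is less than \<open>\<delta>\<close>.\<close>
  define \<epsilon> where "\<epsilon> = \<delta> / (real (card ?I))"
  have \<epsilon>: "0 < \<epsilon>" using \<delta>(1) card by (simp only: \<epsilon>_def divide_pos_pos of_nat_0_less_iff)
  let ?B = "\<lambda>(k, is). {g \<in> schwartz. schwartz_seminorm k is (\<lambda>x. g x - h x) < \<epsilon>}"
  have "openin schwartz_topology (\<Inter>i\<in>?I. ?B i)"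
  proof (rule openin_INT2[OF fin ne])
    fix i assume "i \<in> ?I"
    show "openin schwartz_topology (?B i)"
      unfolding schwartz_topology_def using hS \<epsilon>
      by (cases i) (auto intro!: topology_generated_by_Basis)
  qed
  moreover have "h \<in> (\<Inter>i\<in>?I. ?B i)"
  proof -
    have "schwartz_seminorm k is (\<lambda>x. h x - h x) < \<epsilon>" for k "is"
    proof -
      have "iter_partial is (\<lambda>x::real^'n. 0 :: real) = (\<lambda>x. 0)"
        by (induction "is") (auto simp: partial_deriv_def)
      then show ?thesis using \<epsilon> by (simp add: schwartz_seminorm_def)
    qed
    then show ?thesis using hS by auto
  qed
  moreover have "(\<Inter>i\<in>?I. ?B i) \<subseteq> A"
  proof
    fix f assume f: "f \<in> (\<Inter>i\<in>?I. ?B i)"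
    have fS: "f \<in> schwartz" using f ne by auto
    have "snorm N (\<lambda>x. f x - h x) = (\<Sum>i\<in>?I. case i of (k, is) \<Rightarrow> schwartz_seminorm k is (\<lambda>x. f x - h x))"
      unfolding snorm_def by (subst sum.cartesian_product) simp
    also have "\<dots> < (\<Sum>i\<in>?I. \<epsilon>)"
      using f by (intro sum_strict_mono fin ne) auto
    also have "\<dots> = \<delta>" using card by (simp only: sum_constant \<epsilon>_def) simp
    finally show "f \<in> A" by (rule \<delta>(2)[OF fS])
  qed
  ultimately show "\<exists>T. openin schwartz_topology T \<and> h \<in> T \<and> T \<subseteq> A" by blast
qed

lemma topspace_schwartz_topology: "topspace schwartz_topology = schwartz"
proof -
  have "f \<in> {g \<in> schwartz. schwartz_seminorm 0 [] (\<lambda>x. g x - f x) < 1}" if "f \<in> schwartz" for f :: "real^'n \<Rightarrow> 'b::real_normed_vector"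
    using that by (simp add: schwartz_seminorm_def)
  moreover have "{g \<in> schwartz. schwartz_seminorm 0 [] (\<lambda>x. g x - f x) < 1}
      \<in> {{g \<in> schwartz. schwartz_seminorm k is (\<lambda>x. g x - f x) < e} | f k is e. f \<in> schwartz \<and> 0 < e}"
    if "f \<in> schwartz" for f :: "real^'n \<Rightarrow> 'b::real_normed_vector"
    using that zero_less_one[where 'a = real] by blast
  ultimately have "f \<in> \<Union>{{g \<in> schwartz. schwartz_seminorm k is (\<lambda>x. g x - f x) < e} | f k is e. f \<in> schwartz \<and> 0 < e}"
    if "f \<in> schwartz" for f :: "real^'n \<Rightarrow> 'b::real_normed_vector"
    using that by (intro UnionI)
  then show ?thesis
    unfolding schwartz_topology_def topology_generated_by_topspace by auto
qed

lemma continuous_map_schwartz_linear: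
  fixes Q :: "(real^'n \<Rightarrow> real) \<Rightarrow> real^'n \<Rightarrow> real"
  assumes Q: "\<And>\<psi>. \<psi> \<in> schwartz \<Longrightarrow> Q \<psi> \<in> schwartz"
    and lin: "\<And>\<phi> \<psi> a b. \<phi> \<in> schwartz \<Longrightarrow> \<psi> \<in> schwartz \<Longrightarrow>
       Q (\<lambda>x. a * \<phi> x + b * \<psi> x) = (\<lambda>x. a * Q \<phi> x + b * Q \<psi> x)"
    and bound: "\<And>k is. \<exists>C\<ge>0. \<exists>N. \<forall>\<psi>\<in>schwartz. schwartz_seminorm k is (Q \<psi>) \<le> C * snorm N \<psi>"
  shows "continuous_map schwartz_topology schwartz_topology Q"
proof -
  have "openin schwartz_topology (Q -` U \<inter> schwartz)"
    if "U \<in> {{g \<in> schwartz. schwartz_seminorm k is (\<lambda>x. g x - f x) < e} | f k is e. f \<in> schwartz \<and> 0 < e}" for U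
  proof -
    obtain f k "is" e where U: "U = {g \<in> schwartz. schwartz_seminorm k is (\<lambda>x. g x - f x) < e}"
      and f: "f \<in> schwartz" using \<open>U \<in> _\<close> by blast
    obtain C N where C: "C \<ge> 0" "\<And>\<psi>. \<psi> \<in> schwartz \<Longrightarrow> schwartz_seminorm k is (Q \<psi>) \<le> C * snorm N \<psi>"
      using bound by blast
    show ?thesis
    proof (rule openin_schwartz_topologyI)
      fix h assume "h \<in> Q -` U \<inter> schwartz"
      then have h: "h \<in> schwartz" and he: "schwartz_seminorm k is (\<lambda>x. Q h x - f x) < e" by (auto simp: U)
      define \<delta> where "\<delta> = (e - schwartz_seminorm k is (\<lambda>x. Q h x - f x)) / (C + 1)"
      have \<delta>: "0 < \<delta>" using he C(1) by (simp add: \<delta>_def)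
      have "g \<in> Q -` U \<inter> schwartz" if g: "g \<in> schwartz" "snorm N (\<lambda>x. g x - h x) < \<delta>" for g
      proof -
        have d: "(\<lambda>x. g x - h x) \<in> schwartz" by (rule schwartz_diff[OF g(1) h])
        have Qd: "Q (\<lambda>x. g x - h x) = (\<lambda>x. Q g x - Q h x)"
          using lin[OF g(1) h, of 1 "-1"] by simp
        have "schwartz_seminorm k is (\<lambda>x. Q g x - f x)
            = schwartz_seminorm k is (\<lambda>x. (Q g x - Q h x) + (Q h x - f x))" by simp
        also have "\<dots> \<le> schwartz_seminorm k is (\<lambda>x. Q g x - Q h x) + schwartz_seminorm k is (\<lambda>x. Q h x - f x)"
          by (intro schwartz_seminorm_triangle schwartz_diff Q g h f)
        also have "schwartz_seminorm k is (\<lambda>x. Q g x - Q h x) \<le> C * snorm N (\<lambda>x. g x - h x)"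
          using C(2)[OF d] by (simp only: Qd)
        also have "\<dots> \<le> C * \<delta>" using g(2) C(1) by (intro mult_left_mono) auto
        also have "\<dots> < (C + 1) * \<delta>" using \<delta> by (simp add: distrib_right)
        also have "\<dots> = e - schwartz_seminorm k is (\<lambda>x. Q h x - f x)" using C(1) by (simp add: \<delta>_def)
        finally show ?thesis using Q[OF g(1)] g(1) by (simp add: U)
      qed
      then show "\<exists>N \<delta>. 0 < \<delta> \<and> (\<forall>g\<in>schwartz. snorm N (\<lambda>x. g x - h x) < \<delta> \<longrightarrow> g \<in> Q -` U \<inter> schwartz)"
        using \<delta> by blast
    qed auto
  qed
  moreover have "Q ` schwartz \<subseteq> \<Union>{{g \<in> schwartz. schwartz_seminorm k is (\<lambda>x. g x - f x) < e} | f k is e. f \<in> schwartz \<and> 0 < e}"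
  proof -
    have "topspace schwartz_topology = (schwartz :: (real^'n \<Rightarrow> real) set)"
      by (rule topspace_schwartz_topology)
    then show ?thesis
      using Q unfolding schwartz_topology_def topology_generated_by_topspace
      by (intro image_subsetI) simp
  qed
  ultimately show ?thesis
    by (subst (2) schwartz_topology_def)
      (simp only: continuous_on_generated_topo_iff topspace_schwartz_topology, simp)
qed

lemma tempered_lincomb:
  "\<omega> \<in> tempered \<Longrightarrow> \<phi> \<in> schwartz \<Longrightarrow> \<psi> \<in> schwartz \<Longrightarrow>
    \<omega> (\<lambda>x. a * \<phi> x + b * \<psi> x) = a * \<omega> \<phi> + b * \<omega> \<psi>"
  by (simp add: tempered_def)

lemma tempered_zero: "\<omega> \<in> tempered \<Longrightarrow> \<omega> (\<lambda>x. 0) = 0"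
  using tempered_lincomb[OF _ schwartz_zero schwartz_zero, of \<omega> 0 0] by simp

lemma tempered_sum:
  assumes \<omega>: "\<omega> \<in> tempered" and I: "finite I" "\<And>i. i \<in> I \<Longrightarrow> f i \<in> schwartz"
  shows "\<omega> (\<lambda>x. \<Sum>i\<in>I. c i * f i x) = (\<Sum>i\<in>I. c i * \<omega> (f i))"
  using I
proof (induction I rule: finite_induct)
  case (insert i I)
  then show ?case
    using tempered_lincomb[OF \<omega>, of "f i" "\<lambda>x. \<Sum>i\<in>I. c i * f i x" "c i" 1] schwartz_sum[of I f c] by simp
qed (simp add: tempered_zero[OF \<omega>])

lemma topspace_tempered_topology: "topspace tempered_topology = tempered"
  by (auto simp: tempered_topology_def tempered_def PiE_def)

lemma space_tempered_borel: "space tempered_borel = tempered"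
  by (simp add: tempered_borel_def space_measure_of_conv)

lemma openin_tempered_sets: "openin tempered_topology U \<Longrightarrow> U \<in> sets tempered_borel"
  using openin_subset[of tempered_topology]
  by (auto simp: tempered_borel_def topspace_tempered_topology intro!: sigma_sets.Basic)

text \<open>
  The Borel sets are generated by all weak-* open sets, whereas measurability of the evaluations only
  speaks of cylinder sets. So continuity is the starting point here.
\<close>

lemma continuous_map_tempered_measurable:
  assumes "continuous_map tempered_topology tempered_topology F"
  shows "F \<in> measurable tempered_borel tempered_borel"
proof -
  have F: "F \<in> tempered \<rightarrow> tempered"
    using continuous_map_funspace[OF assms] by (simp add: topspace_tempered_topology)
  have "F -` U \<inter> tempered \<in> sets tempered_borel" if "openin tempered_topology U" for U
    using openin_continuous_map_preimage[OF assms that]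
    by (intro openin_tempered_sets) (simp add: topspace_tempered_topology vimage_def Int_def conj_commute)
  then have "F \<in> measurable tempered_borel (sigma tempered {U. openin tempered_topology U})"
    using F by (intro measurable_measure_of)
      (auto simp: space_tempered_borel topspace_tempered_topology dest!: openin_subset)
  then show ?thesis by (simp only: tempered_borel_def[symmetric])
qed

lemma continuous_map_tempered_eval:
  "\<phi> \<in> schwartz \<Longrightarrow> continuous_map tempered_topology euclideanreal (\<lambda>\<omega>. \<omega> \<phi>)"
  unfolding tempered_topology_def
  by (intro continuous_map_from_subtopology continuous_map_product_projection)

lemma tempered_eval_measurable:
  assumes "\<phi> \<in> schwartz"
  shows "(\<lambda>\<omega>. \<omega> \<phi>) \<in> borel_measurable tempered_borel"
proof (rule borel_measurableI)
  fix S :: "real set" assume "open S"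
  then show "(\<lambda>\<omega>. \<omega> \<phi>) -` S \<inter> space tempered_borel \<in> sets tempered_borel"
    using openin_continuous_map_preimage[OF continuous_map_tempered_eval[OF assms], of S]
    by (intro openin_tempered_sets)
      (simp add: space_tempered_borel topspace_tempered_topology vimage_def Int_def conj_commute)
qed

text \<open>
  The transpose of a continuous linear map is weak-* continuous, because its evaluation at \<open>\<psi>\<close> is the
  evaluation at \<open>Q \<psi>\<close>.
\<close>

lemma dual_map_measurable:
  fixes Q :: "(real^'n \<Rightarrow> real) \<Rightarrow> real^'n \<Rightarrow> real"
  assumes Q: "\<And>\<psi>. \<psi> \<in> schwartz \<Longrightarrow> Q \<psi> \<in> schwartz"
    and lin: "\<And>\<phi> \<psi> a b. \<phi> \<in> schwartz \<Longrightarrow> \<psi> \<in> schwartz \<Longrightarrow>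
       Q (\<lambda>x. a * \<phi> x + b * \<psi> x) = (\<lambda>x. a * Q \<phi> x + b * Q \<psi> x)"
    and cont: "continuous_map schwartz_topology schwartz_topology Q"
  shows "(\<lambda>\<omega>. restrict (\<lambda>\<psi>. \<omega> (Q \<psi>)) schwartz) \<in> measurable tempered_borel tempered_borel"
proof (rule continuous_map_tempered_measurable)
  let ?F = "\<lambda>\<omega>. restrict (\<lambda>\<psi>. \<omega> (Q \<psi>)) schwartz"
  have F: "?F \<omega> \<in> tempered" if \<omega>: "\<omega> \<in> tempered" for \<omega>
    unfolding tempered_def
  proof (intro CollectI conjI ballI allI)
    show "?F \<omega> (\<lambda>x. a * \<phi> x + b * \<psi> x) = a * ?F \<omega> \<phi> + b * ?F \<omega> \<psi>"
      if "\<phi> \<in> schwartz" "\<psi> \<in> schwartz" for \<phi> \<psi> a b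
      using that schwartz_lincomb[OF that, of a b] lin[OF that, of a b] tempered_lincomb[OF \<omega> Q Q] by simp
    have "continuous_map schwartz_topology euclideanreal (\<omega> \<circ> Q)"
      using cont \<omega> by (intro continuous_map_compose[OF cont]) (simp add: tempered_def)
    then show "continuous_map schwartz_topology euclideanreal (?F \<omega>)"
      by (rule continuous_map_eq) (simp add: topspace_schwartz_topology)
  qed auto
  show "continuous_map tempered_topology tempered_topology ?F"
  proof (subst (2) tempered_topology_def, unfold continuous_map_in_subtopology continuous_map_componentwise, intro conjI ballI)
    fix \<psi> :: "real^'n \<Rightarrow> real" assume "\<psi> \<in> schwartz"
    then show "continuous_map tempered_topology euclideanreal (\<lambda>\<omega>. ?F \<omega> \<psi>)"
      using continuous_map_tempered_eval[OF Q] by simp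
  qed (use F in \<open>auto simp: topspace_tempered_topology\<close>)
qed

section \<open>Gaussian variables on the white noise space\<close>

lemma white_noise_space:
  assumes "white_noise_measure W"
  shows "space W = tempered"
proof -
  have "sets W = sets tempered_borel" using assms by (simp add: white_noise_measure_def)
  from sets_eq_imp_space_eq[OF this] show ?thesis by (simp add: space_tempered_borel)
qed

lemma white_noise_eval_measurable:
  assumes "white_noise_measure W" "h \<in> schwartz"
  shows "(\<lambda>\<omega>. \<omega> h) \<in> borel_measurable W"
proof -
  have "sets W = sets tempered_borel" using assms by (simp add: white_noise_measure_def)
  then show ?thesis
    using tempered_eval_measurable[OF assms(2)] by (simp cong: measurable_cong_sets)
qed

lemma white_noise_char:
  fixes h :: "real^'n \<Rightarrow> real"
  assumes W: "white_noise_measure W" and h: "h \<in> schwartz"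
  shows "char (distr W borel (\<lambda>\<omega>. \<omega> h)) t = complex_of_real (exp (- (t * l2_norm lborel h)\<^sup>2 / 2))"
proof -
  note [measurable] = white_noise_eval_measurable[OF W h]
  have th: "(\<lambda>x. t * h x) \<in> schwartz"
    using schwartz_lincomb[OF h h, of t 0] by simp
  have "char (distr W borel (\<lambda>\<omega>. \<omega> h)) t = (\<integral>\<omega>. exp (\<i> * complex_of_real (t * \<omega> h)) \<partial>W)"
    unfolding char_def by (subst integral_distr) auto
  also have "\<dots> = (\<integral>\<omega>. exp (\<i> * complex_of_real (\<omega> (\<lambda>x. t * h x))) \<partial>W)"
    using tempered_lincomb[OF _ h h, of _ t 0]
    by (intro Bochner_Integration.integral_cong) (simp_all add: white_noise_space[OF W])
  also have "\<dots> = complex_of_real (exp (- (l2_norm lborel (\<lambda>x. t * h x))\<^sup>2 / 2))"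
    using W th by (simp add: white_noise_measure_def)
  also have "(l2_norm lborel (\<lambda>x. t * h x))\<^sup>2 = (t * l2_norm lborel h)\<^sup>2"
    unfolding l2_norm_def
    by (simp add: power_mult_distrib integral_nonneg_AE)
  finally show ?thesis .
qed

text \<open>
  Divided by the norm of \<open>h\<close>, the variable has the characteristic function of the standard normal
  law, hence is standard normal by Levy's uniqueness theorem. If the norm is zero the same theorem
  shows that the variable is almost surely zero.
\<close>

lemma white_noise_gaussian:
  fixes h :: "real^'n \<Rightarrow> real"
  assumes W: "white_noise_measure W" and h: "h \<in> schwartz"
  shows "gaussian_rv W (\<lambda>\<omega>. \<omega> h)"
    and "integrable W (\<lambda>\<omega>. (\<omega> h)\<^sup>2)"
    and "(\<integral>\<omega>. (\<omega> h)\<^sup>2 \<partial>W) = (l2_norm lborel h)\<^sup>2"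
proof -
  interpret W: prob_space W using W by (simp add: white_noise_measure_def)
  let ?s = "l2_norm lborel h" and ?Y = "\<lambda>\<omega> :: (real^'n \<Rightarrow> real) \<Rightarrow> real. \<omega> h"
  have Y[measurable]: "?Y \<in> borel_measurable W" by (rule white_noise_eval_measurable[OF W h])
  have s: "0 \<le> ?s" unfolding l2_norm_def by (simp add: integral_nonneg_AE)
  have rd: "real_distribution (distr W borel (\<lambda>\<omega>. ?Y \<omega> / c))" for c
    by (rule W.real_distribution_distr) simp
  have "gaussian_rv W ?Y \<and> integrable W (\<lambda>\<omega>. (?Y \<omega>)\<^sup>2) \<and> (\<integral>\<omega>. (?Y \<omega>)\<^sup>2 \<partial>W) = ?s\<^sup>2"
  proof (cases "?s = 0")
    case True
    have "distr W borel ?Y = return borel 0"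
    proof (rule Levy_uniqueness)
      show "real_distribution (distr W borel ?Y)" using rd[of 1] by simp
      show "real_distribution (return borel 0)"
        by (simp add: real_distribution_def real_distribution_axioms_def prob_space_return)
      show "char (distr W borel ?Y) = char (return borel 0)"
      proof
        fix t
        have "char (return borel 0) t = 1" by (simp add: char_def integral_return)
        then show "char (distr W borel ?Y) t = char (return borel 0) t"
          using white_noise_char[OF W h, of t] True by simp
      qed
    qed
    moreover have "AE y in return borel (0::real). y = 0"
      by (subst AE_return) auto
    ultimately have "AE y in distr W borel ?Y. y = 0" by (simp only:)
    then have AE: "AE \<omega> in W. ?Y \<omega> = 0"
      by (subst (asm) AE_distr_iff) auto
    have AE2: "AE \<omega> in W. (?Y \<omega>)\<^sup>2 = 0" using AE by eventually_elim simp
    have "integrable W (\<lambda>\<omega>. (?Y \<omega>)\<^sup>2) \<longleftrightarrow> integrable W (\<lambda>\<omega>. 0 :: real)"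
      by (rule integrable_cong_AE[OF _ _ AE2]) measurable
    moreover have "(\<integral>\<omega>. (?Y \<omega>)\<^sup>2 \<partial>W) = (\<integral>\<omega>. 0 \<partial>W)"
      by (rule integral_cong_AE[OF _ _ AE2]) measurable
    ultimately have "integrable W (\<lambda>\<omega>. (?Y \<omega>)\<^sup>2)" "(\<integral>\<omega>. (?Y \<omega>)\<^sup>2 \<partial>W) = 0"
      by simp_all
    then show ?thesis
      using AE Y True unfolding gaussian_rv_def by auto
  next
    case False
    with s have s: "0 < ?s" by simp
    have eq: "distr W borel (\<lambda>\<omega>. ?Y \<omega> / ?s) = std_normal_distribution"
    proof (rule Levy_uniqueness[OF rd real_dist_normal_dist], rule ext)
      fix t
      have "char (distr W borel (\<lambda>\<omega>. ?Y \<omega> / ?s)) t = char (distr W borel ?Y) (t / ?s)"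
        unfolding char_def by (simp add: integral_distr)
      also have "\<dots> = char std_normal_distribution t"
        using s by (simp add: white_noise_char[OF W h] char_std_normal_distribution)
      finally show "char (distr W borel (\<lambda>\<omega>. ?Y \<omega> / ?s)) t = char std_normal_distribution t" .
    qed
    have "distributed W lborel (\<lambda>\<omega>. (?Y \<omega> - 0) / ?s) std_normal_density"
      unfolding distributed_def using eq by (simp cong: distr_cong)
    then have "distributed W lborel ?Y (normal_density 0 ?s)"
      using W.normal_standard_normal_convert[OF s, of ?Y 0] by simp
    then have "gaussian_rv W ?Y" using s Y unfolding gaussian_rv_def by blast
    moreover have std: "integrable W (\<lambda>\<omega>. (?Y \<omega> / ?s)\<^sup>2)" "(\<integral>\<omega>. (?Y \<omega> / ?s)\<^sup>2 \<partial>W) = 1"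
    proof -
      have "integrable (distr W borel (\<lambda>\<omega>. ?Y \<omega> / ?s)) (\<lambda>x. x\<^sup>2)"
        "(\<integral>x. x\<^sup>2 \<partial>distr W borel (\<lambda>\<omega>. ?Y \<omega> / ?s)) = 1"
        unfolding eq using std_normal_distribution_even_moments[of 1] by simp_all
      then show "integrable W (\<lambda>\<omega>. (?Y \<omega> / ?s)\<^sup>2)" "(\<integral>\<omega>. (?Y \<omega> / ?s)\<^sup>2 \<partial>W) = 1"
        by (simp_all add: integrable_distr_eq integral_distr)
    qed
    moreover have "integrable W (\<lambda>\<omega>. (?Y \<omega>)\<^sup>2)"
      using integrable_mult_right[OF std(1), of "?s\<^sup>2"] s by (simp add: power_divide)
    ultimately show ?thesis
      using s by (simp add: power_divide divide_eq_eq)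
  qed
  then show "gaussian_rv W (\<lambda>\<omega>. \<omega> h)" "integrable W (\<lambda>\<omega>. (\<omega> h)\<^sup>2)"
    "(\<integral>\<omega>. (\<omega> h)\<^sup>2 \<partial>W) = (l2_norm lborel h)\<^sup>2" by auto
qed

text \<open>
  The evaluation at \<open>f\<close> meets the condition in the definition of \<open>tilde_real\<close>, with a constant sequence.
  Conversely, evaluation is isometric from \<open>L\<^sub>2(dx)\<close> to \<open>L\<^sub>2(W)\<close>, so every function that meets this
  condition is almost surely equal to the evaluation at \<open>f\<close>.
\<close>

lemma tilde_real_schwartz:
  fixes f :: "real^'n \<Rightarrow> real"
  assumes W: "white_noise_measure W" and f: "f \<in> schwartz"
  shows "AE \<omega> in W. tilde_real W f \<omega> = \<omega> f"
proof -
  let ?P = "\<lambda>F. F \<in> L2 W \<and>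
     (\<exists>\<psi>::nat \<Rightarrow> real^'n \<Rightarrow> real. (\<forall>k. \<psi> k \<in> schwartz) \<and>
        (\<lambda>k. l2_norm lborel (\<lambda>x. \<psi> k x - f x)) \<longlonglongrightarrow> 0 \<and>
        (\<lambda>k. l2_norm W (\<lambda>\<omega>. \<omega> (\<psi> k) - F \<omega>)) \<longlonglongrightarrow> 0)"
  note [measurable] = white_noise_eval_measurable[OF W f]
  have "?P (\<lambda>\<omega>. \<omega> f)"
    using f white_noise_gaussian(2)[OF W f] white_noise_eval_measurable[OF W f]
    by (auto simp: L2_def l2_norm_def intro!: exI[of _ "\<lambda>_. f"])
  then have "?P (tilde_real W f)"
    unfolding tilde_real_def by (rule someI[where P = ?P])
  then obtain \<psi> where F: "tilde_real W f \<in> L2 W" and \<psi>: "\<And>k. \<psi> k \<in> schwartz"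
    and lim: "(\<lambda>k. l2_norm lborel (\<lambda>x. \<psi> k x - f x)) \<longlonglongrightarrow> 0"
      "(\<lambda>k. l2_norm W (\<lambda>\<omega>. \<omega> (\<psi> k) - tilde_real W f \<omega>)) \<longlonglongrightarrow> 0"
    by blast
  let ?F = "tilde_real W f"
  have [measurable]: "?F \<in> borel_measurable W" and intF: "integrable W (\<lambda>\<omega>. (?F \<omega>)\<^sup>2)"
    using F by (auto simp: L2_def)
  have sq_diff: "integrable W (\<lambda>\<omega>. (a \<omega> - b \<omega>)\<^sup>2)"
    if [measurable]: "a \<in> borel_measurable W" "b \<in> borel_measurable W"
      and "integrable W (\<lambda>\<omega>. (a \<omega>)\<^sup>2)" "integrable W (\<lambda>\<omega>. (b \<omega>)\<^sup>2)" for a b :: "_ \<Rightarrow> real"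
  proof (rule Bochner_Integration.integrable_bound)
    show "integrable W (\<lambda>\<omega>. 2 * (a \<omega>)\<^sup>2 + 2 * (b \<omega>)\<^sup>2)" using that by simp
    have "(a \<omega> - b \<omega>)\<^sup>2 \<le> 2 * (a \<omega>)\<^sup>2 + 2 * (b \<omega>)\<^sup>2" for \<omega>
      using zero_le_power2[of "a \<omega> + b \<omega>"] by (simp add: power2_eq_square algebra_simps)
    then show "AE \<omega> in W. norm ((a \<omega> - b \<omega>)\<^sup>2) \<le> norm (2 * (a \<omega>)\<^sup>2 + 2 * (b \<omega>)\<^sup>2)"
      by (intro AE_I2) simp
  qed measurable
  let ?d = "\<lambda>k. 2 * (l2_norm W (\<lambda>\<omega>. \<omega> (\<psi> k) - ?F \<omega>))\<^sup>2 + 2 * (l2_norm lborel (\<lambda>x. \<psi> k x - f x))\<^sup>2"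
  have intd: "integrable W (\<lambda>\<omega>. (?F \<omega> - \<omega> f)\<^sup>2)"
    by (intro sq_diff intF white_noise_gaussian(2)[OF W f]) measurable
  have bound: "(\<integral>\<omega>. (?F \<omega> - \<omega> f)\<^sup>2 \<partial>W) \<le> ?d k" for k
  proof -
    note [measurable] = white_noise_eval_measurable[OF W \<psi>[of k]]
    have i1: "integrable W (\<lambda>\<omega>. (\<omega> (\<psi> k) - ?F \<omega>)\<^sup>2)"
      by (intro sq_diff intF white_noise_gaussian(2)[OF W \<psi>]) measurable
    have i2: "integrable W (\<lambda>\<omega>. (\<omega> (\<psi> k) - \<omega> f)\<^sup>2)"
      by (intro sq_diff white_noise_gaussian(2)[OF W \<psi>] white_noise_gaussian(2)[OF W f]) measurable
    have "(\<integral>\<omega>. (?F \<omega> - \<omega> f)\<^sup>2 \<partial>W) \<le> (\<integral>\<omega>. 2 * (\<omega> (\<psi> k) - ?F \<omega>)\<^sup>2 + 2 * (\<omega> (\<psi> k) - \<omega> f)\<^sup>2 \<partial>W)"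
    proof (intro integral_mono intd Bochner_Integration.integrable_add integrable_mult_right i1 i2)
      fix \<omega>
      show "(?F \<omega> - \<omega> f)\<^sup>2 \<le> 2 * (\<omega> (\<psi> k) - ?F \<omega>)\<^sup>2 + 2 * (\<omega> (\<psi> k) - \<omega> f)\<^sup>2"
        using zero_le_power2[of "(\<omega> (\<psi> k) - ?F \<omega>) + (\<omega> (\<psi> k) - \<omega> f)"] by (simp add: power2_eq_square algebra_simps)
    qed
    also have "\<dots> = 2 * (\<integral>\<omega>. (\<omega> (\<psi> k) - ?F \<omega>)\<^sup>2 \<partial>W) + 2 * (\<integral>\<omega>. (\<omega> (\<psi> k) - \<omega> f)\<^sup>2 \<partial>W)"
      using i1 i2 by simp
    also have "(\<integral>\<omega>. (\<omega> (\<psi> k) - \<omega> f)\<^sup>2 \<partial>W) = (\<integral>\<omega>. (\<omega> (\<lambda>x. \<psi> k x - f x))\<^sup>2 \<partial>W)"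
      using tempered_lincomb[OF _ \<psi>[of k] f, of _ 1 "-1"]
      by (intro Bochner_Integration.integral_cong) (simp_all add: white_noise_space[OF W])
    also have "\<dots> = (l2_norm lborel (\<lambda>x. \<psi> k x - f x))\<^sup>2"
      by (rule white_noise_gaussian(3)[OF W schwartz_diff[OF \<psi> f]])
    also have "(\<integral>\<omega>. (\<omega> (\<psi> k) - ?F \<omega>)\<^sup>2 \<partial>W) = (l2_norm W (\<lambda>\<omega>. \<omega> (\<psi> k) - ?F \<omega>))\<^sup>2"
      by (simp add: l2_norm_def integral_nonneg_AE)
    finally show ?thesis .
  qed
  have "?d \<longlonglongrightarrow> 2 * 0\<^sup>2 + 2 * 0\<^sup>2"
    by (intro tendsto_intros lim)
  then have "(\<integral>\<omega>. (?F \<omega> - \<omega> f)\<^sup>2 \<partial>W) \<le> 0"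
    using bound by (intro LIMSEQ_le_const) auto
  moreover have "0 \<le> (\<integral>\<omega>. (?F \<omega> - \<omega> f)\<^sup>2 \<partial>W)"
    by (intro integral_nonneg_AE) auto
  ultimately have "(\<integral>\<omega>. (?F \<omega> - \<omega> f)\<^sup>2 \<partial>W) = 0" by simp
  then have "AE \<omega> in W. (?F \<omega> - \<omega> f)\<^sup>2 = 0"
    using integral_nonneg_eq_0_iff_AE[OF intd] by auto
  then show ?thesis by eventually_elim simp
qed

section \<open>Complex test functions and the process\<close>

lemma gaussian_rv_cong:
  assumes "\<And>y. y \<in> space M \<Longrightarrow> Y y = Z y" "gaussian_rv M Z"
  shows "gaussian_rv M Y"
proof -
  have "Y \<in> borel_measurable M \<longleftrightarrow> Z \<in> borel_measurable M"
    using assms(1) by (rule measurable_cong)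
  moreover have "(AE y in M. Y y = m) \<longleftrightarrow> (AE y in M. Z y = m)" for m
    using assms(1) by (intro AE_cong) simp
  moreover have "distr M lborel Y = distr M lborel Z"
    using assms(1) by (intro distr_cong) auto
  moreover have "Y \<in> measurable M lborel \<longleftrightarrow> Z \<in> measurable M lborel"
    using assms(1) by (rule measurable_cong)
  ultimately show ?thesis
    using assms(2) unfolding gaussian_rv_def distributed_def by (simp only:)
qed

definition complexify :: "((real^'n \<Rightarrow> real) \<Rightarrow> real) \<Rightarrow> (real^'n \<Rightarrow> complex) \<Rightarrow> complex" where
  "complexify L \<psi> = Complex (L (\<lambda>x. Re (\<psi> x))) (L (\<lambda>x. Im (\<psi> x)))"

lemma schwartz_Re_Im:
  assumes "\<psi> \<in> schwartz"
  shows "(\<lambda>x. Re (\<psi> x)) \<in> schwartz" "(\<lambda>x. Im (\<psi> x)) \<in> schwartz"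
  using assms by (simp_all add: schwartz_bounded_linear bounded_linear_Re bounded_linear_Im)

text \<open>
  The real and imaginary parts of a complex combination of \<open>\<phi>\<close> and \<open>\<psi>\<close> are real combinations of the four
  real and imaginary parts of \<open>\<phi>\<close> and \<open>\<psi>\<close>.
\<close>

lemma complexify_linear:
  fixes L :: "(real^'n \<Rightarrow> real) \<Rightarrow> real"
  assumes L: "\<And>\<phi> \<psi> a b. \<phi> \<in> schwartz \<Longrightarrow> \<psi> \<in> schwartz \<Longrightarrow>
       L (\<lambda>x. a * \<phi> x + b * \<psi> x) = a * L \<phi> + b * L \<psi>"
    and \<phi>: "\<phi> \<in> schwartz" and \<psi>: "\<psi> \<in> schwartz"
  shows "complexify L (\<lambda>x. a * \<phi> x + b * \<psi> x) = a * complexify L \<phi> + b * complexify L \<psi>"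
proof -
  note S = schwartz_Re_Im[OF \<phi>] schwartz_Re_Im[OF \<psi>]
  have comb: "L (\<lambda>x. 1 * (c1 * Re (\<phi> x) + c2 * Im (\<phi> x)) + 1 * (c3 * Re (\<psi> x) + c4 * Im (\<psi> x)))
      = c1 * L (\<lambda>x. Re (\<phi> x)) + c2 * L (\<lambda>x. Im (\<phi> x)) + (c3 * L (\<lambda>x. Re (\<psi> x)) + c4 * L (\<lambda>x. Im (\<psi> x)))"
    for c1 c2 c3 c4
    by (subst L[OF schwartz_lincomb[OF S(1,2)] schwartz_lincomb[OF S(3,4)]])
      (simp add: L[OF S(1,2)] L[OF S(3,4)])
  have "L (\<lambda>x. Re (a * \<phi> x + b * \<psi> x))
      = Re a * L (\<lambda>x. Re (\<phi> x)) - Im a * L (\<lambda>x. Im (\<phi> x)) + (Re b * L (\<lambda>x. Re (\<psi> x)) - Im b * L (\<lambda>x. Im (\<psi> x)))"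
    using comb[of "Re a" "- Im a" "Re b" "- Im b"] by simp
  moreover have "L (\<lambda>x. Im (a * \<phi> x + b * \<psi> x))
      = Im a * L (\<lambda>x. Re (\<phi> x)) + Re a * L (\<lambda>x. Im (\<phi> x)) + (Im b * L (\<lambda>x. Re (\<psi> x)) + Re b * L (\<lambda>x. Im (\<psi> x)))"
    using comb[of "Im a" "Re a" "Im b" "Re b"] by (simp add: add.commute)
  ultimately show ?thesis
    by (simp add: complexify_def complex_eq_iff)
qed

lemma complexify_L2:
  fixes L :: "(real^'n \<Rightarrow> real) \<Rightarrow> 'a \<Rightarrow> real"
  assumes "L (\<lambda>x. Re (\<psi> x)) \<in> L2 M" "L (\<lambda>x. Im (\<psi> x)) \<in> L2 M"
  shows "(\<lambda>y. complexify (\<lambda>\<phi>. L \<phi> y) \<psi>) \<in> L2 M"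
proof -
  have [measurable]: "L (\<lambda>x. Re (\<psi> x)) \<in> borel_measurable M" "L (\<lambda>x. Im (\<psi> x)) \<in> borel_measurable M"
    using assms by (auto simp: L2_def)
  have "(\<lambda>y. complexify (\<lambda>\<phi>. L \<phi> y) \<psi>) \<in> borel_measurable M"
    unfolding complexify_def Complex_eq by measurable
  moreover have "integrable M (\<lambda>y. (norm (complexify (\<lambda>\<phi>. L \<phi> y) \<psi>))\<^sup>2)"
    using assms by (simp add: L2_def complexify_def cmod_power2)
  ultimately show ?thesis by (simp add: L2_def)
qed

lemma schwartz_L2:
  fixes h :: "real^'n \<Rightarrow> real"
  assumes h: "h \<in> schwartz"
  shows "h \<in> L2 lborel"
proof -
  have [measurable]: "h \<in> borel_measurable borel" by (rule schwartz_measurable[OF h])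
  have int: "integrable lborel (\<lambda>x. snorm 0 h * (2 * \<bar>h x\<bar>))"
    using integrable_schwartz[OF h] by simp
  have bound: "norm ((norm (h x))\<^sup>2) \<le> norm (snorm 0 h * (2 * \<bar>h x\<bar>))" for x
  proof -
    have "\<bar>h x\<bar> \<le> 2 * snorm 0 h"
      using schwartz_decay[OF h, of 0 0 "[]" x] by simp
    then have "\<bar>h x\<bar> * \<bar>h x\<bar> \<le> 2 * snorm 0 h * \<bar>h x\<bar>"
      by (rule mult_right_mono) simp
    then show ?thesis using snorm_nonneg[OF h, of 0] by (simp add: abs_mult power2_eq_square)
  qed
  have "integrable lborel (\<lambda>x. (norm (h x))\<^sup>2)"
    by (rule Bochner_Integration.integrable_bound[OF int _ AE_I2[OF bound]]) measurable
  then show ?thesis using schwartz_measurable[OF h] by (simp only: L2_def) simp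
qed

theorem theorem5p2:
  fixes \<sigma> :: "(real^'n) measure"
    and W :: "((real^'n \<Rightarrow> real) \<Rightarrow> real) measure"
  assumes "\<sigma> \<in> spectral_measures"
    and "white_noise_measure W"
  shows "\<exists>(\<mu> :: ((real^'n \<Rightarrow> real) \<Rightarrow> real) measure)
          (Q :: (real^'n \<Rightarrow> complex) \<Rightarrow> real^'n \<Rightarrow> complex)
          (X :: (real^'n \<Rightarrow> complex) \<Rightarrow> ((real^'n \<Rightarrow> real) \<Rightarrow> real) \<Rightarrow> complex).
     prob_space \<mu> \<and> sets \<mu> = sets tempered_borel \<and>
     linear_into_L2 lborel Q \<and>
     generalized_gaussian_process W X \<and>
     (\<forall>\<psi>\<in>schwartz. AE \<omega> in W. X \<psi> \<omega> = tilde W (Q \<psi>) \<omega>) \<and>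
     (\<forall>\<psi>\<in>(schwartz :: (real^'n \<Rightarrow> real) set).
        (\<integral>\<omega>. exp (\<i> * X (\<lambda>x. complex_of_real (\<psi> x)) \<omega>) \<partial>W) =
          (\<integral>\<omega>. exp (\<i> * complex_of_real (\<omega> \<psi>)) \<partial>\<mu>) \<and>
        (\<integral>\<omega>. exp (\<i> * complex_of_real (\<omega> \<psi>)) \<partial>\<mu>) =
          complex_of_real
            (exp (- (l2_norm \<sigma> (fourier (\<lambda>x. complex_of_real (\<psi> x))))\<^sup>2 / 2)))"
proof -
  note W = assms(2)
  interpret W: prob_space W using W by (simp add: white_noise_measure_def)
  have setsW: "sets W = sets tempered_borel" using W by (simp add: white_noise_measure_def)
  note spaceW = white_noise_space[OF W]
  obtain Q :: "(real^'n \<Rightarrow> real) \<Rightarrow> real^'n \<Rightarrow> real" where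
    Q: "\<And>\<psi>. \<psi> \<in> schwartz \<Longrightarrow> Q \<psi> \<in> schwartz"
    and lin: "\<And>\<phi> \<psi> a b. \<phi> \<in> schwartz \<Longrightarrow> \<psi> \<in> schwartz \<Longrightarrow>
       Q (\<lambda>x. a * \<phi> x + b * \<psi> x) = (\<lambda>x. a * Q \<phi> x + b * Q \<psi> x)"
    and bound: "\<And>k is. \<exists>C\<ge>0. \<exists>N. \<forall>\<psi>\<in>schwartz. schwartz_seminorm k is (Q \<psi>) \<le> C * snorm N \<psi>"
    and norm: "\<And>\<psi>. \<psi> \<in> schwartz \<Longrightarrow> l2_norm lborel (Q \<psi>) = l2_norm \<sigma> (fourier_real \<psi>)"
    by (rule spectral_factor[OF assms(1)], rule that)
  \<comment> \<open>The transpose of \<open>Q\<close>; its image of white noise is the measure \<open>\<mu>\<close>.\<close>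
  define D where "D = (\<lambda>\<omega> :: (real^'n \<Rightarrow> real) \<Rightarrow> real. restrict (\<lambda>\<psi>. \<omega> (Q \<psi>)) schwartz)"
  have D: "D \<in> measurable W tempered_borel"
  proof -
    have "D \<in> measurable tempered_borel tempered_borel"
      unfolding D_def using Q lin continuous_map_schwartz_linear[of Q, OF Q lin bound]
      by (rule dual_map_measurable[of Q])
    then show ?thesis by (simp only: measurable_cong_sets[OF setsW refl])
  qed
  let ?\<mu> = "distr W tempered_borel D"
  let ?Q = "\<lambda>\<psi> x. complexify (\<lambda>\<phi>. Q \<phi> x) \<psi>"
  let ?X = "\<lambda>\<psi> \<omega>. complexify (\<lambda>\<phi>. \<omega> (Q \<phi>)) \<psi>"
  have Xlin: "\<omega> (Q (\<lambda>x. a * \<phi> x + b * \<psi> x)) = a * \<omega> (Q \<phi>) + b * \<omega> (Q \<psi>)"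
    if "\<omega> \<in> space W" "\<phi> \<in> schwartz" "\<psi> \<in> schwartz" for \<omega> \<phi> \<psi> and a b :: real
    unfolding lin[OF that(2,3)]
    by (rule tempered_lincomb) (use that Q in \<open>simp_all add: spaceW\<close>)
  have "prob_space ?\<mu>" by (rule W.prob_space_distr[OF D])
  moreover have "sets ?\<mu> = sets tempered_borel" by simp
  moreover have "linear_into_L2 lborel ?Q"
    unfolding linear_into_L2_def
  proof (intro conjI ballI allI AE_I2)
    fix \<psi> :: "real^'n \<Rightarrow> complex" assume \<psi>: "\<psi> \<in> schwartz"
    show "?Q \<psi> \<in> L2 lborel"
      by (intro complexify_L2 schwartz_L2 Q schwartz_Re_Im \<psi>)
    fix \<phi> :: "real^'n \<Rightarrow> complex" and a b y assume \<phi>: "\<phi> \<in> schwartz"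
    show "?Q (\<lambda>x. a * \<psi> x + b * \<phi> x) y = a * ?Q \<psi> y + b * ?Q \<phi> y"
      by (rule complexify_linear[OF _ \<psi> \<phi>]) (simp add: lin)
  qed
  moreover have "generalized_gaussian_process W ?X"
    unfolding generalized_gaussian_process_def
  proof (intro conjI allI impI)
    show "linear_into_L2 W ?X"
      unfolding linear_into_L2_def
    proof (intro conjI ballI allI AE_I2)
      fix \<psi> :: "real^'n \<Rightarrow> complex" assume \<psi>: "\<psi> \<in> schwartz"
      have evL2: "(\<lambda>\<omega>. \<omega> (Q \<phi>)) \<in> L2 W" if "\<phi> \<in> schwartz" for \<phi>
        using white_noise_gaussian(2)[OF W Q[OF that]] white_noise_eval_measurable[OF W Q[OF that]]
        by (simp add: L2_def)
      show "?X \<psi> \<in> L2 W"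
        by (intro complexify_L2[where L = "\<lambda>\<phi> \<omega>. \<omega> (Q \<phi>)"] evL2 schwartz_Re_Im \<psi>)
      fix \<phi> :: "real^'n \<Rightarrow> complex" and a b \<omega> assume \<phi>: "\<phi> \<in> schwartz" and \<omega>: "\<omega> \<in> space W"
      show "?X (\<lambda>x. a * \<psi> x + b * \<phi> x) \<omega> = a * ?X \<psi> \<omega> + b * ?X \<phi> \<omega>"
        by (rule complexify_linear[OF _ \<psi> \<phi>]) (rule Xlin[OF \<omega>])
    qed
    fix F :: "(real^'n \<Rightarrow> complex) set" assume F: "finite F \<and> F \<subseteq> schwartz"
    show "jointly_gaussian W (F \<times> {Re, Im}) (\<lambda>(\<psi>, part) y. part (?X \<psi> y))"
      unfolding jointly_gaussian_def
    proof
      fix c :: "(real^'n \<Rightarrow> complex) \<times> (complex \<Rightarrow> real) \<Rightarrow> real"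
      let ?I = "F \<times> {Re, Im}"
      \<comment> \<open>A combination of real and imaginary parts is itself an evaluation at a single Schwartz function.\<close>
      let ?q = "\<lambda>(\<psi>, part). Q (\<lambda>x. part (\<psi> x))"
      have I: "finite ?I" using F by simp
      have q: "?q i \<in> schwartz" if "i \<in> ?I" for i
        using that F by (auto intro!: Q schwartz_Re_Im)
      show "gaussian_rv W (\<lambda>\<omega>. \<Sum>i\<in>?I. c i * (\<lambda>(\<psi>, part) y. part (?X \<psi> y)) i \<omega>)"
      proof (rule gaussian_rv_cong[OF _ white_noise_gaussian(1)[OF W schwartz_sum[OF I q]]])
        fix \<omega> assume "\<omega> \<in> space W"
        then have "\<omega> (\<lambda>x. \<Sum>i\<in>?I. c i * ?q i x) = (\<Sum>i\<in>?I. c i * \<omega> (?q i))"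
          by (intro tempered_sum I q) (simp_all add: spaceW)
        also have "\<dots> = (\<Sum>i\<in>?I. c i * (\<lambda>(\<psi>, part) y. part (?X \<psi> y)) i \<omega>)"
          by (intro sum.cong) (auto simp: complexify_def)
        finally show "(\<Sum>i\<in>?I. c i * (\<lambda>(\<psi>, part) y. part (?X \<psi> y)) i \<omega>)
            = \<omega> (\<lambda>x. \<Sum>i\<in>?I. c i * ?q i x)" by simp
      qed
    qed
  qed
  moreover have "\<forall>\<psi>\<in>schwartz. AE \<omega> in W. ?X \<psi> \<omega> = tilde W (?Q \<psi>) \<omega>"
  proof
    fix \<psi> :: "real^'n \<Rightarrow> complex" assume \<psi>: "\<psi> \<in> schwartz"
    show "AE \<omega> in W. ?X \<psi> \<omega> = tilde W (?Q \<psi>) \<omega>"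
      using tilde_real_schwartz[OF W Q[OF schwartz_Re_Im(1)[OF \<psi>]]]
        tilde_real_schwartz[OF W Q[OF schwartz_Re_Im(2)[OF \<psi>]]]
      by eventually_elim (simp add: tilde_def complexify_def Complex_eq)
  qed
  moreover have "\<forall>\<psi>\<in>(schwartz :: (real^'n \<Rightarrow> real) set).
        (\<integral>\<omega>. exp (\<i> * ?X (\<lambda>x. complex_of_real (\<psi> x)) \<omega>) \<partial>W) =
          (\<integral>\<omega>. exp (\<i> * complex_of_real (\<omega> \<psi>)) \<partial>?\<mu>) \<and>
        (\<integral>\<omega>. exp (\<i> * complex_of_real (\<omega> \<psi>)) \<partial>?\<mu>) =
          complex_of_real
            (exp (- (l2_norm \<sigma> (fourier (\<lambda>x. complex_of_real (\<psi> x))))\<^sup>2 / 2))"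
  proof
    fix \<psi> :: "real^'n \<Rightarrow> real" assume \<psi>: "\<psi> \<in> schwartz"
    note [measurable] = tempered_eval_measurable[OF \<psi>]
    have mu: "(\<integral>\<omega>. exp (\<i> * complex_of_real (\<omega> \<psi>)) \<partial>?\<mu>) = (\<integral>\<omega>. exp (\<i> * complex_of_real (\<omega> (Q \<psi>))) \<partial>W)"
      using \<psi> by (subst integral_distr[OF D]) (simp_all add: D_def)
    have "?X (\<lambda>x. complex_of_real (\<psi> x)) \<omega> = complex_of_real (\<omega> (Q \<psi>))" if "\<omega> \<in> space W" for \<omega>
      using Xlin[OF that \<psi> \<psi>, of 0 0] by (simp add: complexify_def complex_eq_iff)
    then have "(\<integral>\<omega>. exp (\<i> * ?X (\<lambda>x. complex_of_real (\<psi> x)) \<omega>) \<partial>W) = (\<integral>\<omega>. exp (\<i> * complex_of_real (\<omega> (Q \<psi>))) \<partial>W)"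
      by (intro Bochner_Integration.integral_cong) simp_all
    moreover have "\<dots> = complex_of_real (exp (- (l2_norm lborel (Q \<psi>))\<^sup>2 / 2))"
      using W Q[OF \<psi>] by (simp add: white_noise_measure_def)
    ultimately show "(\<integral>\<omega>. exp (\<i> * ?X (\<lambda>x. complex_of_real (\<psi> x)) \<omega>) \<partial>W) =
          (\<integral>\<omega>. exp (\<i> * complex_of_real (\<omega> \<psi>)) \<partial>?\<mu>) \<and>
        (\<integral>\<omega>. exp (\<i> * complex_of_real (\<omega> \<psi>)) \<partial>?\<mu>) =
          complex_of_real (exp (- (l2_norm \<sigma> (fourier (\<lambda>x. complex_of_real (\<psi> x))))\<^sup>2 / 2))"
      unfolding mu norm[OF \<psi>] fourier_real_def by simp
  qed
  ultimately show ?thesis by blast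
qed

end
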